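(* Let $d\in\{2,3,\dots\}$, $\mu\in[0,\infty)$, $\gamma\in[-\frac12,\infty)$, and $\alpha:=\mu+\frac{d-1}{2}$. Let $h_\tau\big(W_{\mu,\gamma};(x,t),(y,s)\big)$ be the Jacobi heat kernel on the cone $\mathbb{V}^{d+1}$. Then there is a constant $C\ge 1$, depending only on $d,\mu,\gamma$, such that for all $(x,t),(y,s)\in\mathbb{V}^{d+1}$ the following hold. (i) For every $\tau\in(0,4]$, $$C^{-1}\,K_\tau\big((x,t),(y,s)\big)\le h_\tau\big(W_{\mu,\gamma};(x,t),(y,s)\big)\le C\,K_\tau\big((x,t),(y,s)\big),$$ where $$\begin{aligned}K_\tau\big((x,t),(y,s)\big):={}&\tau^{-\alpha+\mu-1}\big(\sqrt{1-t}\sqrt{1-s}\vee\tau\big)^{-\gamma-\frac12}\big(\sqrt{st+\langle x,y\rangle}\vee\tau\big)^{-\alpha}\\&\times\Big(\sqrt{(t^2-\|x\|^2)(s^2-\|y\|^2)(st+\langle x,y\rangle)^{-1}}\vee\tau\Big)^{-\mu}\exp\Big\{-\tfrac1\tau\,\mathrm{dist}^2_{\mathbb{V}^{d+1}}\big((x,t),(y,s)\big)\Big\}.\end{aligned}$$ (ii) For every $\tau\in[4,\infty)$, $\;C^{-1}\le h_\tau\big(W_{\mu,\gamma};(x,t),(y,s)\big)\le C$.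
   Context: Notation: $a\vee b=\max(a,b)$; $\langle\cdot,\cdot\rangle$ and $\|\cdot\|$ are the Euclidean inner product and norm on $\mathbb{R}^d$. The cone is $\mathbb{V}^{d+1}:=\{(x,t)\in\mathbb{R}^d\times\mathbb{R}:\ \|x\|\le t,\ t\in[0,1]\}$. For $(x,t),(y,s)\in\mathbb{V}^{d+1}$ one has $st+\langle x,y\rangle\ge 0$; when $st+\langle x,y\rangle=0$, also $(t^2-\|x\|^2)(s^2-\|y\|^2)=0$, and the expression $\sqrt{(t^2-\|x\|^2)(s^2-\|y\|^2)(st+\langle x,y\rangle)^{-1}}$ is read as $0$. Distance: $$\mathrm{dist}_{\mathbb{V}^{d+1}}\big((x,t),(y,s)\big):=\arccos\Big(\sqrt{\tfrac12\big(st+\langle x,y\rangle+\sqrt{t^2-\|x\|^2}\sqrt{s^2-\|y\|^2}\big)}+\sqrt{1-t}\sqrt{1-s}\Big).$$ Measures on $[-1,1]$: for $\nu>-\frac12$, $\mathrm{d}\Pi_\nu(w):=c_\nu(1-w^2)^{\nu-\frac12}\,\mathrm{d}w$ with $c_\nu$ chosen so that $\Pi_\nu$ is a probability measure; $\Pi_{-1/2}:=\frac12(\delta_{-1}+\delta_1)$. Special functions: for $n\in\{0,1,\dots\}$, $\lambda\in[0,\infty)$, $w\in[-1,1]$, $$Z_n^{\lambda+\frac12}(w):=\frac{P_n^{\lambda,\lambda}(1)\,P_n^{\lambda,\lambda}(w)}{h_n^{\lambda,\lambda}},$$ where $P_n^{\lambda,\lambda}$ is the classical Jacobi polynomial of degree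 $n$ on $[-1,1]$ with both parameters equal to $\lambda$, and $h_n^{\lambda,\lambda}$ is the square of its norm in $L^2([-1,1],\mathrm{d}\Pi_{\lambda+\frac12})$. Put $$\xi(x,t,y,s;u,v_1,v_2):=v_1\sqrt{\tfrac12\big(st+\langle x,y\rangle+\sqrt{t^2-\|x\|^2}\sqrt{s^2-\|y\|^2}\,u\big)}+v_2\sqrt{1-t}\sqrt{1-s},$$ which lies in $[-1,1]$ for $u,v_1,v_2\in[-1,1]$. With $\alpha:=\mu+\frac{d-1}2$, set $$P_n\big(W_{\mu,\gamma};(x,t),(y,s)\big):=\int_{[-1,1]^3}Z_{2n}^{2\alpha+\gamma+1}\big(\xi(x,t,y,s;u,v_1,v_2)\big)\,\mathrm{d}\Pi_{\mu-\frac12}(u)\,\mathrm{d}\Pi_{\alpha-\frac12}(v_1)\,\mathrm{d}\Pi_\gamma(v_2).$$ (This is the reproducing kernel of the space of orthogonal polynomials of degree $n$ on $\mathbb{V}^{d+1}$ for the weight $W_{\mu,\gamma}(x,t)=(t^2-\|x\|^2)^{\mu-\frac12}(1-t)^\gamma$ normalized to be a probability measure.) The Jacobi heat kernel on $\mathbb{V}^{d+1}$ is, for $\tau\in(0,\infty)$, $$h_\tau\big(W_{\mu,\gamma};(x,t),(y,s)\big):=\sum_{n=0}^\infty e^{-\tau n(n+2\mu+\gamma+d)}\,P_n\big(W_{\mu,\gamma};(x,t),(y,s)\big).$$ *)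

theory Defs
  imports "HOL-Probability.Probability"
begin

text \<open>
  The Euclidean space of dimension \<open>d\<close> is \<^typ>\<open>real ^ 'd\<close>, with \<open>d = CARD('d)\<close>.
\<close>

definition solid_cone :: "((real ^ 'd) \<times> real) set" where
  "solid_cone = {(x, t). norm x \<le> t \<and> t \<in> {0..1}}"

definition cone_dist :: "(real ^ 'd) \<times> real \<Rightarrow> (real ^ 'd) \<times> real \<Rightarrow> real" where
  "cone_dist = (\<lambda>(x, t) (y, s).
     arccos (sqrt ((s * t + x \<bullet> y + sqrt (t\<^sup>2 - (norm x)\<^sup>2) * sqrt (s\<^sup>2 - (norm y)\<^sup>2)) / 2)
             + sqrt (1 - t) * sqrt (1 - s)))"

definition Pi_const :: "real \<Rightarrow> real" where
  "Pi_const \<nu> = 1 / (LBINT w:{-1..1}. (1 - w\<^sup>2) powr (\<nu> - 1/2))"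

text \<open>
  \<open>\<Pi>\<^sub>\<nu>\<close> for \<open>\<nu> \<ge> -1/2\<close>, as a Borel measure on the whole line that is concentrated on
  \<open>[-1,1]\<close>; for \<open>\<nu> = -1/2\<close> it gives mass \<open>1/2\<close> to each of \<open>-1\<close> and \<open>1\<close>.
\<close>

definition Pi_measure :: "real \<Rightarrow> real measure" where
  "Pi_measure \<nu> =
     (if \<nu> = -1/2 then distr (measure_pmf (pmf_of_set {-1, 1})) borel (\<lambda>w. w)
      else density lborel
        (\<lambda>w. ennreal (indicator {-1..1} w * (Pi_const \<nu> * (1 - w\<^sup>2) powr (\<nu> - 1/2)))))"

lemma emeasure_Pi_measure_minus_half:
  assumes "A \<in> sets borel"
  shows "emeasure (Pi_measure (-1/2)) A = ennreal ((indicator A (-1) + indicator A 1) / 2)"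
proof -
  have "emeasure (Pi_measure (-1/2)) A = emeasure (measure_pmf (pmf_of_set {-1, 1})) A"
    using assms by (simp add: Pi_measure_def emeasure_distr)
  also have "\<dots> = ennreal (real (card ({-1, 1} \<inter> A)) / 2)"
    by (subst emeasure_pmf_of_set) auto
  also have "\<dots> = ennreal ((indicator A (-1) + indicator A 1) / 2)"
    by (cases "-1 \<in> A"; cases "1 \<in> A") auto
  finally show ?thesis .
qed

lemma Pi_weight_has_integral:
  fixes \<nu> :: real
  assumes "\<nu> > -1/2"
  shows "((\<lambda>w. (1 - w\<^sup>2) powr (\<nu> - 1/2)) has_integral 4 powr (\<nu> - 1/2) * 2 * Beta (\<nu> + 1/2) (\<nu> + 1/2)) {-1..1}"
proof -
  let ?a = "\<nu> + 1/2"
  have "((\<lambda>t. t powr (?a - 1) * (1 - t) powr (?a - 1)) has_integral Beta ?a ?a) (cbox 0 1)"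
    using has_integral_Beta_real[of ?a ?a] assms by simp
  from has_integral_affinity[OF this, of "1/2" "1/2"]
  have "((\<lambda>x. ((x + 1) / 2) powr (?a - 1) * (1 - (x + 1) / 2) powr (?a - 1)) has_integral 2 * Beta ?a ?a)
     ((\<lambda>x. 2 * x - 1) ` {0..1})"
    by (simp add: algebra_simps add_divide_distrib)
  also have "(\<lambda>x::real. 2 * x - 1) ` {0..1} = {-1..1}"
    using image_affinity_atLeastAtMost[of 2 "-1" 0 "1::real"] by simp
  finally have "((\<lambda>x. 4 powr (\<nu> - 1/2) * (((x + 1) / 2) powr (?a - 1) * (1 - (x + 1) / 2) powr (?a - 1))) 
      has_integral 4 powr (\<nu> - 1/2) * (2 * Beta ?a ?a)) {-1..1}"
    by (rule has_integral_mult_right)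
  then show ?thesis
  proof (subst has_integral_cong)
    fix x :: real assume x: "x \<in> {-1..1}"
    have "1 - x\<^sup>2 = 4 * (((x + 1) / 2) * (1 - (x + 1) / 2))"
      by (simp add: field_simps power2_eq_square)
    also have "\<dots> powr (\<nu> - 1/2) = 4 powr (\<nu> - 1/2) * (((x + 1) / 2) powr (\<nu> - 1/2) * (1 - (x + 1) / 2) powr (\<nu> - 1/2))"
      using x by (simp only: powr_mult)
    finally show "(1 - x\<^sup>2) powr (\<nu> - 1/2) = 4 powr (\<nu> - 1/2) * (((x + 1) / 2) powr (?a - 1) * (1 - (x + 1) / 2) powr (?a - 1))" by simp
  qed (simp add: mult.assoc)
qed

lemma prob_space_Pi_measure:
  assumes "\<nu> \<ge> -1/2"
  shows "prob_space (Pi_measure \<nu>)"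
proof (cases "\<nu> = -1/2")
  case True
  then show ?thesis
    by (auto simp: Pi_measure_def intro!: prob_space.prob_space_distr prob_space_measure_pmf)
next
  case False
  with assms have nu: "\<nu> > -1/2" by simp
  let ?f = "\<lambda>w::real. (1 - w\<^sup>2) powr (\<nu> - 1/2)"
  let ?I = "4 powr (\<nu> - 1/2) * 2 * Beta (\<nu> + 1/2) (\<nu> + 1/2)"
  have pos: "?I > 0" using nu by (auto simp: Beta_def intro!: mult_pos_pos divide_pos_pos Gamma_real_pos)
  have "((\<lambda>w. if w \<in> {-1..1} then ?f w else 0) has_integral ?I) UNIV"
    using Pi_weight_has_integral[OF nu] by (subst has_integral_restrict_UNIV)
  then have nn: "nn_integral lborel (\<lambda>w. ennreal (if w \<in> {-1..1} then ?f w else 0)) = ennreal ?I"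
    by (intro nn_integral_has_integral_lborel) auto
  have bi: "has_bochner_integral lborel (\<lambda>w. if w \<in> {-1..1} then ?f w else 0) ?I"
    using nn pos by (intro has_bochner_integral_nn_integral) auto
  have "Pi_const \<nu> = 1 / (LINT w|lborel. (if w \<in> {-1..1} then ?f w else 0))"
    unfolding Pi_const_def set_lebesgue_integral_def
    by (rule arg_cong[of _ _ "\<lambda>x. 1 / x"], rule Bochner_Integration.integral_cong) auto
  then have c: "Pi_const \<nu> = 1 / ?I"
    using has_bochner_integral_integral_eq[OF bi] by simp
  have "emeasure (Pi_measure \<nu>) UNIV
      = (\<integral>\<^sup>+w. ennreal (indicator {-1..1} w * (Pi_const \<nu> * ?f w)) \<partial>lborel)"
    using False by (simp add: Pi_measure_def emeasure_density)
  also have "\<dots> = (\<integral>\<^sup>+w. ennreal (1 / ?I) * ennreal (if w \<in> {-1..1} then ?f w else 0) \<partial>lborel)"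
    using pos unfolding c by (intro nn_integral_cong) (auto simp flip: ennreal_mult)
  also have "\<dots> = ennreal (1 / ?I) * ennreal ?I"
    by (subst nn_integral_cmult, measurable) (simp only: nn)
  also have "\<dots> = ennreal (1 / ?I * ?I)"
    using pos by (intro ennreal_mult[symmetric]) auto
  also have "1 / ?I * ?I = 1"
    by (rule nonzero_eq_divide_eq[OF less_imp_neq[OF pos, symmetric], THEN iffD1, OF refl])
  finally have "emeasure (Pi_measure \<nu>) UNIV = 1"
    by simp
  then show ?thesis
    using False by (intro prob_spaceI) (simp add: Pi_measure_def)
qed

text \<open>
  The Jacobi polynomial of degree \<open>n\<close> with parameters \<open>a, b > -1\<close> in its classical
  normalization, with value \<open>(n + a) gchoose n\<close> at \<open>1\<close>
  (Szego, Orthogonal Polynomials, (4.3.2)).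
\<close>

definition jacobi_poly :: "nat \<Rightarrow> real \<Rightarrow> real \<Rightarrow> real \<Rightarrow> real" where
  "jacobi_poly n a b w =
     (\<Sum>k\<le>n. ((real n + a) gchoose (n - k)) * ((real n + b) gchoose k)
             * ((w - 1) / 2) ^ k * ((w + 1) / 2) ^ (n - k))"

lemma jacobi_poly_at_1: "jacobi_poly n a b 1 = (real n + a) gchoose n"
proof -
  have "jacobi_poly n a b 1 = (\<Sum>k\<le>n. if k = 0 then (real n + a) gchoose n else 0)"
    unfolding jacobi_poly_def by (intro sum.cong) (auto simp: power_0_left)
  then show ?thesis by simp
qed

definition jacobi_norm_sq :: "nat \<Rightarrow> real \<Rightarrow> real" where
  "jacobi_norm_sq n a = (LINT w:{-1..1}|Pi_measure (a + 1/2). (jacobi_poly n a a w)\<^sup>2)"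

text \<open>
  \<open>zonal n \<kappa>\<close> is \<open>Z\<^sub>n\<close> with superscript \<open>\<kappa>\<close>, which exceeds the Jacobi parameter by \<open>1/2\<close>.
\<close>

definition zonal :: "nat \<Rightarrow> real \<Rightarrow> real \<Rightarrow> real" where
  "zonal n \<kappa> w = (let a = \<kappa> - 1/2 in
     jacobi_poly n a a 1 * jacobi_poly n a a w / jacobi_norm_sq n a)"

definition cone_xi ::
  "(real ^ 'd) \<times> real \<Rightarrow> (real ^ 'd) \<times> real \<Rightarrow> real \<Rightarrow> real \<Rightarrow> real \<Rightarrow> real" where
  "cone_xi = (\<lambda>(x, t) (y, s) u v1 v2.
     v1 * sqrt ((s * t + x \<bullet> y + sqrt (t\<^sup>2 - (norm x)\<^sup>2) * sqrt (s\<^sup>2 - (norm y)\<^sup>2) * u) / 2)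
     + v2 * sqrt (1 - t) * sqrt (1 - s))"

definition cone_alpha :: "'d::finite itself \<Rightarrow> real \<Rightarrow> real" where
  "cone_alpha _ \<mu> = \<mu> + (real CARD('d) - 1) / 2"

definition cone_P ::
  "nat \<Rightarrow> real \<Rightarrow> real \<Rightarrow> (real ^ 'd::finite) \<times> real \<Rightarrow> (real ^ 'd) \<times> real \<Rightarrow> real" where
  "cone_P n \<mu> \<gamma> p q = (let \<alpha> = cone_alpha TYPE('d) \<mu> in
     LINT (u, v1, v2):{-1..1} \<times> {-1..1} \<times> {-1..1}
       |Pi_measure (\<mu> - 1/2) \<Otimes>\<^sub>M (Pi_measure (\<alpha> - 1/2) \<Otimes>\<^sub>M Pi_measure \<gamma>).
         zonal (2 * n) (2 * \<alpha> + \<gamma> + 1) (cone_xi p q u v1 v2))"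

definition cone_heat_kernel ::
  "real \<Rightarrow> real \<Rightarrow> real \<Rightarrow> (real ^ 'd::finite) \<times> real \<Rightarrow> (real ^ 'd) \<times> real \<Rightarrow> real" where
  "cone_heat_kernel \<mu> \<gamma> \<tau> p q =
     (\<Sum>n. exp (- \<tau> * real n * (real n + 2 * \<mu> + \<gamma> + real CARD('d))) * cone_P n \<mu> \<gamma> p q)"

text \<open>
  When \<open>s * t + x \<bullet> y = 0\<close>, the quotient below is \<open>0\<close> because division by zero yields \<open>0\<close>,
  which is the intended reading of that degenerate case. All bases of \<open>powr\<close> are at least
  \<open>\<tau> > 0\<close>.
\<close>

definition cone_K ::
  "real \<Rightarrow> real \<Rightarrow> real \<Rightarrow> (real ^ 'd::finite) \<times> real \<Rightarrow> (real ^ 'd) \<times> real \<Rightarrow> real" where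
  "cone_K \<mu> \<gamma> \<tau> = (\<lambda>(x, t) (y, s). let \<alpha> = cone_alpha TYPE('d) \<mu> in
     \<tau> powr (- \<alpha> + \<mu> - 1)
     * max (sqrt (1 - t) * sqrt (1 - s)) \<tau> powr (- \<gamma> - 1/2)
     * max (sqrt (s * t + x \<bullet> y)) \<tau> powr (- \<alpha>)
     * max (sqrt ((t\<^sup>2 - (norm x)\<^sup>2) * (s\<^sup>2 - (norm y)\<^sup>2) / (s * t + x \<bullet> y))) \<tau> powr (- \<mu>)
     * exp (- (1 / \<tau>) * (cone_dist (x, t) (y, s))\<^sup>2))"

end

theory Submission
  imports Defs
begin

text \<open>
  Let \<open>\<kappa> = 2\<alpha> + \<gamma> + 1\<close> and \<open>t = \<tau>/4\<close>. The kernel on the cone is the average over the cube, in the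
  variables \<open>u, v1, v2\<close>, of \<open>(G t \<xi> + G t (- \<xi>)) / 2\<close>, where
  \<open>G t w = (\<Sum>n. exp (- t n (n + 2\<kappa>)) * zonal n \<kappa> w)\<close> is the heat kernel with pole \<open>w = 1\<close> of a
  ``sphere of dimension \<open>2\<kappa> + 1\<close>''. In the polar angle \<open>r\<close> the generator is
  \<open>\<partial>\<^sub>r\<^sup>2 + 2\<kappa> cot r \<partial>\<^sub>r\<close>, and with \<open>m = \<kappa> + 1/2\<close> one checks directly that
  \<open>t powr (- m) * exp (- r\<^sup>2/4t)\<close> is a subsolution of the heat equation, while
  \<open>exp (\<kappa>\<^sup>2 t) * t powr (- m) * exp (- r\<^sup>2/4t) * (r / sin r) powr \<kappa>\<close> and
  \<open>exp (m\<^sup>2 t) * t powr (- m) * exp (- (1 - cos r)/2t)\<close> are supersolutions. Comparing them with the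
  evolution of polynomial approximations of a point mass, for which the heat flow is a finite sum,
  gives two-sided bounds for \<open>G\<close>. As \<open>r\<^sup>2\<close> is comparable with a linear function of \<open>cos r\<close>, these
  bounds sandwich \<open>G t \<xi>\<close>, for \<open>\<xi> \<le> X\<close> and \<open>X \<ge> 0\<close> the largest value of \<open>\<xi>\<close>, between multiples of
  \<open>t powr (- m) * exp (- arccos\<^sup>2 X / 4t) * exp (- k (X - \<xi>) / t)\<close> with two different values of \<open>k\<close>.
  The average of the last exponential factors into one-dimensional integrals
  \<open>\<integral> exp (- x (1 - v)) d\<Pi>\<^sub>\<nu>(v)\<close>, which are comparable to \<open>(1 + x) powr (- \<nu> - 1/2)\<close>.
\<close>

section \<open>Jacobi polynomials\<close>

text \<open>The exponent of dist^2 must be the same in both bounds, so nothing may be lost in the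
  Gaussian factor at X. A loss in the rate k that multiplies X - \<xi> is harmless: it changes the
  one-dimensional integrals only by constant factors. Two supersolutions are needed because r / sin
  r blows up at the antipode r = \<pi>. The first has the sharp Gaussian but helps only away from
  \<pi>; the second is regular there, and its cruder exponent is still good enough for r > 2\<pi>/3
  because X \<ge> 0 keeps arccos X below \<pi>/2. The kernel and the explicit functions are singular
  at time 0. Polynomials close to exp(-j(1 - w)) avoid this: their flow is bounded down to time 0,
  and the explicit function at time \<rho>/j has the matching width, with \<rho> fitted to each
  function. Both signs of \<xi> appear because only even degrees 2n occur on the cone, and the
  factor 4 in t = \<tau>/4 because 2n(2n + 2\<kappa>) = 4n(n + \<kappa>).\<close>

definition jacobi_coeff :: "nat \<Rightarrow> real \<Rightarrow> nat \<Rightarrow> real" where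
  "jacobi_coeff n a k = ((real n + a) gchoose (n - k)) * ((real n + a) gchoose k)"

text \<open>Kept as a \<open>real poly\<close>, so that \<open>pderiv\<close> and
  \<open>degree\<close> apply; the linear factors are (w - 1)/2 and (w + 1)/2.\<close>

definition jacobi :: "nat \<Rightarrow> real \<Rightarrow> real poly" where
  "jacobi n a = (\<Sum>k\<le>n. smult (jacobi_coeff n a k) ([:-1/2, 1/2:] ^ k * [:1/2, 1/2:] ^ (n - k)))"

lemma poly_jacobi: "poly (jacobi n a) w = jacobi_poly n a a w"
proof -
  have "w / 2 - 1 / 2 = (w - 1) / 2" "1 / 2 + w / 2 = (w + 1) / 2" by (simp_all add: field_simps)
  then show ?thesis
    unfolding jacobi_def jacobi_poly_def jacobi_coeff_def poly_sum
    by (intro sum.cong) (simp_all add: mult.assoc diff_divide_distrib add_divide_distrib add.commute)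
qed

lemma jacobi_coeff_pos:
  assumes "k \<le> n" "a > -1"
  shows "jacobi_coeff n a k > 0"
proof -
  have "(real n + a) gchoose j > 0" if "j \<le> n" for j
    using assms that by (auto simp: gbinomial_prod_rev intro!: divide_pos_pos prod_pos)
  then show ?thesis using assms by (simp add: jacobi_coeff_def)
qed

text \<open>One binomial factor moves up and the other down, each by the recursion for b gchoose j
  with b = n + a. This is the relation that lets the shifted sums in \<open>jacobi_ode\<close> be
  moved back to the diagonal.\<close>

lemma jacobi_coeff_Suc:
  assumes "k < n"
  shows "jacobi_coeff n a (Suc k) * (real (Suc k) * (real (Suc k) + a))
    = jacobi_coeff n a k * (real (n - k) * (real (n - k) + a))"
proof -
  define b where "b = real n + a"
  have s: "real (Suc j) * (b gchoose Suc j) = (b - real j) * (b gchoose j)" for j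
    using gbinomial_mult_1[of b j] by (simp add: algebra_simps)
  obtain m where m: "n = Suc (k + m)" using assms less_iff_Suc_add by blast
  have 1: "real (Suc k) * (b gchoose Suc k) = (b - real k) * (b gchoose k)" by (rule s)
  have 2: "real (Suc m) * (b gchoose Suc m) = (b - real m) * (b gchoose m)" by (rule s)
  have d: "n - k = Suc m" "n - Suc k = m" using m by auto
  have bb: "b - real m = real (Suc k) + a" "b - real k = real (n - k) + a"
    using m by (auto simp: b_def)
  have "jacobi_coeff n a (Suc k) * (real (Suc k) * (real (Suc k) + a)) =
    (real (Suc k) * (b gchoose Suc k)) * ((b - real m) * (b gchoose m))"
    unfolding jacobi_coeff_def d b_def[symmetric] bb by (simp add: mult_ac)
  also have "\<dots> = ((b - real k) * (b gchoose k)) * (real (Suc m) * (b gchoose Suc m))"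
    unfolding 1 2 ..
  also have "\<dots> = jacobi_coeff n a k * (real (n - k) * (real (n - k) + a))"
    unfolding jacobi_coeff_def b_def[symmetric] bb d by (simp add: mult_ac)
  finally show ?thesis .
qed

text \<open>With w = X + Y and 1 - w^2 = -4XY the operator is homogeneous: it maps X^i Y^j to
  monomials of the same total degree, moving at most one unit between the exponents. The truncated
  exponents i - 1 and j - 1 are harmless because of the factors i and j in front.\<close>

lemma jacobi_basis_ode:
  fixes a w :: real and i j :: nat
  defines "p \<equiv> [:-1/2, 1/2:] ^ i * [:1/2, 1/2:] ^ j"
  defines "X \<equiv> (w - 1) / 2" and "Y \<equiv> (w + 1) / 2"
  shows "(1 - w\<^sup>2) * poly (pderiv (pderiv p)) w - (2 * a + 2) * w * poly (pderiv p) w =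
    - (real i * (real i + a) * (X ^ (i - 1) * Y ^ (j + 1))
      + (2 * real i * real j + (a + 1) * real (i + j)) * (X ^ i * Y ^ j)
      + real j * (real j + a) * (X ^ (i + 1) * Y ^ (j - 1)))"
proof -
  define x y where "x = [:-1/2, 1/2::real:]" and "y = [:1/2, 1/2::real:]"
  have Y: "Y = X + 1" and w: "w = 2 * X + 1" by (simp_all add: X_def Y_def field_simps)
  have xX: "poly x w = X" and yY: "poly y w = Y"
    by (simp_all add: x_def y_def X_def Y_def field_simps)
  have dx: "pderiv x = [:1/2:]" and dy: "pderiv y = [:1/2:]"
    by (simp_all add: x_def y_def pderiv_pCons)
  have D: "pderiv (x ^ i * y ^ j) = smult (real i / 2) (x ^ (i - 1) * y ^ j) + smult (real j / 2) (x ^ i * y ^ (j - 1))"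
    for i j by (simp add: pderiv_mult pderiv_power dx dy mult_ac)
  have p: "p = x ^ i * y ^ j" by (simp add: p_def x_def y_def)
  define P1 P2 Q1 Q2 where "P1 = real i * X ^ (i - 1)" and "P2 = real i * (real (i - 1) * X ^ (i - 1 - 1))"
    and "Q1 = real j * Y ^ (j - 1)" and "Q2 = real j * (real (j - 1) * Y ^ (j - 1 - 1))"
  have aux: "Z * (real n * Z ^ (n - 1)) = real n * Z ^ n"
    "Z * (real n * (real (n - 1) * Z ^ (n - 1 - 1))) = (real n - 1) * (real n * Z ^ (n - 1))" for Z :: real and n
    by (cases n; cases "n - 1"; simp)+
  have h: "X * P1 = real i * X ^ i" "X * P2 = (real i - 1) * P1"
    "Y * Q1 = real j * Y ^ j" "Y * Q2 = (real j - 1) * Q1"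
    unfolding P1_def P2_def Q1_def Q2_def by (rule aux)+
  have d1: "2 * poly (pderiv p) w = P1 * Y ^ j + X ^ i * Q1"
    unfolding p D P1_def Q1_def by (simp add: xX yY field_simps)
  have d2: "4 * poly (pderiv (pderiv p)) w = P2 * Y ^ j + 2 * P1 * Q1 + X ^ i * Q2"
    unfolding p D pderiv_add pderiv_smult P1_def Q1_def P2_def Q2_def by (simp add: xX yY field_simps)
  have "(1 - w\<^sup>2) * poly (pderiv (pderiv p)) w - (2 * a + 2) * w * poly (pderiv p) w
    = - X * Y * (4 * poly (pderiv (pderiv p)) w) - (a + 1) * (X + Y) * (2 * poly (pderiv p) w)"
    unfolding w Y by (simp add: field_simps power2_eq_square)
  also have "\<dots> = - (Y * Y ^ j) * (X * P2) - 2 * (X * P1) * (Y * Q1) - (X * X ^ i) * (Y * Q2)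
    - (a + 1) * ((X * P1) * Y ^ j + (Y * Y ^ j) * P1 + (X * X ^ i) * Q1 + X ^ i * (Y * Q1))"
    unfolding d1 d2 by (simp add: algebra_simps)
  also have "\<dots> = - ((real i + a) * (P1 * (Y * Y ^ j))
      + (2 * real i * real j + (a + 1) * real (i + j)) * (X ^ i * Y ^ j)
      + (real j + a) * (X * X ^ i * Q1))"
    unfolding h by (simp add: algebra_simps)
  finally show ?thesis
    unfolding P1_def Q1_def by (simp add: mult_ac)
qed

lemma jacobi_ode:
  "(1 - w\<^sup>2) * poly (pderiv (pderiv (jacobi n a))) w - (2 * a + 2) * w * poly (pderiv (jacobi n a)) w
    + real n * (real n + 2 * a + 1) * poly (jacobi n a) w = 0"
proof -
  define X Y where "X = (w - 1) / 2" and "Y = (w + 1) / 2"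
  define c where "c = jacobi_coeff n a"
  define b where "b k = [:-1/2, 1/2:] ^ k * [:1/2, 1/2::real:] ^ (n - k)" for k
  define L where "L p = (1 - w\<^sup>2) * poly (pderiv (pderiv p)) w - (2 * a + 2) * w * poly (pderiv p) w" for p
  have pb: "poly (b k) w = X ^ k * Y ^ (n - k)" for k
    by (simp add: b_def X_def Y_def diff_divide_distrib add_divide_distrib add.commute)
  have Lb: "L (b k) = - (real k * (real k + a) * (X ^ (k - 1) * Y ^ (n - k + 1))
      + (2 * real k * real (n - k) + (a + 1) * real n) * (X ^ k * Y ^ (n - k))
      + real (n - k) * (real (n - k) + a) * (X ^ (k + 1) * Y ^ (n - k - 1)))" if "k \<le> n" for k
    using jacobi_basis_ode[where i = k and j = "n - k" and a = a and w = w] that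
    unfolding L_def b_def X_def Y_def by simp
  define U where "U = (\<Sum>k\<le>n. c k * (real k * (real k + a)) * (X ^ (k - 1) * Y ^ (n - k + 1)))"
  define V where "V = (\<Sum>k\<le>n. c k * (real (n - k) * (real (n - k) + a)) * (X ^ (k + 1) * Y ^ (n - k - 1)))"
  have U: "U = (\<Sum>k\<le>n. c k * (real (n - k) * (real (n - k) + a)) * (X ^ k * Y ^ (n - k)))"
  proof (cases n)
    case 0 then show ?thesis by (simp add: U_def)
  next
    case (Suc m)
    have "U = (\<Sum>k\<le>m. c (Suc k) * (real (Suc k) * (real (Suc k) + a)) * (X ^ k * Y ^ (n - Suc k + 1)))"
      unfolding U_def Suc sum.atMost_Suc_shift by simp
    also have "\<dots> = (\<Sum>k\<le>m. c k * (real (n - k) * (real (n - k) + a)) * (X ^ k * Y ^ (n - k)))"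
      using jacobi_coeff_Suc[of _ n a] unfolding c_def
      by (intro sum.cong refl) (simp add: Suc Suc_diff_le del: of_nat_Suc)
    also have "\<dots> = (\<Sum>k\<le>n. c k * (real (n - k) * (real (n - k) + a)) * (X ^ k * Y ^ (n - k)))"
      by (simp add: Suc)
    finally show ?thesis .
  qed
  have V: "V = (\<Sum>k\<le>n. c k * (real k * (real k + a)) * (X ^ k * Y ^ (n - k)))"
  proof (cases n)
    case 0 then show ?thesis by (simp add: V_def)
  next
    case (Suc m)
    have "V = (\<Sum>k\<le>m. c k * (real (n - k) * (real (n - k) + a)) * (X ^ (k + 1) * Y ^ (n - k - 1)))"
      by (simp add: V_def Suc)
    also have "\<dots> = (\<Sum>k\<le>m. c (Suc k) * (real (Suc k) * (real (Suc k) + a)) * (X ^ Suc k * Y ^ (n - Suc k)))"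
      using jacobi_coeff_Suc[of _ n a] unfolding c_def
      by (intro sum.cong refl) (simp add: Suc del: of_nat_Suc)
    also have "\<dots> = (\<Sum>k\<le>n. c k * (real k * (real k + a)) * (X ^ k * Y ^ (n - k)))"
      unfolding Suc sum.atMost_Suc_shift by simp
    finally show ?thesis .
  qed
  have pderiv_sum: "pderiv (sum f {..n}) = (\<Sum>k\<le>n. pderiv (f k))" for n and f :: "nat \<Rightarrow> real poly"
    by (induction n) (simp_all add: pderiv_add)
  have L: "L (jacobi n a) = (\<Sum>k\<le>n. c k * L (b k))"
    unfolding L_def jacobi_def c_def b_def pderiv_sum pderiv_smult poly_sum poly_smult
    by (simp add: sum_distrib_left sum_subtractf right_diff_distrib mult_ac)
  have P: "poly (jacobi n a) w = (\<Sum>k\<le>n. c k * (X ^ k * Y ^ (n - k)))"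
    unfolding jacobi_def poly_sum poly_smult c_def[symmetric] b_def[symmetric] pb ..
  define W where "W = (\<Sum>k\<le>n. c k * ((2 * real k * real (n - k) + (a + 1) * real n) * (X ^ k * Y ^ (n - k))))"
  have "L (jacobi n a) = (\<Sum>k\<le>n. - (c k * (real k * (real k + a)) * (X ^ (k - 1) * Y ^ (n - k + 1)))
      - c k * ((2 * real k * real (n - k) + (a + 1) * real n) * (X ^ k * Y ^ (n - k)))
      - c k * (real (n - k) * (real (n - k) + a)) * (X ^ (k + 1) * Y ^ (n - k - 1)))"
    unfolding L by (intro sum.cong refl) (simp add: Lb algebra_simps)
  also have "\<dots> = - U - W - V"
    unfolding U_def V_def W_def by (simp add: sum_subtractf sum_negf)
  \<comment> \<open>All three sums now carry X^k Y^(n-k), and for every k the weights add up to the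
    eigenvalue: k(k+a) + 2k(n-k) + (a+1)n + (n-k)(n-k+a) = n(n+2a+1).\<close>
  also have "\<dots> = (\<Sum>k\<le>n. - (real n * (real n + 2 * a + 1)) * (c k * (X ^ k * Y ^ (n - k))))"
    unfolding U V W_def sum_subtractf[symmetric] sum_negf[symmetric]
    by (intro sum.cong refl) (auto simp: of_nat_diff algebra_simps)
  also have "\<dots> = - (real n * (real n + 2 * a + 1)) * poly (jacobi n a) w"
    unfolding P sum_distrib_left ..
  finally show ?thesis unfolding L_def by simp
qed

text \<open>The reflection exchanges the two linear factors up to sign, and equal parameters make
  the coefficients symmetric under k -> n - k.\<close>

lemma jacobi_minus: "poly (jacobi n a) (- w) = (- 1) ^ n * poly (jacobi n a) w"
proof -
  have "poly (jacobi n a) (- w) = (\<Sum>k\<le>n. jacobi_coeff n a (n - k) * ((- w - 1) / 2) ^ (n - k) * ((- w + 1) / 2) ^ k)"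
    unfolding poly_jacobi jacobi_poly_def jacobi_coeff_def
    by (subst sum.atLeastAtMost_rev[of _ 0 n, simplified atMost_atLeast0[symmetric]]) simp
  also have "\<dots> = (\<Sum>k\<le>n. (- 1) ^ n * (jacobi_coeff n a k * ((w - 1) / 2) ^ k * ((w + 1) / 2) ^ (n - k)))"
  proof (intro sum.cong refl)
    fix k assume "k \<in> {..n}"
    then have k: "k \<le> n" by simp
    have "((- w - 1) / 2) = (-1) * ((w + 1) / 2)" "((- w + 1) / 2) = (-1) * ((w - 1) / 2)" by (simp_all add: field_simps)
    then have "((- w - 1) / 2) ^ (n - k) * ((- w + 1) / 2) ^ k
      = ((-1) ^ (n - k) * (-1) ^ k) * (((w - 1) / 2) ^ k * ((w + 1) / 2) ^ (n - k))"
      by (simp only: power_mult_distrib mult_ac)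
    also have "(-1) ^ (n - k) * (-1) ^ k = (-1 :: real) ^ n"
      using k by (simp flip: power_add)
    finally show "jacobi_coeff n a (n - k) * ((- w - 1) / 2) ^ (n - k) * ((- w + 1) / 2) ^ k =
      (- 1) ^ n * (jacobi_coeff n a k * ((w - 1) / 2) ^ k * ((w + 1) / 2) ^ (n - k))"
      using k by (simp add: jacobi_coeff_def mult_ac)
  qed
  also have "\<dots> = (- 1) ^ n * poly (jacobi n a) w"
    by (simp add: poly_jacobi jacobi_poly_def jacobi_coeff_def sum_distrib_left)
  finally show ?thesis .
qed

lemma jacobi_at_1_pos:
  assumes "a > -1"
  shows "poly (jacobi n a) 1 > 0"
  using assms unfolding poly_jacobi jacobi_poly_at_1
  by (auto simp: gbinomial_prod_rev intro!: divide_pos_pos prod_pos)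

text \<open>Every summand has degree exactly n and a positive leading coefficient, so nothing
  cancels.\<close>

lemma degree_jacobi:
  assumes "a > -1"
  shows "degree (jacobi n a) = n"
proof -
  have deg: "degree ([:-1/2, 1/2:] ^ k * [:1/2, 1/2::real:] ^ (n - k)) = n" if "k \<le> n" for k
    using that by (simp add: degree_mult_eq degree_power_eq)
  have "coeff ([:-1/2, 1/2:] ^ k * [:1/2, 1/2::real:] ^ (n - k)) n = (1/2) ^ n" if "k \<le> n" for k
  proof -
    have "coeff ([:-1/2, 1/2:] ^ k * [:1/2, 1/2::real:] ^ (n - k)) n
      = lead_coeff ([:-1/2, 1/2:] ^ k * [:1/2, 1/2::real:] ^ (n - k))"
      using deg[OF that] by simp
    also have "\<dots> = (1/2) ^ k * (1/2) ^ (n - k)"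
      by (simp add: lead_coeff_mult lead_coeff_power)
    finally show ?thesis using that by (simp flip: power_add)
  qed
  then have "coeff (jacobi n a) n = (\<Sum>k\<le>n. jacobi_coeff n a k * (1/2) ^ n)"
    unfolding jacobi_def coeff_sum by (intro sum.cong) simp_all
  also have "\<dots> > 0"
    using assms by (intro sum_pos mult_pos_pos) (auto intro: jacobi_coeff_pos)
  finally have "n \<le> degree (jacobi n a)" by (simp add: le_degree)
  moreover have "degree (jacobi n a) \<le> n"
    unfolding jacobi_def using deg by (intro degree_sum_le) (auto intro: order_trans[OF degree_smult_le])
  ultimately show ?thesis by simp
qed

section \<open>A parabolic minimum principle\<close>

text \<open>If c were negative, f' would be negative just to the right of its zero x, and the mean
  value theorem would give a smaller value of f there.\<close>

lemma local_min_second_derivative_nonneg: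
  fixes f :: "real \<Rightarrow> real"
  assumes S: "open S" "x \<in> S" and min: "\<And>y. y \<in> S \<Longrightarrow> f x \<le> f y"
    and f': "\<And>y. y \<in> S \<Longrightarrow> (f has_real_derivative f' y) (at y)"
    and f'': "(f' has_real_derivative c) (at x)"
  shows "f' x = 0" "0 \<le> c"
proof -
  obtain d where d: "d > 0" "ball x d \<subseteq> S"
    using S openE by blast
  have inS: "y \<in> S" if "\<bar>x - y\<bar> < d" for y
    using d that by (auto simp: dist_real_def)
  show f'0: "f' x = 0"
    using inS by (intro DERIV_local_min[OF f'[OF S(2)] d(1)]) (auto intro: min)
  show "0 \<le> c"
  proof (rule ccontr)
    assume "\<not> 0 \<le> c"
    with DERIV_neg_dec_right[OF f''] obtain e where e: "e > 0" "\<And>h. 0 < h \<Longrightarrow> h < e \<Longrightarrow> f' (x + h) < 0"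
      by (auto simp: f'0)
    define h where "h = min d e / 2"
    have h: "0 < h" "h < d" "h < e" using d e by (auto simp: h_def)
    have "\<exists>z>x. z < x + h \<and> f (x + h) - f x = (x + h - x) * f' z"
    proof (rule MVT2)
      show "x < x + h" using h by simp
      show "(f has_real_derivative f' y) (at y)" if "x \<le> y" "y \<le> x + h" for y
        using that h by (intro f' inS) auto
    qed
    then obtain z where z: "x < z" "z < x + h" "f (x + h) - f x = h * f' z" by auto
    have "f' z < 0" using e(2)[of "z - x"] z h by auto
    then have "h * f' z < 0" using h by (simp add: mult_pos_neg)
    then have "f (x + h) < f x" using z by linarith
    moreover have "f x \<le> f (x + h)" using h by (intro min inS) auto
    ultimately show False by simp
  qed
qed

text \<open>
  The operator is the radial Laplacian of a sphere of dimension \<open>2 * \<kappa> + 1\<close>. The poles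
  are polar sets, so that no boundary condition is needed: this is what the barrier
  \<open>- ln (sin r)\<close> in the proof expresses.
\<close>

lemma parabolic_minimum_principle:
  fixes D Dt Dp Dpp :: "real \<Rightarrow> real \<Rightarrow> real" and \<kappa> T M :: real
  assumes \<kappa>: "\<kappa> \<ge> 1/2"
    and cont: "continuous_on ({0..T} \<times> {0<..<pi}) (\<lambda>(t, r). D t r)"
    and Dt: "\<And>t r. \<lbrakk>0 < t; t \<le> T; 0 < r; r < pi\<rbrakk> \<Longrightarrow> ((\<lambda>s. D s r) has_real_derivative Dt t r) (at t)"
    and Dp: "\<And>t r. \<lbrakk>0 < t; t \<le> T; 0 < r; r < pi\<rbrakk> \<Longrightarrow> (D t has_real_derivative Dp t r) (at r)"
    and Dpp: "\<And>t r. \<lbrakk>0 < t; t \<le> T; 0 < r; r < pi\<rbrakk> \<Longrightarrow> (Dp t has_real_derivative Dpp t r) (at r)"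
    and super: "\<And>t r. \<lbrakk>0 < t; t \<le> T; 0 < r; r < pi\<rbrakk> \<Longrightarrow>
      Dpp t r + 2 * \<kappa> * (cos r / sin r) * Dp t r \<le> Dt t r"
    and bdd: "\<And>t r. \<lbrakk>0 \<le> t; t \<le> T; 0 < r; r < pi\<rbrakk> \<Longrightarrow> - M \<le> D t r"
    and init: "\<And>r. \<lbrakk>0 < r; r < pi\<rbrakk> \<Longrightarrow> 0 \<le> D 0 r"
    and t0: "0 \<le> t0" "t0 \<le> T" and r0: "0 < r0" "r0 < pi"
  shows "0 \<le> D t0 r0"
proof (rule ccontr)
  assume "\<not> 0 \<le> D t0 r0"
  then have neg: "D t0 r0 < 0" by simp
  define H where "H r = - ln (sin r)" for r :: real
  have H: "0 \<le> H r" if "0 < r" "r < pi" for r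
    using sin_gt_zero[OF that] by (simp add: H_def)
  \<comment> \<open>So small that adding the barrier leaves \<open>E\<close> negative at (t0,
    r0).\<close>
  define \<epsilon> where "\<epsilon> = - D t0 r0 / (2 * (H r0 + (2 * \<kappa> + 1) * t0 + 1))"
  \<comment> \<open>The term linear in t makes the barrier strict: the heat operator maps H r +
    (2\<kappa> + 1) t to 1 + (2\<kappa> - 1)/(sin r)^2, which is positive for \<kappa> \<ge>
    1/2.\<close>
  define E where "E t r = D t r + \<epsilon> * (H r + (2 * \<kappa> + 1) * t)" for t r
  have d0: "H r0 + (2 * \<kappa> + 1) * t0 + 1 > 0"
    using H[OF r0] t0 \<kappa> by (simp add: add_nonneg_pos)
  have \<epsilon>: "\<epsilon> > 0" using neg d0 by (simp add: \<epsilon>_def divide_neg_pos)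
  have "\<epsilon> * (H r0 + (2 * \<kappa> + 1) * t0) < \<epsilon> * (2 * (H r0 + (2 * \<kappa> + 1) * t0 + 1))"
  proof (intro mult_strict_left_mono \<epsilon>)
    have "A < 2 * (A + 1)" if "A + 1 > 0" for A :: real using that by argo
    then show "H r0 + (2 * \<kappa> + 1) * t0 < 2 * (H r0 + (2 * \<kappa> + 1) * t0 + 1)" using d0 by blast
  qed
  also have "\<dots> = - D t0 r0" using d0 by (simp add: \<epsilon>_def)
  finally have Eneg: "E t0 r0 < 0" by (simp add: E_def)
  \<comment> \<open>Where sin r < \<eta>, the barrier exceeds \<bar>M\<bar> and outweighs the lower
    bound of D. Negative values of \<open>E\<close> are thus confined to the compact set
    \<open>K\<close>, on which a minimum is attained.\<close>
  define \<eta> where "\<eta> = exp (- (\<bar>M\<bar> / \<epsilon>))"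
  define K where "K = {0..pi} \<inter> sin -` {\<eta>..}"
  have "closed K" unfolding K_def
    by (intro closed_Int closed_vimage) (auto intro: continuous_intros)
  then have "compact K" unfolding K_def
    by (intro compact_Int_closed compact_Icc closed_vimage) (auto intro: continuous_intros)
  have Kpos: "0 < r \<and> r < pi" if "r \<in> K" for r
  proof -
    have "sin r > 0" using that by (auto simp: K_def \<eta>_def intro: less_le_trans[OF exp_gt_zero])
    then show ?thesis using that by (auto simp: K_def less_le)
  qed
  have out: "E t r \<ge> 0" if "0 \<le> t" "t \<le> T" "0 < r" "r < pi" "r \<notin> K" for t r
  proof -
    have s: "sin r > 0" using that by (simp add: sin_gt_zero)
    have "sin r < \<eta>" using that by (auto simp: K_def)
    then have "ln (sin r) < ln \<eta>" using s by (subst ln_less_cancel_iff) auto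
    then have "ln (sin r) \<le> - (\<bar>M\<bar> / \<epsilon>)" by (simp add: \<eta>_def)
    then have "\<epsilon> * (\<bar>M\<bar> / \<epsilon>) \<le> \<epsilon> * H r" using \<epsilon> by (intro mult_left_mono) (auto simp: H_def)
    then have "\<bar>M\<bar> \<le> \<epsilon> * H r" using \<epsilon> by simp
    moreover have "0 \<le> \<epsilon> * ((2 * \<kappa> + 1) * t)" using \<epsilon> \<kappa> that by simp
    ultimately show ?thesis using bdd[of t r] that by (simp add: E_def distrib_left)
  qed
  have r0K: "r0 \<in> K" using out[OF t0 r0] Eneg by auto
  have "continuous_on ({0..T} \<times> K) (\<lambda>p. (\<lambda>(t, r). D t r) p + \<epsilon> * (- ln (sin (snd p)) + (2 * \<kappa> + 1) * fst p))"
  proof (intro continuous_intros)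
    show "continuous_on ({0..T} \<times> K) (\<lambda>(t, r). D t r)"
      by (rule continuous_on_subset[OF cont]) (auto dest: Kpos)
    have "sin (snd p) > 0" if "p \<in> {0..T} \<times> K" for p
      using that Kpos[of "snd p"] by (intro sin_gt_zero) auto
    then show "\<forall>p\<in>{0..T} \<times> K. sin (snd p) \<noteq> 0" by force
  qed
  then have contE: "continuous_on ({0..T} \<times> K) (\<lambda>(t, r). E t r)"
    by (simp add: E_def H_def case_prod_unfold)
  have ne: "{0..T} \<times> K \<noteq> {}" using t0 r0K by auto
  from continuous_attains_inf[OF compact_Times[OF compact_Icc \<open>compact K\<close>] ne contE]
  obtain p where p: "p \<in> {0..T} \<times> K"
    "\<forall>q\<in>{0..T} \<times> K. (\<lambda>(t, r). E t r) p \<le> (\<lambda>(t, r). E t r) q"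
    by blast
  obtain t1 r1 where p1: "p = (t1, r1)" by (cases p)
  have 1: "t1 \<in> {0..T}" "r1 \<in> K" using p(1) by (auto simp: p1)
  have min: "E t1 r1 \<le> E t r" if "t \<in> {0..T}" "r \<in> K" for t r
    using bspec[OF p(2), of "(t, r)"] that by (simp add: p1)
  have neg1: "E t1 r1 < 0" using min[of t0 r0] t0 r0K Eneg by auto
  have gmin: "E t1 r1 \<le> E t r" if "0 \<le> t" "t \<le> T" "0 < r" "r < pi" for t r
    using min[of t r] out[OF that] neg1 that by (cases "r \<in> K") auto
  have r1: "0 < r1" "r1 < pi" using Kpos 1 by auto
  have s1: "sin r1 > 0" using r1 by (simp add: sin_gt_zero)
  have t1: "0 < t1" "t1 \<le> T"
  proof -
    have "t1 \<noteq> 0"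
    proof
      assume "t1 = 0"
      then have "E t1 r1 \<ge> 0" using init[OF r1] H[OF r1] \<epsilon> by (simp add: E_def)
      then show False using neg1 by simp
    qed
    then show "0 < t1" "t1 \<le> T" using 1 by auto
  qed
  define E1 where "E1 r = Dp t1 r - \<epsilon> * (cos r / sin r)" for r
  define E2 where "E2 = Dpp t1 r1 + \<epsilon> / (sin r1)\<^sup>2"
  have dE: "(E t1 has_real_derivative E1 r) (at r)" if "r \<in> {0<..<pi}" for r
    unfolding E_def H_def E1_def using that t1 sin_gt_zero[of r]
    by (auto intro!: derivative_eq_intros Dp)
  have dcot: "((\<lambda>r. cos r / sin r) has_real_derivative - 1 / (sin r1)\<^sup>2) (at r1)"
    using s1 by (auto intro!: derivative_eq_intros simp: power2_eq_square[symmetric] cos_squared_eq)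
  have dE1: "(E1 has_real_derivative E2) (at r1)"
    using DERIV_diff[OF Dpp[OF t1 r1] DERIV_cmult[OF dcot, of \<epsilon>]] by (simp add: E1_def[abs_def] E2_def)
  note loc = local_min_second_derivative_nonneg[of "{0<..<pi}" r1 "E t1" E1 E2]
  have E1: "E1 r1 = 0" and E2: "0 \<le> E2"
    using loc dE dE1 gmin t1 r1 by auto
  define Et where "Et = Dt t1 r1 + \<epsilon> * (2 * \<kappa> + 1)"
  have dEt: "((\<lambda>s. E s r1) has_real_derivative Et) (at t1)"
    unfolding E_def Et_def by (auto intro!: derivative_eq_intros Dt t1 r1)
  \<comment> \<open>The minimum may sit at t1 = T, so only earlier times can be compared; this gives
    a sign for the time derivative instead of its vanishing.\<close>
  have Et: "Et \<le> 0"
  proof (rule ccontr)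
    assume "\<not> Et \<le> 0"
    then obtain e where e: "e > 0" "\<And>h. 0 < h \<Longrightarrow> h < e \<Longrightarrow> E (t1 - h) r1 < E t1 r1"
      using DERIV_pos_inc_left[OF dEt] by auto
    define h where "h = min e t1 / 2"
    have "0 < h" "h < e" "h \<le> t1" using e t1 by (auto simp: h_def)
    then show False using e(2)[of h] gmin[of "t1 - h" r1] t1 r1 by auto
  qed
  have "Et - E2 - 2 * \<kappa> * (cos r1 / sin r1) * E1 r1 =
    Dt t1 r1 - Dpp t1 r1 - 2 * \<kappa> * (cos r1 / sin r1) * Dp t1 r1
    + \<epsilon> * (2 * \<kappa> + 1 - 1 / (sin r1)\<^sup>2 + 2 * \<kappa> * ((cos r1)\<^sup>2 / (sin r1)\<^sup>2))"
    unfolding Et_def E2_def E1_def using s1 by (simp add: field_simps power2_eq_square)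
  also have "2 * \<kappa> * ((cos r1)\<^sup>2 / (sin r1)\<^sup>2) = 2 * \<kappa> / (sin r1)\<^sup>2 - 2 * \<kappa>"
    using s1 by (simp add: cos_squared_eq field_simps)
  finally have "Et - E2 - 2 * \<kappa> * (cos r1 / sin r1) * E1 r1 \<ge> \<epsilon> * (1 + (2 * \<kappa> - 1) / (sin r1)\<^sup>2)"
    using super[OF t1 r1] by (simp add: diff_divide_distrib algebra_simps)
  moreover have "\<epsilon> * (1 + (2 * \<kappa> - 1) / (sin r1)\<^sup>2) > 0"
    using \<epsilon> \<kappa> by (intro mult_pos_pos add_pos_nonneg) auto
  ultimately show False using E1 E2 Et by simp
qed

section \<open>The measures on the interval\<close>

text \<open>1 + z \<le> M (1 + c z / q) \<le> M exp(c z / q) with M = max 1 (q / c), raised to the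
  power q.\<close>

lemma powr_le_exp:
  fixes c q :: real
  assumes "c > 0" "q \<ge> 0"
  obtains C where "C > 0" "\<And>z. z \<ge> 0 \<Longrightarrow> (1 + z) powr q \<le> C * exp (c * z)"
proof (cases "q = 0")
  case True
  have "(1 + z) powr q \<le> 1 * exp (c * z)" if "z \<ge> 0" for z using True that assms by simp
  then show ?thesis by (intro that[of 1]) auto
next
  case False
  then have q: "q > 0" using assms by simp
  define M where "M = max 1 (q / c)"
  have "(1 + z) powr q \<le> M powr q * exp (c * z)" if z: "z \<ge> 0" for z
  proof -
    have "z * 1 \<le> z * (M * (c / q))"
      using z q assms by (intro mult_left_mono) (auto simp: M_def max_def field_simps)
    then have "1 + z \<le> M * (1 + c * z / q)"
      by (auto simp: distrib_left M_def mult_ac add_mono)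
    also have "\<dots> \<le> M * exp (c * z / q)"
      by (intro mult_left_mono exp_ge_add_one_self) (auto simp: M_def)
    finally have "(1 + z) powr q \<le> (M * exp (c * z / q)) powr q"
      using z q by (intro powr_mono2) auto
    also have "\<dots> = M powr q * exp (c * z)"
      using q by (simp add: powr_mult M_def exp_powr_real)
    finally show ?thesis .
  qed
  moreover have "M powr q > 0" by (simp add: M_def)
  ultimately show ?thesis by (intro that)
qed

section \<open>Basic properties of the measures\<close>

lemma sets_Pi_measure [simp, measurable_cong]: "sets (Pi_measure \<nu>) = sets borel"
  by (simp add: Pi_measure_def)

lemma space_Pi_measure [simp]: "space (Pi_measure \<nu>) = UNIV"
  by (simp add: Pi_measure_def)

text \<open>Read off from the total mass 1: with a nonpositive constant, \<open>ennreal\<close>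
  would truncate the density to 0.\<close>

lemma Pi_const_pos:
  assumes "\<nu> > -1/2"
  shows "Pi_const \<nu> > 0"
proof (rule ccontr)
  assume neg: "\<not> Pi_const \<nu> > 0"
  interpret prob_space "Pi_measure \<nu>" using assms by (intro prob_space_Pi_measure) simp
  have "emeasure (Pi_measure \<nu>) UNIV = (\<integral>\<^sup>+w. 0 \<partial>lborel)"
    using assms neg unfolding Pi_measure_def
    by (simp add: emeasure_density)
      (intro nn_integral_0_iff_AE[THEN iffD2] AE_I2; auto simp: ennreal_eq_0_iff mult_nonpos_nonneg indicator_def)
  then show False using emeasure_space_1 by simp
qed

lemma nn_integral_Pi_measure:
  assumes "\<nu> > -1/2" and [measurable]: "f \<in> borel_measurable borel"
  shows "(\<integral>\<^sup>+w. f w \<partial>Pi_measure \<nu>)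
    = (\<integral>\<^sup>+w. ennreal (indicator {-1..1} w * (Pi_const \<nu> * (1 - w\<^sup>2) powr (\<nu> - 1/2))) * f w \<partial>lborel)"
  using assms by (simp add: Pi_measure_def nn_integral_density)

lemma Pi_measure_minus_half:
  "Pi_measure (-1/2) = distr (measure_pmf (pmf_of_set {-1, 1})) borel (\<lambda>w. w)"
  by (simp add: Pi_measure_def)

lemma AE_Pi_measure: "AE w in Pi_measure \<nu>. w \<in> {-1..1}"
proof (cases "\<nu> = -1/2")
  case True
  show ?thesis unfolding True Pi_measure_minus_half
    by (subst AE_distr_iff) (simp_all add: AE_measure_pmf_iff)
next
  case False
  show ?thesis unfolding Pi_measure_def if_not_P[OF False]
    by (subst AE_density) (auto simp: indicator_def)
qed

lemma integral_Pi_measure_minus: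
  fixes f :: "real \<Rightarrow> real"
  assumes [measurable]: "f \<in> borel_measurable borel" and "\<nu> \<ge> -1/2"
  shows "(LINT w|Pi_measure \<nu>. f (- w)) = (LINT w|Pi_measure \<nu>. f w)"
proof (cases "\<nu> = -1/2")
  case True
  have "(LINT w|Pi_measure \<nu>. g w) = (g (-1) + g 1) / 2" if [measurable]: "g \<in> borel_measurable borel" for g :: "real \<Rightarrow> real"
    unfolding True Pi_measure_minus_half by (simp add: integral_distr integral_pmf_of_set)
  from this[of f] this[of "\<lambda>w. f (- w)"] show ?thesis by simp
next
  case False
  define d where "d w = indicator {-1..1} w * (Pi_const \<nu> * (1 - w\<^sup>2) powr (\<nu> - 1/2))" for w :: real
  have [measurable]: "d \<in> borel_measurable borel" unfolding d_def by measurable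
  have d: "d (- w) = d w" for w by (auto simp: d_def indicator_def)
  have "d w \<ge> 0" for w using Pi_const_pos[of \<nu>] assms(2) False by (auto simp: d_def)
  then have *: "(LINT w|Pi_measure \<nu>. g w) = (LINT w|lborel. d w * g w)"
    if "g \<in> borel_measurable borel" for g :: "real \<Rightarrow> real"
    using that unfolding Pi_measure_def if_not_P[OF False] d_def[symmetric]
    by (simp add: integral_density)
  have "(LINT w|Pi_measure \<nu>. f (- w)) = (LINT w|lborel. d (- w) * f (- w))"
    by (subst *) (auto simp: d)
  also have "\<dots> = (LINT w|Pi_measure \<nu>. f w)"
    using lborel_integral_real_affine[of "-1" "\<lambda>w. d w * f w" 0] by (simp add: *)
  finally show ?thesis .
qed

text \<open>The factor (1 + v)^(p-1) lies between 1/2 and 2^p. These crude bounds cover both signs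
  of p - 1 at once.\<close>

lemma Pi_measure_weight_bounds:
  fixes p v :: real
  assumes "p > 0" "0 \<le> v" "v < 1"
  shows "(1 - v\<^sup>2) powr (p - 1) \<le> 2 powr p * (1 - v) powr (p - 1)"
    and "(1/2) * (1 - v) powr (p - 1) \<le> (1 - v\<^sup>2) powr (p - 1)"
proof -
  have "1 - v\<^sup>2 = (1 + v) * (1 - v)" by (simp add: power2_eq_square algebra_simps)
  then have eq: "(1 - v\<^sup>2) powr (p - 1) = (1 + v) powr (p - 1) * (1 - v) powr (p - 1)"
    using assms by (simp add: powr_mult)
  have "(1 + v) powr (p - 1) \<le> (1 + v) powr p" using assms by (intro powr_mono) auto
  also have "\<dots> \<le> 2 powr p" using assms by (intro powr_mono2) auto
  finally show "(1 - v\<^sup>2) powr (p - 1) \<le> 2 powr p * (1 - v) powr (p - 1)"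
    unfolding eq by (intro mult_right_mono) auto
  have "(1/2 :: real) = 2 powr (-1)" by (simp add: powr_minus field_simps)
  also have "\<dots> \<le> (1 + v) powr (-1)" using assms by (intro powr_mono2') auto
  also have "\<dots> \<le> (1 + v) powr (p - 1)" using assms by (intro powr_mono) auto
  finally show "(1/2) * (1 - v) powr (p - 1) \<le> (1 - v\<^sup>2) powr (p - 1)"
    unfolding eq by (intro mult_right_mono) auto
qed

text \<open>
  The majorant \<open>(1 + x y) powr (- p - 1)\<close> of \<open>exp (- x y)\<close> is chosen because its product with
  \<open>y powr (p - 1)\<close> has the primitive \<open>(y / (1 + x y)) powr p / p\<close>.
\<close>

lemma has_integral_powr_exp_majorant:
  fixes p x d :: real
  assumes p: "p > 0" and x: "x \<ge> 0" and d: "0 \<le> d" "d \<le> 1"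
  shows "((\<lambda>v. (1 - v) powr (p - 1) * (1 + x * (1 - v)) powr (- p - 1))
    has_integral (d / (1 + x * d)) powr p / p) {1 - d..1}"
proof -
  define F where "F v = - (((1 - v) / (1 + x * (1 - v))) powr p) / p" for v
  have "((\<lambda>v. (1 - v) powr (p - 1) * (1 + x * (1 - v)) powr (- p - 1)) has_integral F 1 - F (1 - d)) {1 - d..1}"
  proof (rule fundamental_theorem_of_calculus_interior)
    show "1 - d \<le> 1" using d by simp
    have pos: "1 + x * (1 - v) > 0" if "v \<le> 1" for v
      using x that by (intro add_pos_nonneg) auto
    show "continuous_on {1 - d..1} F"
      unfolding F_def using p pos
      by (intro continuous_intros continuous_on_powr')
        (auto simp: less_imp_neq[THEN not_sym] intro!: divide_nonneg_pos)
    fix v assume v: "v \<in> {1 - d<..<1}"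
    have pv: "1 + x * (1 - v) > 0" using pos v by simp
    define y z where "y = 1 - v" and "z = 1 + x * (1 - v)"
    have y: "y > 0" and z: "z > 0" using v pv by (auto simp: y_def z_def)
    have "((\<lambda>v. (1 - v) / (1 + x * (1 - v))) has_real_derivative - 1 / z\<^sup>2) (at v)"
      unfolding z_def using pv by (auto intro!: derivative_eq_intros simp: field_simps power2_eq_square)
    then have "((\<lambda>v. ((1 - v) / (1 + x * (1 - v))) powr p) has_real_derivative p * (y / z) powr (p - 1) * (- 1 / z\<^sup>2)) (at v)"
      using DERIV_fun_powr[of "\<lambda>v. (1 - v) / (1 + x * (1 - v))" "- 1 / z\<^sup>2" v p] y z
      by (simp add: y_def z_def)
    then have "(F has_real_derivative - (p * (y / z) powr (p - 1) * (- 1 / z\<^sup>2)) / p) (at v)"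
      unfolding F_def by (intro DERIV_cdivide DERIV_minus)
    also have "- (p * (y / z) powr (p - 1) * (- 1 / z\<^sup>2)) / p = y powr (p - 1) * (z powr (1 - p) * z powr (-2))"
      using p y z by (simp add: powr_divide powr_minus_divide[of z 2] powr_minus_divide[of z "p - 1", simplified])
    also have "z powr (1 - p) * z powr (-2) = z powr ((1 - p) + (-2))"
      by (rule powr_add[symmetric])
    also have "(1 - p) + (-2) = - p - 1" by simp
    finally show "(F has_vector_derivative (1 - v) powr (p - 1) * (1 + x * (1 - v)) powr (- p - 1)) (at v)"
      by (simp add: y_def z_def has_real_derivative_iff_has_vector_derivative)
  qed
  then show ?thesis by (simp add: F_def)
qed

text \<open>For v < 0 the integrand is at most exp(-x), smaller than any power. For v \<ge> 0 the
  weight is compared with (1 - v)^(p-1) and the exponential with the explicitly integrable majorant.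
  For \<nu> = -1/2 the power on the right is 1 and the total mass suffices.\<close>

lemma Pi_measure_exp_upper:
  assumes "\<nu> \<ge> -1/2"
  obtains C where "C > 0"
    "\<And>x. x \<ge> 0 \<Longrightarrow> (LINT v|Pi_measure \<nu>. indicator {-1..1} v * exp (- x * (1 - v))) \<le> C * (1 + x) powr (- \<nu> - 1/2)"
proof (cases "\<nu> = -1/2")
  case True
  interpret prob_space "Pi_measure \<nu>" using assms by (rule prob_space_Pi_measure)
  have "(LINT v|Pi_measure \<nu>. indicator {-1..1} v * exp (- x * (1 - v))) \<le> 1 * (1 + x) powr (- \<nu> - 1/2)" if "x \<ge> 0" for x
  proof -
    have "(LINT v|Pi_measure \<nu>. indicator {-1..1} v * exp (- x * (1 - v))) \<le> (LINT v|Pi_measure \<nu>. 1)"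
      using that by (intro integral_mono' integrable_const) (auto simp: indicator_def)
    moreover have "measure (Pi_measure \<nu>) UNIV = 1" using prob_space by simp
    ultimately show ?thesis using that True by simp
  qed
  then show ?thesis by (intro that[of 1]) auto
next
  case False
  define p where "p = \<nu> + 1/2"
  have \<nu>: "\<nu> > -1/2" and p: "p > 0" using False assms by (auto simp: p_def)
  have pp: "\<nu> - 1/2 = p - 1" "- \<nu> - 1/2 = - p" by (auto simp: p_def)
  interpret prob_space "Pi_measure \<nu>" using assms by (rule prob_space_Pi_measure)
  obtain C1 where C1: "C1 > 0" "\<And>z. z \<ge> 0 \<Longrightarrow> (1 + z) powr (p + 1) \<le> C1 * exp (1 * z)"
    using p powr_le_exp[of 1 "p + 1"] by auto
  have exp_le: "exp (- z) \<le> C1 * (1 + z) powr (- p - 1)" if "z \<ge> 0" for z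
  proof -
    have "(1 + z) powr (p + 1) * exp (- z) \<le> C1" using C1(2)[OF that] by (simp add: exp_minus field_simps)
    then have "(1 + z) powr (p + 1) * exp (- z) * (1 + z) powr (- p - 1) \<le> C1 * (1 + z) powr (- p - 1)"
      by (rule mult_right_mono) simp
    moreover have "(1 + z) powr (p + 1) * (1 + z) powr (- p - 1) = 1"
      using that by (simp flip: powr_add)
    ultimately show ?thesis by (simp add: mult_ac)
  qed
  define K where "K = Pi_const \<nu> * 2 powr p * C1"
  have K: "K > 0" using Pi_const_pos[OF \<nu>] C1 by (simp add: K_def)
  define C where "C = C1 + K / p"
  show ?thesis
  proof (rule that)
    show "C > 0" using K p C1 by (simp add: C_def add_pos_pos)
    fix x :: real assume x: "x \<ge> 0"
    have "(\<integral>\<^sup>+v. ennreal (indicator {0..1} v * exp (- x * (1 - v))) \<partial>Pi_measure \<nu>)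
      = (\<integral>\<^sup>+v. ennreal (indicator {-1..1} v * (Pi_const \<nu> * (1 - v\<^sup>2) powr (\<nu> - 1/2)))
          * ennreal (indicator {0..1} v * exp (- x * (1 - v))) \<partial>lborel)"
      by (rule nn_integral_Pi_measure[OF \<nu>]) measurable
    \<comment> \<open>\<open>{1-1..1}\<close> is {0..1}, spelled as the case d = 1 of
      \<open>has_integral_powr_exp_majorant\<close>. The null point v = 1 is left out because the
      weight bounds require v < 1.\<close>
    also have "\<dots> \<le> (\<integral>\<^sup>+v. ennreal (K * (if v \<in> {1-1..1} then (1 - v) powr (p - 1) * (1 + x * (1 - v)) powr (- p - 1) else 0)) \<partial>lborel)"
    proof (intro nn_integral_mono_AE, use AE_lborel_singleton[of 1] in eventually_elim)
      fix v :: real assume v: "v \<noteq> 1"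
      show "ennreal (indicator {-1..1} v * (Pi_const \<nu> * (1 - v\<^sup>2) powr (\<nu> - 1/2))) * ennreal (indicator {0..1} v * exp (- x * (1 - v)))
        \<le> ennreal (K * (if v \<in> {1-1..1} then (1 - v) powr (p - 1) * (1 + x * (1 - v)) powr (- p - 1) else 0))"
      proof (cases "v \<in> {0..1}")
        case True
        then have v01: "0 \<le> v" "v < 1" using v by auto
        have "Pi_const \<nu> * (1 - v\<^sup>2) powr (p - 1) * exp (- (x * (1 - v)))
          \<le> Pi_const \<nu> * (2 powr p * (1 - v) powr (p - 1)) * (C1 * (1 + x * (1 - v)) powr (- p - 1))"
          using v01 x Pi_const_pos[OF \<nu>] Pi_measure_weight_bounds(1)[OF p v01]
          by (intro mult_mono exp_le) auto
        moreover have "ennreal (indicator {-1..1} v * (Pi_const \<nu> * (1 - v\<^sup>2) powr (\<nu> - 1/2))) * ennreal (indicator {0..1} v * exp (- x * (1 - v)))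
          = ennreal (Pi_const \<nu> * (1 - v\<^sup>2) powr (p - 1) * exp (- (x * (1 - v))))"
          using True Pi_const_pos[OF \<nu>] by (simp add: pp flip: ennreal_mult)
        moreover have "K * (if v \<in> {1-1..1} then (1 - v) powr (p - 1) * (1 + x * (1 - v)) powr (- p - 1) else 0)
          = Pi_const \<nu> * (2 powr p * (1 - v) powr (p - 1)) * (C1 * (1 + x * (1 - v)) powr (- p - 1))"
          using True by (simp add: K_def mult_ac)
        ultimately show ?thesis by (simp only: ennreal_leI)
      qed simp
    qed
    also have "\<dots> = ennreal (K * ((1 / (1 + x)) powr p / p))"
    proof (rule nn_integral_has_integral_lborel)
      show "((\<lambda>v. K * (if v \<in> {1-1..1} then (1 - v) powr (p - 1) * (1 + x * (1 - v)) powr (- p - 1) else 0))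
        has_integral K * ((1 / (1 + x)) powr p / p)) UNIV"
        using has_integral_powr_exp_majorant[OF p x, of 1]
        by (intro has_integral_mult_right, subst has_integral_restrict_UNIV) simp
    qed (use K in auto)
    finally have A: "(\<integral>\<^sup>+v. ennreal (indicator {0..1} v * exp (- x * (1 - v))) \<partial>Pi_measure \<nu>)
      \<le> ennreal (K * ((1 / (1 + x)) powr p / p))" .
    have "(\<integral>\<^sup>+v. ennreal (indicator {-1..1} v * exp (- x * (1 - v))) \<partial>Pi_measure \<nu>)
      \<le> (\<integral>\<^sup>+v. ennreal (exp (- x)) + ennreal (indicator {0..1} v * exp (- x * (1 - v))) \<partial>Pi_measure \<nu>)"
    proof (intro nn_integral_mono)
      fix v :: real
      have "x * v \<le> 0" if "v < 0" using x that by (simp add: mult_nonneg_nonpos)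
      then show "ennreal (indicator {-1..1} v * exp (- x * (1 - v)))
        \<le> ennreal (exp (- x)) + ennreal (indicator {0..1} v * exp (- x * (1 - v)))"
        by (auto simp: indicator_def algebra_simps simp flip: ennreal_plus intro!: ennreal_leI)
    qed
    also have "\<dots> = ennreal (exp (- x)) + (\<integral>\<^sup>+v. ennreal (indicator {0..1} v * exp (- x * (1 - v))) \<partial>Pi_measure \<nu>)"
      by (subst nn_integral_add) (auto simp: emeasure_space_1[simplified])
    also have "\<dots> \<le> ennreal (exp (- x)) + ennreal (K * ((1 / (1 + x)) powr p / p))"
      by (intro add_left_mono A)
    also have "\<dots> = ennreal (exp (- x) + K * ((1 / (1 + x)) powr p / p))"
      using K p by (intro ennreal_plus[symmetric]) auto
    finally have B: "(\<integral>\<^sup>+v. ennreal (indicator {-1..1} v * exp (- x * (1 - v))) \<partial>Pi_measure \<nu>)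
      \<le> ennreal (exp (- x) + K * ((1 / (1 + x)) powr p / p))" .
    have "(LINT v|Pi_measure \<nu>. indicator {-1..1} v * exp (- x * (1 - v))) \<le> exp (- x) + K * ((1 / (1 + x)) powr p / p)"
      using K p by (intro integral_real_bounded[OF _ B]) (auto intro!: add_nonneg_nonneg)
    also have "exp (- x) \<le> C1 * (1 + x) powr (- p - 1)" using exp_le x by simp
    also have "\<dots> \<le> C1 * (1 + x) powr (- p)" using C1 x by (intro mult_left_mono powr_mono) auto
    also have "C1 * (1 + x) powr (- p) + K * ((1 / (1 + x)) powr p / p) = C * (1 + x) powr (- p)"
      using x by (simp add: C_def powr_divide powr_minus field_simps)
    finally show "(LINT v|Pi_measure \<nu>. indicator {-1..1} v * exp (- x * (1 - v))) \<le> C * (1 + x) powr (- \<nu> - 1/2)"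
      by (simp add: pp)
  qed
qed

lemma Pi_measure_cap_lower:
  assumes "\<nu> \<ge> -1/2"
  obtains c where "c > 0" "\<And>d. 0 < d \<Longrightarrow> d \<le> 1 \<Longrightarrow> c * d powr (\<nu> + 1/2) \<le> measure (Pi_measure \<nu>) {1 - d..1}"
proof (cases "\<nu> = -1/2")
  case True
  interpret prob_space "Pi_measure \<nu>" using assms by (rule prob_space_Pi_measure)
  \<comment> \<open>As d \<le> 1, the cap contains the atom at 1 and misses the one at -1.\<close>
  have "1/2 * d powr (\<nu> + 1/2) \<le> measure (Pi_measure \<nu>) {1 - d..1}" if "0 < d" "d \<le> 1" for d
  proof -
    have "emeasure (Pi_measure \<nu>) {1 - d..1} = ennreal (1/2)"
      using True that emeasure_Pi_measure_minus_half[of "{1 - d..1}"] by (simp add: indicator_def)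
    then have "measure (Pi_measure \<nu>) {1 - d..1} = 1/2"
      by (simp add: emeasure_eq_measure del: ennreal_half)
    then show ?thesis using that True by simp
  qed
  then show ?thesis by (intro that[of "1/2"]) auto
next
  case False
  define p where "p = \<nu> + 1/2"
  have \<nu>: "\<nu> > -1/2" and p: "p > 0" using False assms by (auto simp: p_def)
  have pp: "\<nu> - 1/2 = p - 1" by (auto simp: p_def)
  interpret prob_space "Pi_measure \<nu>" using assms by (rule prob_space_Pi_measure)
  define K where "K = Pi_const \<nu> / 2"
  have K: "K > 0" using Pi_const_pos[OF \<nu>] by (simp add: K_def)
  show ?thesis
  proof (rule that)
    show "K / p > 0" using K p by simp
    fix d :: real assume d: "0 < d" "d \<le> 1"
    \<comment> \<open>With x = 0 the second factor of the majorant is 1, and the same primitive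
      yields d^p / p.\<close>
    have "ennreal (K * (d powr p / p)) =
      (\<integral>\<^sup>+v. ennreal (K * (if v \<in> {1-d..1} then (1 - v) powr (p - 1) * (1 + 0 * (1 - v)) powr (- p - 1) else 0)) \<partial>lborel)"
    proof (rule nn_integral_has_integral_lborel[symmetric])
      show "((\<lambda>v. K * (if v \<in> {1-d..1} then (1 - v) powr (p - 1) * (1 + 0 * (1 - v)) powr (- p - 1) else 0))
        has_integral K * (d powr p / p)) UNIV"
        using has_integral_powr_exp_majorant[OF p, of 0 d] d
        by (intro has_integral_mult_right, subst has_integral_restrict_UNIV) simp
    qed (use K in auto)
    also have "\<dots> \<le> (\<integral>\<^sup>+v. ennreal (indicator {-1..1} v * (Pi_const \<nu> * (1 - v\<^sup>2) powr (\<nu> - 1/2)))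
          * indicator {1 - d..1} v \<partial>lborel)"
    proof (intro nn_integral_mono_AE, use AE_lborel_singleton[of 1] in eventually_elim)
      fix v :: real assume v: "v \<noteq> 1"
      show "ennreal (K * (if v \<in> {1-d..1} then (1 - v) powr (p - 1) * (1 + 0 * (1 - v)) powr (- p - 1) else 0))
        \<le> ennreal (indicator {-1..1} v * (Pi_const \<nu> * (1 - v\<^sup>2) powr (\<nu> - 1/2))) * indicator {1 - d..1} v"
      proof (cases "v \<in> {1-d..1}")
        case True
        then have v01: "0 \<le> v" "v < 1" using v d by auto
        have "Pi_const \<nu> * (1/2 * (1 - v) powr (p - 1)) \<le> Pi_const \<nu> * (1 - v\<^sup>2) powr (p - 1)"
          using Pi_const_pos[OF \<nu>] Pi_measure_weight_bounds(2)[OF p v01] by (intro mult_left_mono) auto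
        then show ?thesis using True v01 by (auto simp: pp K_def intro!: ennreal_leI)
      next
        case False
        then show ?thesis by (simp only: if_False) simp
      qed
    qed
    also have "\<dots> = emeasure (Pi_measure \<nu>) {1 - d..1}"
      using nn_integral_Pi_measure[OF \<nu>, of "indicator {1 - d..1}"] by simp
    finally show "K / p * d powr (\<nu> + 1/2) \<le> measure (Pi_measure \<nu>) {1 - d..1}"
      using K p by (simp add: emeasure_eq_measure p_def[symmetric] ennreal_le_iff)
  qed
qed

text \<open>On the cap of depth 1 / (1 + x) the exponent x (1 - v) is at most 1, so the integral is
  at least exp(-1) times the mass of that cap.\<close>

lemma Pi_measure_exp_lower:
  assumes "\<nu> \<ge> -1/2"
  obtains c where "c > 0"
    "\<And>x. x \<ge> 0 \<Longrightarrow> c * (1 + x) powr (- \<nu> - 1/2) \<le> (LINT v|Pi_measure \<nu>. indicator {-1..1} v * exp (- x * (1 - v)))"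
proof -
  interpret prob_space "Pi_measure \<nu>" using assms by (rule prob_space_Pi_measure)
  obtain c where c: "c > 0" "\<And>d. 0 < d \<Longrightarrow> d \<le> 1 \<Longrightarrow> c * d powr (\<nu> + 1/2) \<le> measure (Pi_measure \<nu>) {1 - d..1}"
    using Pi_measure_cap_lower[OF assms] by blast
  show ?thesis
  proof (rule that)
    show "exp (-1) * c > 0" using c by simp
    fix x :: real assume x: "x \<ge> 0"
    define d where "d = 1 / (1 + x)"
    have d: "0 < d" "d \<le> 1" "x * d \<le> 1" using x by (auto simp: d_def field_simps)
    have "(1 + x) powr (- \<nu> - 1/2) = d powr (\<nu> + 1/2)"
      using x by (simp add: d_def powr_divide flip: powr_minus_divide)
    then have "exp (-1) * c * (1 + x) powr (- \<nu> - 1/2) \<le> exp (-1) * measure (Pi_measure \<nu>) {1 - d..1}"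
      using c(2)[OF d(1,2)] by simp
    also have "\<dots> = (LINT v|Pi_measure \<nu>. exp (-1) * indicator {1 - d..1} v)"
      by simp
    also have "\<dots> \<le> (LINT v|Pi_measure \<nu>. indicator {-1..1} v * exp (- x * (1 - v)))"
    proof (intro integral_mono integrable_const_bound[of _ 1] AE_I2)
      fix v :: real
      show "norm (exp (-1 :: real) * indicator {1 - d..1} v) \<le> 1" by (auto simp: indicator_def)
      have "0 \<le> x * (1 - v)" if "v \<le> 1" using x that by simp
      then show "norm (indicator {-1..1} v * exp (- x * (1 - v))) \<le> 1"
        by (auto simp: indicator_def)
      have "x * (1 - v) \<le> 1" if "1 - d \<le> v"
      proof -
        have "x * (1 - v) \<le> x * d" using x that by (intro mult_left_mono) auto
        then show ?thesis using d by simp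
      qed
      then show "exp (-1) * indicator {1 - d..1} v \<le> indicator {-1..1} v * exp (- x * (1 - v))"
        using d by (auto simp: indicator_def)
    qed auto
    finally show "exp (-1) * c * (1 + x) powr (- \<nu> - 1/2) \<le> (LINT v|Pi_measure \<nu>. indicator {-1..1} v * exp (- x * (1 - v)))" .
  qed
qed

section \<open>Orthogonality and size of the zonal functions\<close>

lemma set_integrable_Pi_measure:
  fixes f :: "real \<Rightarrow> real"
  assumes "\<nu> \<ge> -1/2" "continuous_on {-1..1} f"
  shows "set_integrable (Pi_measure \<nu>) {-1..1} f"
proof -
  interpret prob_space "Pi_measure \<nu>" using assms(1) by (rule prob_space_Pi_measure)
  have "compact (f ` {-1..1})" using assms(2) by (rule compact_continuous_image) simp
  then obtain B where B: "\<And>w. w \<in> {-1..1} \<Longrightarrow> norm (f w) \<le> B"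
    by (meson bounded_iff compact_imp_bounded imageI)
  have "B \<ge> 0" using B[of 0] by (auto intro: order_trans[OF norm_ge_zero])
  then show ?thesis unfolding set_integrable_def
    using B borel_measurable_continuous_on_indicator[OF _ assms(2)]
    by (intro integrable_const_bound[of _ B] AE_I2) (auto simp: indicator_def)
qed

text \<open>The left side is Sonin's energy. Along the equation its derivative is 2 (b - 1) w
  p'(w)^2 / N, nonnegative on [0,1], so its value at 1 controls p and p' together.\<close>

lemma energy_monotone:
  fixes p :: "real poly" and b N :: real
  assumes ode: "\<And>w. (1 - w\<^sup>2) * poly (pderiv (pderiv p)) w - b * w * poly (pderiv p) w + N * poly p w = 0"
    and b: "b \<ge> 1" and N: "N > 0" and w: "0 \<le> w" "w \<le> 1"
  shows "(poly p w)\<^sup>2 + (1 - w\<^sup>2) * (poly (pderiv p) w)\<^sup>2 / N \<le> (poly p 1)\<^sup>2"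
proof -
  define Q where "Q w = (poly p w)\<^sup>2 + (1 - w\<^sup>2) * (poly (pderiv p) w)\<^sup>2 / N" for w
  have "Q w \<le> Q 1"
  proof (rule DERIV_nonneg_imp_nondecreasing[OF w(2)])
    fix x assume x: "w \<le> x" "x \<le> 1"
    let ?y1 = "poly (pderiv p) x" and ?y2 = "poly (pderiv (pderiv p)) x"
    have ode': "(1 - x\<^sup>2) * ?y2 = b * x * ?y1 - N * poly p x" using ode[of x] by simp
    have "(Q has_real_derivative 2 * poly p x * ?y1 + (- 2 * x * ?y1\<^sup>2 + 2 * ?y1 * ((1 - x\<^sup>2) * ?y2)) / N) (at x)"
      unfolding Q_def using N by (auto intro!: derivative_eq_intros simp: power2_eq_square field_simps)
    also have "2 * poly p x * ?y1 + (- 2 * x * ?y1\<^sup>2 + 2 * ?y1 * ((1 - x\<^sup>2) * ?y2)) / N = 2 * (b - 1) * x * ?y1\<^sup>2 / N"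
      unfolding ode' using N by (simp add: power2_eq_square field_simps)
    finally show "\<exists>y. (Q has_real_derivative y) (at x) \<and> 0 \<le> y"
      using x w b N by (intro exI[of _ "2 * (b - 1) * x * ?y1\<^sup>2 / N"]) auto
  qed
  then show ?thesis by (simp add: Q_def)
qed

text \<open>The bound on \<kappa> makes \<kappa>^2 - \<kappa> nonnegative, the sign on which the
  sharp supersolution in \<open>G_upper_gauss\<close> rests.\<close>

locale ultraspherical =
  fixes \<kappa> :: real
  assumes kappa: "\<kappa> \<ge> 1"
begin

sublocale prob_space "Pi_measure \<kappa>"
  using kappa by (intro prob_space_Pi_measure) simp

definition P :: "nat \<Rightarrow> real poly" where "P n = jacobi n (\<kappa> - 1/2)"

definition ev :: "nat \<Rightarrow> real" where "ev n = real n * (real n + 2 * \<kappa>)"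

definition I :: "(real \<Rightarrow> real) \<Rightarrow> real" where "I f = (LINT w:{-1..1}|Pi_measure \<kappa>. f w)"

definition Z :: "nat \<Rightarrow> real \<Rightarrow> real" where "Z n = zonal n \<kappa>"

section \<open>Eigenvalues and the integral functional\<close>

lemma P_ode:
  "(1 - w\<^sup>2) * poly (pderiv (pderiv (P n))) w - (2 * \<kappa> + 1) * w * poly (pderiv (P n)) w + ev n * poly (P n) w = 0"
  using jacobi_ode[of w n "\<kappa> - 1/2"] by (simp add: P_def ev_def algebra_simps)

lemma P_minus: "poly (P n) (- w) = (- 1) ^ n * poly (P n) w"
  unfolding P_def by (rule jacobi_minus)

lemma P_1_pos: "poly (P n) 1 > 0"
  unfolding P_def using kappa by (intro jacobi_at_1_pos) simp

lemma ev_nonneg: "ev n \<ge> 0"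
  using kappa by (simp add: ev_def)

lemma ev_ge: "real n \<le> ev n"
proof (cases "n = 0")
  case False
  then have "real n * 1 \<le> real n * (real n + 2 * \<kappa>)" using kappa by (intro mult_left_mono) auto
  then show ?thesis by (simp add: ev_def)
qed (simp add: ev_def)

lemma ev_strict_mono: "m < n \<Longrightarrow> ev m < ev n"
  unfolding ev_def using kappa by (intro mult_strict_mono) auto

lemma set_integrable_I: "continuous_on {-1..1} f \<Longrightarrow> set_integrable (Pi_measure \<kappa>) {-1..1} f" for f :: "real \<Rightarrow> real"
  using kappa by (intro set_integrable_Pi_measure) auto

lemma I_add: "continuous_on {-1..1} f \<Longrightarrow> continuous_on {-1..1} g \<Longrightarrow> I (\<lambda>w. f w + g w) = I f + I g"
  unfolding I_def by (intro set_integral_add set_integrable_I)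

lemma I_cmult: "I (\<lambda>w. c * f w) = c * I f"
  unfolding I_def by simp

lemma I_sum:
  "finite A \<Longrightarrow> (\<And>i. i \<in> A \<Longrightarrow> continuous_on {-1..1} (f i)) \<Longrightarrow> I (\<lambda>w. \<Sum>i\<in>A. f i w) = (\<Sum>i\<in>A. I (f i))"
  by (induction rule: finite_induct) (simp_all add: I_add continuous_on_sum, simp add: I_def)

lemma I_mono:
  "continuous_on {-1..1} f \<Longrightarrow> continuous_on {-1..1} g \<Longrightarrow> (\<And>w. w \<in> {-1..1} \<Longrightarrow> f w \<le> g w) \<Longrightarrow> I f \<le> I g"
  unfolding I_def by (intro set_integral_mono set_integrable_I) auto

lemma I_one: "I (\<lambda>_. 1) = 1"
proof -
  have "I (\<lambda>_. 1) = (LINT w|Pi_measure \<kappa>. 1)"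
    unfolding I_def set_lebesgue_integral_def
  proof (rule integral_cong_AE)
    show "AE w in Pi_measure \<kappa>. indicator {-1..1} w *\<^sub>R 1 = (1 :: real)"
      using AE_Pi_measure by eventually_elim simp
  qed simp_all
  then show ?thesis using prob_space by simp
qed

text \<open>Passes to the Henstock-Kurzweil integral, for which the fundamental theorem of calculus
  is available.\<close>

lemma I_eq_integral:
  assumes f: "continuous_on {-1..1} f"
  shows "I f = Pi_const \<kappa> * integral {-1..1} (\<lambda>w. (1 - w\<^sup>2) powr (\<kappa> - 1/2) * f w)"
proof -
  have k: "\<kappa> > -1/2" "\<kappa> \<noteq> -1/2" using kappa by auto
  define d where "d w = indicator {-1..1} w * (Pi_const \<kappa> * (1 - w\<^sup>2) powr (\<kappa> - 1/2))" for w :: real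
  have [measurable]: "d \<in> borel_measurable borel" unfolding d_def by measurable
  have "d w \<ge> 0" for w using Pi_const_pos[OF k(1)] by (auto simp: d_def)
  then have "I f = (LINT w|lborel. d w * (indicator {-1..1} w * f w))"
    unfolding I_def set_lebesgue_integral_def Pi_measure_def if_not_P[OF k(2)] d_def[symmetric]
    using borel_measurable_continuous_on_indicator[OF _ f] by (subst integral_density) auto
  also have "\<dots> = (LINT w:{-1..1}|lborel. Pi_const \<kappa> * ((1 - w\<^sup>2) powr (\<kappa> - 1/2) * f w))"
    unfolding set_lebesgue_integral_def
    by (rule Bochner_Integration.integral_cong) (auto simp: d_def indicator_def)
  also have "\<dots> = Pi_const \<kappa> * (LINT w:{-1..1}|lborel. (1 - w\<^sup>2) powr (\<kappa> - 1/2) * f w)"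
    by simp
  also have "continuous_on {-1..1} (\<lambda>w. (1 - w\<^sup>2) powr (\<kappa> - 1/2) * f w)"
    using kappa by (intro continuous_intros f continuous_on_powr') (auto simp: abs_square_le_1 abs_le_iff)
  then have "(LINT w:{-1..1}|lborel. (1 - w\<^sup>2) powr (\<kappa> - 1/2) * f w) = integral {-1..1} (\<lambda>w. (1 - w\<^sup>2) powr (\<kappa> - 1/2) * f w)"
    by (intro set_borel_integral_eq_integral borel_integrable_atLeastAtMost')
  finally show ?thesis .
qed

text \<open>Lagrange's identity: the weighted Wronskian \<open>G\<close> has derivative (ev n - ev
  m) times the weighted product, and its factor (1 - w^2)^(\<kappa>+1/2) vanishes at both ends. The
  eigenvalues are distinct.\<close>

lemma I_P_orthogonal:
  assumes "m \<noteq> n"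
  shows "I (\<lambda>w. poly (P m) w * poly (P n) w) = 0"
proof -
  let ?p = "P m" and ?q = "P n"
  define G where "G w = (1 - w\<^sup>2) powr (\<kappa> + 1/2) * (poly (pderiv ?p) w * poly ?q w - poly ?p w * poly (pderiv ?q) w)" for w
  have "((\<lambda>w. (ev n - ev m) * ((1 - w\<^sup>2) powr (\<kappa> - 1/2) * (poly ?p w * poly ?q w))) has_integral G 1 - G (-1)) {-1..1}"
  proof (rule fundamental_theorem_of_calculus_interior)
    show "continuous_on {-1..1} G"
      unfolding G_def using kappa
      by (intro continuous_intros continuous_on_powr') (auto simp: abs_square_le_1 abs_le_iff)
    fix w :: real assume w: "w \<in> {-1<..<1}"
    then have pos: "1 - w\<^sup>2 > 0" by (simp add: abs_square_less_1 abs_less_iff)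
    let ?p1 = "poly (pderiv ?p) w" and ?q1 = "poly (pderiv ?q) w"
    let ?p2 = "poly (pderiv (pderiv ?p)) w" and ?q2 = "poly (pderiv (pderiv ?q)) w"
    let ?c = "(1 - w\<^sup>2) powr (\<kappa> - 1/2)"
    have d1: "((\<lambda>w. (1 - w\<^sup>2) powr (\<kappa> + 1/2)) has_real_derivative (\<kappa> + 1/2) * ?c * (- 2 * w)) (at w)"
      using DERIV_fun_powr[of "\<lambda>w. 1 - w\<^sup>2" "- 2 * w" w "\<kappa> + 1/2"] pos
      by (auto intro!: derivative_eq_intros)
    have d2: "((\<lambda>w. poly (pderiv ?p) w * poly ?q w - poly ?p w * poly (pderiv ?q) w)
        has_real_derivative ?p2 * poly ?q w - poly ?p w * ?q2) (at w)"
      by (auto intro!: derivative_eq_intros simp: algebra_simps)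
    have "(1 - w\<^sup>2) powr (\<kappa> + 1/2) = (1 - w\<^sup>2) powr (1 + (\<kappa> - 1/2))" by (simp add: add.commute)
    also have "\<dots> = (1 - w\<^sup>2) * ?c" unfolding powr_add using pos by simp
    finally have c: "(1 - w\<^sup>2) powr (\<kappa> + 1/2) = (1 - w\<^sup>2) * ?c" .
    have o1: "(1 - w\<^sup>2) * ?p2 = (2 * \<kappa> + 1) * w * ?p1 - ev m * poly ?p w" using P_ode[of w m] by simp
    have o2: "(1 - w\<^sup>2) * ?q2 = (2 * \<kappa> + 1) * w * ?q1 - ev n * poly ?q w" using P_ode[of w n] by simp
    have "(G has_real_derivative (\<kappa> + 1/2) * ?c * (- 2 * w) * (?p1 * poly ?q w - poly ?p w * ?q1)
      + (?p2 * poly ?q w - poly ?p w * ?q2) * (1 - w\<^sup>2) powr (\<kappa> + 1/2)) (at w)"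
      unfolding G_def by (rule DERIV_mult'[OF d1 d2, THEN DERIV_cong]) (simp add: algebra_simps)
    also have "(\<kappa> + 1/2) * ?c * (- 2 * w) * (?p1 * poly ?q w - poly ?p w * ?q1)
      + (?p2 * poly ?q w - poly ?p w * ?q2) * (1 - w\<^sup>2) powr (\<kappa> + 1/2) =
      ?c * (((1 - w\<^sup>2) * ?p2) * poly ?q w - poly ?p w * ((1 - w\<^sup>2) * ?q2) - (2 * \<kappa> + 1) * w * (?p1 * poly ?q w - poly ?p w * ?q1))"
      unfolding c by (simp add: algebra_simps)
    also have "\<dots> = (ev n - ev m) * (?c * (poly ?p w * poly ?q w))"
      unfolding o1 o2 by (simp add: algebra_simps)
    finally show "(G has_vector_derivative (ev n - ev m) * (?c * (poly ?p w * poly ?q w))) (at w)"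
      by (simp add: has_real_derivative_iff_has_vector_derivative)
  qed simp
  from integral_unique[OF this]
  have "integral {-1..1} (\<lambda>w. (ev n - ev m) * ((1 - w\<^sup>2) powr (\<kappa> - 1/2) * (poly ?p w * poly ?q w))) = 0"
    by (simp add: G_def)
  moreover have "ev n \<noteq> ev m"
    using assms ev_strict_mono[of m n] ev_strict_mono[of n m] by linarith
  ultimately have "integral {-1..1} (\<lambda>w. (1 - w\<^sup>2) powr (\<kappa> - 1/2) * (poly ?p w * poly ?q w)) = 0"
    by simp
  then show ?thesis by (subst I_eq_integral) (auto intro!: continuous_intros)
qed

lemma P_energy:
  assumes "n \<ge> 1" "0 \<le> w" "w \<le> 1"
  shows "(poly (P n) w)\<^sup>2 + (1 - w\<^sup>2) * (poly (pderiv (P n)) w)\<^sup>2 / ev n \<le> (poly (P n) 1)\<^sup>2"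
  using energy_monotone[OF P_ode[of _ n]] assms kappa ev_ge[of n] by auto

text \<open>On [0,1] the derivative term of the energy is dropped; parity carries the bound to
  [-1,0]. Degree 0 is separate because the energy divides by \<open>ev n\<close>.\<close>

lemma abs_P_le:
  assumes "w \<in> {-1..1}"
  shows "\<bar>poly (P n) w\<bar> \<le> poly (P n) 1"
proof -
  have pos: "\<bar>poly (P n) w\<bar> \<le> poly (P n) 1" if w: "0 \<le> w" "w \<le> 1" for w
  proof (cases "n = 0")
    case True
    then have "degree (P n) = 0" using kappa by (simp add: P_def degree_jacobi)
    then obtain c where "P n = [:c:]" by (meson degree_eq_zeroE)
    then show ?thesis using P_1_pos[of n] by simp
  next
    case False
    have "0 \<le> (1 - w\<^sup>2) * (poly (pderiv (P n)) w)\<^sup>2 / ev n"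
      using w ev_nonneg by (intro divide_nonneg_nonneg mult_nonneg_nonneg) (auto simp: power_le_one)
    then have "(poly (P n) w)\<^sup>2 \<le> (poly (P n) 1)\<^sup>2" using P_energy[of n w] w False by linarith
    then show ?thesis using P_1_pos[of n] by (simp add: abs_le_square_iff[symmetric])
  qed
  show ?thesis
  proof (cases "w \<ge> 0")
    case False
    have "\<bar>poly (P n) w\<bar> = \<bar>poly (P n) (- w)\<bar>" by (simp add: P_minus abs_mult power_abs)
    then show ?thesis using pos[of "- w"] False assms by auto
  qed (use pos assms in auto)
qed

text \<open>The energy gives \<bar>P'(x)\<bar> \<le> P(1) sqrt(ev n) / sqrt(1 - x), an integrable
  singularity. From w to 1 the polynomial changes by at most 2 P(1) sqrt(ev n (1 - w)), which is at
  most P(1)/2 within depth 1/(16 ev n).\<close>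

lemma P_lower_near_1:
  assumes "n \<ge> 1" and w: "1 - 1 / (16 * ev n) \<le> w" "w \<le> 1"
  shows "poly (P n) 1 / 2 \<le> poly (P n) w"
proof -
  have ev: "ev n \<ge> 1" using ev_ge[of n] assms by simp
  then have "1 / (16 * ev n) \<le> 1" by simp
  then have w0: "w \<ge> 0" using w by linarith
  define A where "A = poly (P n) 1"
  have A: "A > 0" by (simp add: A_def P_1_pos)
  \<comment> \<open>The second term is a primitive of the bound on the derivative, so
    \<open>M\<close> is nondecreasing.\<close>
  define M where "M x = - poly (P n) x - 2 * A * sqrt (ev n) * sqrt (1 - x)" for x
  have "M w \<le> M 1"
  proof (rule DERIV_nonneg_imp_increasing_open[OF w(2)])
    show "continuous_on {w..1} M" unfolding M_def by (intro continuous_intros)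
    fix x assume x: "w < x" "x < 1"
    let ?y1 = "poly (pderiv (P n)) x"
    have "(poly (P n) x)\<^sup>2 + (1 - x\<^sup>2) * ?y1\<^sup>2 / ev n \<le> A\<^sup>2"
      unfolding A_def using P_energy[of n x] assms w0 x by auto
    then have "(1 - x\<^sup>2) * ?y1\<^sup>2 / ev n \<le> A\<^sup>2" by (smt (verit) zero_le_power2)
    then have "(1 - x\<^sup>2) * ?y1\<^sup>2 \<le> A\<^sup>2 * ev n" using ev by (simp add: field_simps)
    moreover have "x * x \<le> x * 1" using x w0 by (intro mult_left_mono) auto
    then have "(1 - x) * ?y1\<^sup>2 \<le> (1 - x\<^sup>2) * ?y1\<^sup>2"
      by (intro mult_right_mono) (auto simp: power2_eq_square)
    ultimately have "?y1\<^sup>2 \<le> A\<^sup>2 * ev n / (1 - x)" using x by (simp add: field_simps)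
    then have "sqrt (?y1\<^sup>2) \<le> sqrt (A\<^sup>2 * ev n / (1 - x))" by (rule real_sqrt_le_mono)
    then have y1: "\<bar>?y1\<bar> \<le> A * sqrt (ev n) / sqrt (1 - x)"
      using A by (simp add: real_sqrt_mult real_sqrt_divide)
    have "(M has_real_derivative - ?y1 + A * sqrt (ev n) / sqrt (1 - x)) (at x)"
      unfolding M_def using x by (auto intro!: derivative_eq_intros simp: field_simps)
    moreover have "0 \<le> - ?y1 + A * sqrt (ev n) / sqrt (1 - x)" using y1 by linarith
    ultimately show "\<exists>y. (M has_real_derivative y) (at x) \<and> 0 \<le> y" by blast
  qed
  then have "A - 2 * A * (sqrt (ev n) * sqrt (1 - w)) \<le> poly (P n) w"
    by (simp add: M_def A_def mult.assoc)
  moreover have "sqrt (ev n) * sqrt (1 - w) \<le> 1/4"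
  proof -
    have "ev n * (1 - w) \<le> (1/4)\<^sup>2" using w ev by (simp add: field_simps power2_eq_square)
    then have "sqrt (ev n * (1 - w)) \<le> 1/4" by (intro real_le_lsqrt) (use ev w in auto)
    then show ?thesis by (simp add: real_sqrt_mult)
  qed
  then have "2 * A * (sqrt (ev n) * sqrt (1 - w)) \<le> 2 * A * (1/4)" using A by (intro mult_left_mono) auto
  ultimately show ?thesis by (simp add: A_def)
qed

section \<open>Norms of the polynomials and growth of the zonal functions at 1\<close>

definition h :: "nat \<Rightarrow> real" where "h n = I (\<lambda>w. (poly (P n) w)\<^sup>2)"

lemma Z_eq: "Z n w = poly (P n) 1 * poly (P n) w / h n"
  unfolding Z_def zonal_def Let_def h_def I_def jacobi_norm_sq_def P_def poly_jacobi by simp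

text \<open>By \<open>P_lower_near_1\<close> the polynomial keeps half of its value at 1 on a cap of
  depth 1/(16 ev n), whose mass is at least of order ev n powr (-\<kappa> - 1/2). This replaces the
  exact norm in terms of Gamma functions.\<close>

lemma h_lower:
  obtains c where "c > 0" "\<And>n. n \<ge> 1 \<Longrightarrow> c * ev n powr (- \<kappa> - 1/2) * (poly (P n) 1)\<^sup>2 \<le> h n"
proof -
  obtain c where c: "c > 0" "\<And>d. 0 < d \<Longrightarrow> d \<le> 1 \<Longrightarrow> c * d powr (\<kappa> + 1/2) \<le> measure (Pi_measure \<kappa>) {1 - d..1}"
    using Pi_measure_cap_lower[of \<kappa>] kappa by auto
  show ?thesis
  proof (rule that)
    show "c * (1/16) powr (\<kappa> + 1/2) / 4 > 0" using c by simp
    fix n :: nat assume n: "n \<ge> 1"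
    then have ev: "ev n \<ge> 1" using ev_ge[of n] by simp
    define d where "d = 1 / (16 * ev n)"
    have d: "0 < d" "d \<le> 1" using ev by (auto simp: d_def)
    have "d = 1/16 * (1 / ev n)" by (simp add: d_def)
    then have "d powr (\<kappa> + 1/2) = (1/16) powr (\<kappa> + 1/2) * (1 / ev n) powr (\<kappa> + 1/2)"
      using ev by (simp only: powr_mult)
    also have "(1 / ev n) powr (\<kappa> + 1/2) = ev n powr (- \<kappa> - 1/2)"
      using ev by (simp add: powr_divide flip: powr_minus_divide)
    finally have "c * (1/16) powr (\<kappa> + 1/2) / 4 * ev n powr (- \<kappa> - 1/2) * (poly (P n) 1)\<^sup>2 =
      c * d powr (\<kappa> + 1/2) * ((poly (P n) 1 / 2)\<^sup>2)" by (simp add: power2_eq_square)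
    also have "\<dots> \<le> measure (Pi_measure \<kappa>) {1 - d..1} * ((poly (P n) 1 / 2)\<^sup>2)"
      by (intro mult_right_mono c d) simp
    also have "\<dots> = (LINT w|Pi_measure \<kappa>. (poly (P n) 1 / 2)\<^sup>2 * indicator {1 - d..1} w)"
      by simp
    also have "\<dots> \<le> (LINT w|Pi_measure \<kappa>. indicator {-1..1} w *\<^sub>R (poly (P n) w)\<^sup>2)"
    proof (rule integral_mono)
      show "integrable (Pi_measure \<kappa>) (\<lambda>w. (poly (P n) 1 / 2)\<^sup>2 * indicator {1 - d..1} w)"
        by (intro integrable_mult_right integrable_real_indicator) (auto simp: emeasure_eq_measure)
      show "integrable (Pi_measure \<kappa>) (\<lambda>w. indicator {-1..1} w *\<^sub>R (poly (P n) w)\<^sup>2)"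
        using set_integrable_I[of "\<lambda>w. (poly (P n) w)\<^sup>2"] by (simp add: set_integrable_def continuous_intros)
      fix w :: real
      show "(poly (P n) 1 / 2)\<^sup>2 * indicator {1 - d..1} w \<le> indicator {-1..1} w *\<^sub>R (poly (P n) w)\<^sup>2"
        using P_lower_near_1[OF n, of w] P_1_pos[of n] d
        by (auto simp: indicator_def d_def[symmetric] simp del: power_divide intro!: power_mono)
    qed
    finally show "c * (1/16) powr (\<kappa> + 1/2) / 4 * ev n powr (- \<kappa> - 1/2) * (poly (P n) 1)\<^sup>2 \<le> h n"
      by (simp add: h_def I_def set_lebesgue_integral_def)
  qed
qed

lemma P_0: "poly (P 0) w = 1"
  by (simp add: P_def poly_jacobi jacobi_poly_def)

lemma h_0: "h 0 = 1"
  by (simp add: h_def P_0 I_one)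

lemma h_pos: "h n > 0"
proof (cases "n = 0")
  case False
  obtain c where c: "c > 0" "\<And>n. n \<ge> 1 \<Longrightarrow> c * ev n powr (- \<kappa> - 1/2) * (poly (P n) 1)\<^sup>2 \<le> h n"
    using h_lower by blast
  have "0 < c * ev n powr (- \<kappa> - 1/2) * (poly (P n) 1)\<^sup>2"
    using c(1) ev_ge[of n] False P_1_pos[of n] by (intro mult_pos_pos) auto
  also have "\<dots> \<le> h n" using False by (intro c) simp
  finally show ?thesis .
qed (simp add: h_0)

lemma Z_0: "Z 0 w = 1"
  by (simp add: Z_eq P_0 h_0)

lemma Z_minus: "Z n (- w) = (- 1) ^ n * Z n w"
  by (simp add: Z_eq P_minus)

lemma Z_1_pos: "Z n 1 > 0"
  using P_1_pos h_pos by (simp add: Z_eq)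

lemma abs_Z_le: "w \<in> {-1..1} \<Longrightarrow> \<bar>Z n w\<bar> \<le> Z n 1"
  using abs_P_le[of w n] P_1_pos[of n] h_pos[of n]
  by (auto simp: Z_eq abs_mult intro!: divide_right_mono mult_left_mono)

lemma continuous_Z: "continuous_on A (Z n)"
proof -
  have "Z n = (\<lambda>w. poly (P n) 1 * poly (P n) w / h n)" using Z_eq by blast
  then show ?thesis using h_pos[of n] by (simp add: continuous_intros)
qed

lemma Z_1_upper:
  obtains C where "C > 0" "\<And>n. n \<ge> 1 \<Longrightarrow> Z n 1 \<le> C * ev n powr (\<kappa> + 1/2)"
proof -
  obtain c where c: "c > 0" "\<And>n. n \<ge> 1 \<Longrightarrow> c * ev n powr (- \<kappa> - 1/2) * (poly (P n) 1)\<^sup>2 \<le> h n"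
    using h_lower by blast
  show ?thesis
  proof (rule that)
    show "1 / c > 0" using c by simp
    fix n :: nat assume n: "n \<ge> 1"
    then have ev: "ev n \<ge> 1" using ev_ge[of n] by simp
    have "ev n powr (\<kappa> + 1/2) * (c * ev n powr (- \<kappa> - 1/2) * (poly (P n) 1)\<^sup>2) \<le> ev n powr (\<kappa> + 1/2) * h n"
      using c(2)[OF n] by (intro mult_left_mono) auto
    moreover have "ev n powr (\<kappa> + 1/2) * ev n powr (- \<kappa> - 1/2) = 1"
      using ev by (simp flip: powr_add)
    moreover have "ev n powr (\<kappa> + 1/2) * (c * ev n powr (- \<kappa> - 1/2) * (poly (P n) 1)\<^sup>2)
      = (ev n powr (\<kappa> + 1/2) * ev n powr (- \<kappa> - 1/2)) * (c * (poly (P n) 1)\<^sup>2)"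
      by (simp only: mult_ac)
    ultimately have "c * (poly (P n) 1)\<^sup>2 \<le> ev n powr (\<kappa> + 1/2) * h n" by simp
    then show "Z n 1 \<le> 1 / c * ev n powr (\<kappa> + 1/2)"
      using c(1) h_pos[of n] by (simp add: Z_eq field_simps power2_eq_square)
  qed
qed

text \<open>Removing leading coefficients one degree at a time gives some expansion in the
  \<open>P n\<close>; orthogonality then identifies its coefficients.\<close>

lemma poly_expansion:
  assumes "degree f \<le> N" "n0 > N"
  shows "poly f w = (\<Sum>n<n0. I (\<lambda>w. poly f w * poly (P n) w) / poly (P n) 1 * Z n w)"
proof -
  have "\<exists>b. \<forall>w. poly f w = (\<Sum>n<n0. b n * poly (P n) w)" if "degree f < n0" for f
    using that
  proof (induction n0 arbitrary: f)
    case (Suc N)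
    have deg: "degree (P N) = N" using kappa by (simp add: P_def degree_jacobi)
    have lc: "coeff (P N) N \<noteq> 0"
      using P_1_pos[of N] deg by (metis leading_coeff_0_iff poly_0 less_irrefl)
    define c where "c = coeff f N / coeff (P N) N"
    define g where "g = f - smult c (P N)"
    have "degree g \<le> N" unfolding g_def using Suc.prems deg by (intro degree_diff_le) (auto intro: order_trans[OF degree_smult_le])
    moreover have "coeff g N = 0" using lc by (simp add: g_def c_def)
    ultimately have "degree g < N \<or> g = 0"
      by (metis leading_coeff_0_iff le_neq_implies_less)
    then obtain b where b: "\<And>w. poly g w = (\<Sum>n<N. b n * poly (P n) w)"
    proof
      assume "degree g < N"
      then show thesis using Suc.IH that by blast
    next
      assume "g = 0"
      then show thesis by (intro that[of "\<lambda>_. 0"]) simp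
    qed
    have "poly f w = (\<Sum>n<Suc N. (b(N := c)) n * poly (P n) w)" for w
    proof -
      have "poly f w = poly g w + c * poly (P N) w" by (simp add: g_def)
      then show ?thesis by (simp add: b)
    qed
    then show ?case by blast
  qed simp
  then obtain b where b: "\<And>w. poly f w = (\<Sum>n<n0. b n * poly (P n) w)" using assms by fastforce
  have "I (\<lambda>w. poly f w * poly (P m) w) = b m * h m" if "m < n0" for m
  proof -
    have "I (\<lambda>w. poly f w * poly (P m) w) = I (\<lambda>w. \<Sum>n<n0. b n * (poly (P n) w * poly (P m) w))"
      by (simp add: b sum_distrib_right mult.assoc)
    also have "\<dots> = (\<Sum>n<n0. b n * I (\<lambda>w. poly (P n) w * poly (P m) w))"
      by (subst I_sum) (auto intro!: continuous_intros simp: I_cmult)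
    also have "\<dots> = (\<Sum>n<n0. if n = m then b m * h m else 0)"
      by (intro sum.cong) (auto simp: I_P_orthogonal h_def power2_eq_square)
    finally show ?thesis using that by simp
  qed
  then have "(\<Sum>n<n0. I (\<lambda>w. poly f w * poly (P n) w) / poly (P n) 1 * Z n w) = (\<Sum>n<n0. b n * poly (P n) w)"
    using P_1_pos h_pos by (intro sum.cong) (auto simp: Z_eq less_imp_neq[THEN not_sym])
  then show ?thesis using b by simp
qed

end

section \<open>The zonal heat kernel\<close>

text \<open>Uniform approximation with half the minimum of g as tolerance is an approximation with
  relative error 1/2.\<close>

lemma poly_approx_positive:
  fixes g :: "real \<Rightarrow> real"
  assumes g: "continuous_on {-1..1} g" and pos: "\<And>w. w \<in> {-1..1} \<Longrightarrow> g w > 0"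
  obtains p where "\<And>w. w \<in> {-1..1} \<Longrightarrow> g w / 2 \<le> poly p w" "\<And>w. w \<in> {-1..1} \<Longrightarrow> poly p w \<le> 3/2 * g w"
proof -
  obtain w0 where w0: "w0 \<in> {-1..1}" "\<And>w. w \<in> {-1..1} \<Longrightarrow> g w0 \<le> g w"
    using continuous_attains_inf[OF _ _ g] by auto
  obtain q where q: "real_polynomial_function q" "\<And>w. w \<in> {-1..1} \<Longrightarrow> \<bar>g w - q w\<bar> < g w0 / 2"
    using Stone_Weierstrass_real_polynomial_function[OF _ g, of "g w0 / 2"] pos[OF w0(1)] by auto
  obtain a n where "q = (\<lambda>x. \<Sum>i\<le>n. a i * x ^ i)"
    using q(1) by (auto simp: real_polynomial_function_iff_sum)
  then have qp: "q w = poly (\<Sum>i\<le>n. monom (a i) i) w" for w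
    by (simp add: poly_sum poly_monom)
  show ?thesis
  proof (rule that[of "\<Sum>i\<le>n. monom (a i) i"])
    fix w :: real assume w: "w \<in> {-1..1}"
    have "\<bar>g w - q w\<bar> < g w / 2" using q(2)[OF w] w0(2)[OF w] by linarith
    then show "g w / 2 \<le> poly (\<Sum>i\<le>n. monom (a i) i) w" "poly (\<Sum>i\<le>n. monom (a i) i) w \<le> 3/2 * g w"
      unfolding qp[symmetric] by (auto simp: abs_if split: if_splits)
  qed
qed

context ultraspherical
begin

text \<open>Nothing is asked at t = 0 or at the poles, which admits singular functions such as t
  powr (-m) and (r / sin r) powr \<kappa>. Boundedness below is a separate hypothesis wherever it is
  used.\<close>

definition supersolution :: "(real \<Rightarrow> real \<Rightarrow> real) \<Rightarrow> bool" where
  "supersolution V \<longleftrightarrow> continuous_on ({0<..} \<times> {0<..<pi}) (\<lambda>(t, r). V t r) \<and>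
    (\<exists>Vt V1 V2. \<forall>t r. 0 < t \<and> 0 < r \<and> r < pi \<longrightarrow>
      ((\<lambda>s. V s r) has_real_derivative Vt t r) (at t) \<and>
      (V t has_real_derivative V1 t r) (at r) \<and> (V1 t has_real_derivative V2 t r) (at r) \<and>
      V2 t r + 2 * \<kappa> * (cos r / sin r) * V1 t r \<le> Vt t r)"

text \<open>\<open>Z n 1\<close> grows at most like a power of \<open>ev n\<close>. Half of the
  exponent absorbs this; the other half leaves a geometric series because ev n \<ge> n.\<close>

lemma summable_Z_1:
  assumes t: "t > 0"
  shows "summable (\<lambda>n. exp (- t * ev n) * Z n 1)"
proof -
  obtain C where C: "C > 0" "\<And>n. n \<ge> 1 \<Longrightarrow> Z n 1 \<le> C * ev n powr (\<kappa> + 1/2)"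
    using Z_1_upper by blast
  obtain C1 where C1: "C1 > 0" "\<And>z. z \<ge> 0 \<Longrightarrow> (1 + z) powr (\<kappa> + 1/2) \<le> C1 * exp (t/2 * z)"
    using powr_le_exp[of "t/2" "\<kappa> + 1/2"] t kappa by auto
  show ?thesis
  proof (rule summable_comparison_test')
    show "summable (\<lambda>n. C * C1 * exp (- t/2) ^ n)"
      using t by (intro summable_mult summable_geometric) simp
    fix n :: nat assume n: "n \<ge> 1"
    have "ev n powr (\<kappa> + 1/2) \<le> (1 + ev n) powr (\<kappa> + 1/2)"
      using ev_nonneg kappa by (intro powr_mono2) auto
    also have "\<dots> \<le> C1 * exp (t/2 * ev n)" by (rule C1) (rule ev_nonneg)
    finally have "Z n 1 \<le> C * (C1 * exp (t/2 * ev n))"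
      using C(2)[OF n] C(1) by (meson mult_left_mono less_imp_le order_trans)
    then have "exp (- t * ev n) * Z n 1 \<le> exp (- t * ev n) * (C * (C1 * exp (t/2 * ev n)))"
      by (intro mult_left_mono) auto
    also have "\<dots> = C * C1 * exp (- t/2 * ev n)"
      by (simp add: exp_minus field_simps flip: exp_add)
    also have "\<dots> \<le> C * C1 * exp (- t/2 * real n)"
      using C(1) C1(1) t ev_ge[of n] by (intro mult_left_mono) auto
    also have "exp (- t/2 * real n) = exp (- t/2) ^ n"
      by (subst mult.commute) (rule exp_of_nat_mult)
    finally show "norm (exp (- t * ev n) * Z n 1) \<le> C * C1 * exp (- t/2) ^ n"
      using Z_1_pos[of n] by simp
  qed
qed

definition G :: "real \<Rightarrow> real \<Rightarrow> real" where "G t w = (\<Sum>n. exp (- t * ev n) * Z n w)"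

lemma norm_G_term_le: "w \<in> {-1..1} \<Longrightarrow> norm (exp (- t * ev n) * Z n w) \<le> exp (- t * ev n) * Z n 1"
  using abs_Z_le[of w n] by (simp add: abs_mult)

lemma summable_G:
  assumes "t > 0" "w \<in> {-1..1}"
  shows "summable (\<lambda>n. exp (- t * ev n) * Z n w)"
  by (rule summable_comparison_test'[OF summable_Z_1[OF assms(1)] norm_G_term_le[OF assms(2)]])

lemma continuous_G:
  assumes t: "t > 0"
  shows "continuous_on {-1..1} (G t)"
proof (rule uniform_limit_theorem)
  show "uniform_limit {-1..1} (\<lambda>N w. \<Sum>n<N. exp (- t * ev n) * Z n w) (G t) sequentially"
    unfolding G_def by (rule Weierstrass_m_test[OF norm_G_term_le summable_Z_1[OF t]])
  show "\<forall>\<^sub>F N in sequentially. continuous_on {-1..1} (\<lambda>w. \<Sum>n<N. exp (- t * ev n) * Z n w)"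
    by (intro always_eventually allI continuous_intros continuous_Z)
qed simp

text \<open>Divided by \<open>poly (P n) 1\<close> so that a unit mass at w = 1 would have all
  coefficients equal to 1; its flow would then be \<open>G\<close>.\<close>

definition coef :: "real poly \<Rightarrow> nat \<Rightarrow> real" where
  "coef f n = I (\<lambda>w. poly f w * poly (P n) w) / poly (P n) 1"

definition flow :: "real poly \<Rightarrow> real \<Rightarrow> real \<Rightarrow> real" where
  "flow f t w = (\<Sum>n\<le>degree f. exp (- t * ev n) * coef f n * Z n w)"

lemma flow_0: "flow f 0 w = poly f w"
proof -
  have "flow f 0 w = (\<Sum>n<Suc (degree f). I (\<lambda>w. poly f w * poly (P n) w) / poly (P n) 1 * Z n w)"
    by (simp add: flow_def coef_def lessThan_Suc_atMost)
  also have "\<dots> = poly f w"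
    by (rule poly_expansion[symmetric]) auto
  finally show ?thesis .
qed

text \<open>By orthogonality. It allows \<open>flow\<close> to be read as an infinite series, the
  form in which it is compared with \<open>G\<close> term by term.\<close>

lemma coef_beyond_degree:
  assumes "m > degree f"
  shows "coef f m = 0"
proof -
  define n0 where "n0 = Suc (degree f)"
  define c where "c n = coef f n * poly (P n) 1 / h n" for n
  have e: "poly f w = (\<Sum>n<n0. c n * poly (P n) w)" for w
  proof -
    have "poly f w = (\<Sum>n<n0. coef f n * Z n w)"
      unfolding coef_def by (rule poly_expansion) (auto simp: n0_def)
    then show ?thesis by (simp add: c_def Z_eq mult.assoc)
  qed
  have "(\<lambda>w. poly f w * poly (P m) w) = (\<lambda>w. \<Sum>n<n0. c n * (poly (P n) w * poly (P m) w))"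
    unfolding e by (simp add: sum_distrib_right mult.assoc)
  then have "I (\<lambda>w. poly f w * poly (P m) w)
    = I (\<lambda>w. \<Sum>n<n0. c n * (poly (P n) w * poly (P m) w))"
    by (rule arg_cong)
  also have "\<dots> = (\<Sum>n<n0. c n * I (\<lambda>w. poly (P n) w * poly (P m) w))"
    by (subst I_sum) (auto intro!: continuous_intros simp: I_cmult)
  also have "\<dots> = 0" using assms by (intro sum.neutral) (auto simp: I_P_orthogonal n0_def)
  finally show ?thesis by (simp add: coef_def)
qed

lemma coef_smult: "coef (smult c f) n = c * coef f n"
  by (simp add: coef_def mult.assoc I_cmult)

lemma flow_smult: "flow (smult c f) t w = c * flow f t w"
  \<comment> \<open>For c = 0 the degree drops, and with it the range of the sum.\<close>
  by (cases "c = 0") (simp_all add: flow_def coef_smult sum_distrib_left mult_ac, simp add: coef_def I_def)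

lemma flow_eq_suminf: "flow f t w = (\<Sum>n. exp (- t * ev n) * coef f n * Z n w)"
  unfolding flow_def by (rule suminf_finite[symmetric]) (auto simp: coef_beyond_degree)

lemma abs_flow_le:
  assumes "t \<ge> 0" "w \<in> {-1..1}"
  shows "\<bar>flow f t w\<bar> \<le> (\<Sum>n\<le>degree f. \<bar>coef f n\<bar> * Z n 1)"
  unfolding flow_def
proof (intro order_trans[OF sum_abs] sum_mono)
  fix n
  have "exp (- t * ev n) \<le> 1" using assms ev_nonneg[of n] by simp
  then have "exp (- t * ev n) * (\<bar>coef f n\<bar> * \<bar>Z n w\<bar>) \<le> 1 * (\<bar>coef f n\<bar> * Z n 1)"
    by (intro mult_mono mult_left_mono abs_Z_le assms) auto
  then show "\<bar>exp (- t * ev n) * coef f n * Z n w\<bar> \<le> \<bar>coef f n\<bar> * Z n 1"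
    by (simp add: abs_mult mult.assoc)
qed

section \<open>The heat equation in the polar angle\<close>

definition Z1 :: "nat \<Rightarrow> real \<Rightarrow> real" where
  "Z1 n r = poly (P n) 1 / h n * (- sin r * poly (pderiv (P n)) (cos r))"

definition Z2 :: "nat \<Rightarrow> real \<Rightarrow> real" where
  "Z2 n r = poly (P n) 1 / h n * ((sin r)\<^sup>2 * poly (pderiv (pderiv (P n))) (cos r) - cos r * poly (pderiv (P n)) (cos r))"

lemma Z_polar_derivatives:
  "((\<lambda>r. Z n (cos r)) has_real_derivative Z1 n r) (at r)"
  "(Z1 n has_real_derivative Z2 n r) (at r)"
proof -
  have d: "((\<lambda>r. poly p (cos r)) has_real_derivative - sin r * poly (pderiv p) (cos r)) (at r)" for p
    using DERIV_chain2[OF poly_DERIV[of p "cos r"] DERIV_cos] by (simp add: mult.commute)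
  have "((\<lambda>r. poly (P n) 1 / h n * poly (P n) (cos r)) has_real_derivative Z1 n r) (at r)"
    unfolding Z1_def by (intro DERIV_cmult d)
  then show "((\<lambda>r. Z n (cos r)) has_real_derivative Z1 n r) (at r)"
    by (simp add: Z_eq)
  show "(Z1 n has_real_derivative Z2 n r) (at r)"
    unfolding Z1_def Z2_def
    by (intro DERIV_cmult, rule DERIV_cong[OF DERIV_mult[OF DERIV_minus[OF DERIV_sin] d]])
      (simp add: power2_eq_square)
qed

lemma Z_polar_ode:
  assumes "0 < r" "r < pi"
  shows "Z2 n r + 2 * \<kappa> * (cos r / sin r) * Z1 n r = - ev n * Z n (cos r)"
proof -
  have s: "sin r > 0" using assms by (rule sin_gt_zero)
  define c where "c = poly (P n) 1 / h n"
  let ?w = "cos r" and ?c = c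
  have "2 * \<kappa> * (cos r / sin r) * Z1 n r = ?c * (- 2 * \<kappa> * ?w * poly (pderiv (P n)) ?w)"
    using s by (simp add: Z1_def c_def)
  then
  have "Z2 n r + 2 * \<kappa> * (cos r / sin r) * Z1 n r =
    ?c * ((1 - ?w\<^sup>2) * poly (pderiv (pderiv (P n))) ?w - (2 * \<kappa> + 1) * ?w * poly (pderiv (P n)) ?w)"
    unfolding Z2_def c_def[symmetric] sin_squared_eq by (simp add: algebra_simps)
  also have "\<dots> = ?c * (- ev n * poly (P n) ?w)"
    using P_ode[of ?w n] by (intro arg_cong[of _ _ "\<lambda>x. ?c * x"]) linarith
  finally show ?thesis by (simp add: Z_eq c_def)
qed

text \<open>The minimum principle for V minus the flow. V starts at a time s > 0 because the
  explicit functions are singular at 0; the flow of a polynomial is bounded from time 0 on.\<close>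

lemma flow_comparison:
  assumes super: "supersolution V" and s: "s > 0" and T: "T \<ge> 0"
    and bdd: "\<And>t r. s \<le> t \<Longrightarrow> t \<le> s + T \<Longrightarrow> 0 < r \<Longrightarrow> r < pi \<Longrightarrow> - M \<le> V t r"
    and init: "\<And>r. 0 < r \<Longrightarrow> r < pi \<Longrightarrow> poly f (cos r) \<le> V s r"
    and r: "0 < r" "r < pi"
  shows "flow f T (cos r) \<le> V (s + T) r"
proof -
  obtain Vt V1 V2 where V: "\<And>t r. 0 < t \<Longrightarrow> 0 < r \<Longrightarrow> r < pi \<Longrightarrow>
      ((\<lambda>s. V s r) has_real_derivative Vt t r) (at t) \<and>
      (V t has_real_derivative V1 t r) (at r) \<and> (V1 t has_real_derivative V2 t r) (at r) \<and>
      V2 t r + 2 * \<kappa> * (cos r / sin r) * V1 t r \<le> Vt t r"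
    using super unfolding supersolution_def by blast
  define A where "A = (\<Sum>n\<le>degree f. \<bar>coef f n\<bar> * Z n 1)"
  define e where "e t n = exp (- t * ev n) * coef f n" for t n
  have flow_e: "flow f t w = (\<Sum>n\<le>degree f. e t n * Z n w)" for t w
    by (simp add: flow_def e_def)
  have "0 \<le> V (s + T) r - flow f T (cos r)"
  proof (rule parabolic_minimum_principle[where \<kappa> = \<kappa> and T = T and M = "M + A" and
      D = "\<lambda>t r. V (s + t) r - flow f t (cos r)" and
      Dt = "\<lambda>t r. Vt (s + t) r - (\<Sum>n\<le>degree f. - ev n * (e t n * Z n (cos r)))" and
      Dp = "\<lambda>t r. V1 (s + t) r - (\<Sum>n\<le>degree f. e t n * Z1 n r)" and
      Dpp = "\<lambda>t r. V2 (s + t) r - (\<Sum>n\<le>degree f. e t n * Z2 n r)"])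
    show "1/2 \<le> \<kappa>" using kappa by simp
    have "continuous_on ({0..T} \<times> {0<..<pi}) (\<lambda>p. (\<lambda>(t, r). V t r) (s + fst p, snd p))"
    proof (rule continuous_on_compose2[where g = "\<lambda>(t, r). V t r" and t = "{0<..} \<times> {0<..<pi}"])
      show "continuous_on ({0<..} \<times> {0<..<pi}) (\<lambda>(t, r). V t r)"
        using super by (simp add: supersolution_def)
    qed (use s in \<open>auto intro!: continuous_intros\<close>)
    moreover have "continuous_on ({0..T} \<times> {0<..<pi}) (\<lambda>p. \<Sum>n\<le>degree f. exp (- fst p * ev n) * coef f n * Z n (cos (snd p)))"
      by (intro continuous_on_sum continuous_on_mult continuous_on_const continuous_on_exp continuous_on_minus
          continuous_on_fst continuous_on_id continuous_on_compose2[OF continuous_Z[of UNIV]]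
          continuous_on_cos continuous_on_snd) auto
    ultimately show "continuous_on ({0..T} \<times> {0<..<pi}) (\<lambda>(t, r). V (s + t) r - flow f t (cos r))"
      unfolding flow_def case_prod_unfold by (simp add: continuous_on_diff)
    fix t r :: real
    assume p: "0 < r" "r < pi"
    have w: "cos r \<in> {-1..1}" by simp
    {
      assume t: "0 < t" "t \<le> T"
      then have st: "s + t > 0" using s by simp
      have "((\<lambda>t. V (s + t) r) has_real_derivative Vt (s + t) r) (at t)"
        using V[OF st p] DERIV_shift[of "\<lambda>t. V t r" "Vt (s + t) r" t s] by (simp add: add.commute)
      moreover have "((\<lambda>t. flow f t (cos r)) has_real_derivative (\<Sum>n\<le>degree f. - ev n * (e t n * Z n (cos r)))) (at t)"
        unfolding flow_def e_def by (auto intro!: derivative_eq_intros sum.cong)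
      ultimately show "((\<lambda>t. V (s + t) r - flow f t (cos r)) has_real_derivative
          Vt (s + t) r - (\<Sum>n\<le>degree f. - ev n * (e t n * Z n (cos r)))) (at t)"
        by (rule DERIV_diff)
      show "((\<lambda>r. V (s + t) r - flow f t (cos r)) has_real_derivative
          V1 (s + t) r - (\<Sum>n\<le>degree f. e t n * Z1 n r)) (at r)"
        unfolding flow_e using V[OF st p]
        by (intro DERIV_diff DERIV_sum DERIV_cmult Z_polar_derivatives) simp
      show "((\<lambda>r. V1 (s + t) r - (\<Sum>n\<le>degree f. e t n * Z1 n r)) has_real_derivative
          V2 (s + t) r - (\<Sum>n\<le>degree f. e t n * Z2 n r)) (at r)"
        using V[OF st p] by (intro DERIV_diff DERIV_sum DERIV_cmult Z_polar_derivatives) simp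
      have "(\<Sum>n\<le>degree f. - ev n * (e t n * Z n (cos r)))
        = (\<Sum>n\<le>degree f. e t n * (Z2 n r + 2 * \<kappa> * (cos r / sin r) * Z1 n r))"
        unfolding Z_polar_ode[OF p] by (simp add: mult_ac)
      also have "\<dots> = (\<Sum>n\<le>degree f. e t n * Z2 n r) + 2 * \<kappa> * (cos r / sin r) * (\<Sum>n\<le>degree f. e t n * Z1 n r)"
        by (simp add: sum_distrib_left sum.distrib distrib_left mult_ac)
      moreover have "V2 (s + t) r + 2 * \<kappa> * (cos r / sin r) * V1 (s + t) r \<le> Vt (s + t) r"
        using V[OF st p] by simp
      ultimately show "V2 (s + t) r - (\<Sum>n\<le>degree f. e t n * Z2 n r)
          + 2 * \<kappa> * (cos r / sin r) * (V1 (s + t) r - (\<Sum>n\<le>degree f. e t n * Z1 n r))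
          \<le> Vt (s + t) r - (\<Sum>n\<le>degree f. - ev n * (e t n * Z n (cos r)))"
        by (simp only: right_diff_distrib)
    }
    {
      assume t: "0 \<le> t" "t \<le> T"
      show "- (M + A) \<le> V (s + t) r - flow f t (cos r)"
        using abs_flow_le[OF t(1) w, of f] bdd[of "s + t" r] t p by (simp add: A_def)
    }
    show "0 \<le> V (s + 0) r - flow f 0 (cos r)"
      using init[OF p] by (simp add: flow_0)
  qed (use T r in auto)
  then show ?thesis by simp
qed

section \<open>Polynomial approximations of a point mass at w = 1\<close>

lemma I_exp_bounds:
  obtains c C where "c > 0" "C > 0"
    "\<And>x. x \<ge> 0 \<Longrightarrow> c * (1 + x) powr (- \<kappa> - 1/2) \<le> I (\<lambda>w. exp (- x * (1 - w)))"
    "\<And>x. x \<ge> 0 \<Longrightarrow> I (\<lambda>w. exp (- x * (1 - w))) \<le> C * (1 + x) powr (- \<kappa> - 1/2)"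
proof -
  have k: "\<kappa> \<ge> -1/2" using kappa by simp
  have "I (\<lambda>w. exp (- x * (1 - w))) = (LINT v|Pi_measure \<kappa>. indicator {-1..1} v * exp (- x * (1 - v)))" for x
    by (simp add: I_def set_lebesgue_integral_def)
  moreover obtain c where c: "c > 0"
    "\<And>x. x \<ge> 0 \<Longrightarrow> c * (1 + x) powr (- \<kappa> - 1/2) \<le> (LINT v|Pi_measure \<kappa>. indicator {-1..1} v * exp (- x * (1 - v)))"
    using Pi_measure_exp_lower[OF k] by blast
  moreover obtain C where C: "C > 0"
    "\<And>x. x \<ge> 0 \<Longrightarrow> (LINT v|Pi_measure \<kappa>. indicator {-1..1} v * exp (- x * (1 - v))) \<le> C * (1 + x) powr (- \<kappa> - 1/2)"
    using Pi_measure_exp_upper[OF k] by blast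
  ultimately show ?thesis
    using that[of c C] by simp
qed

text \<open>After division by its mass, \<open>f j\<close> is close to a unit mass at w = 1 spread
  over the scale 1 - w ~ 1/j. The factors 1/2 and 3/2 are those of
  \<open>poly_approx_positive\<close>.\<close>

definition approximate_identity :: "real \<Rightarrow> real \<Rightarrow> (nat \<Rightarrow> real poly) \<Rightarrow> bool" where
  "approximate_identity c C f \<longleftrightarrow> c > 0 \<and> C > 0 \<and>
    (\<forall>j. \<forall>w\<in>{-1..1}. exp (- real j * (1 - w)) / 2 \<le> poly (f j) w
      \<and> poly (f j) w \<le> 3/2 * exp (- real j * (1 - w))) \<and>
    (\<forall>j\<ge>1. c * real j powr (- \<kappa> - 1/2) \<le> I (poly (f j))
      \<and> I (poly (f j)) \<le> C * real j powr (- \<kappa> - 1/2)) \<and>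
    (\<forall>t>0. \<forall>w\<in>{-1..1}. (\<lambda>j. flow (f j) t w / I (poly (f j))) \<longlonglongrightarrow> G t w)"

lemma approximate_identity_exists:
  obtains c C f where "approximate_identity c C f"
proof -
  define E where "E x w = exp (- x * (1 - w))" for x w :: real
  have contE: "continuous_on {-1..1} (E x)" for x unfolding E_def by (intro continuous_intros)
  have "\<exists>p. \<forall>w\<in>{-1..1}. E (real j) w / 2 \<le> poly p w \<and> poly p w \<le> 3/2 * E (real j) w" for j
    using poly_approx_positive[OF contE[of "real j"]] by (metis E_def exp_gt_zero)
  then obtain f where f: "\<And>j w. w \<in> {-1..1} \<Longrightarrow> E (real j) w / 2 \<le> poly (f j) w"
    "\<And>j w. w \<in> {-1..1} \<Longrightarrow> poly (f j) w \<le> 3/2 * E (real j) w"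
    by metis
  obtain c C where cC: "c > 0" "C > 0"
    "\<And>x. x \<ge> 0 \<Longrightarrow> c * (1 + x) powr (- \<kappa> - 1/2) \<le> I (E x)"
    "\<And>x. x \<ge> 0 \<Longrightarrow> I (E x) \<le> C * (1 + x) powr (- \<kappa> - 1/2)"
    using I_exp_bounds unfolding E_def by metis
  \<comment> \<open>The power of 2 comes from 1 + j \<le> 2j, the final 1/2 from the lower bound for
    \<open>f j\<close>.\<close>
  define c1 where "c1 = c * 2 powr (- \<kappa> - 1/2) / 2"
  have c1: "c1 > 0" using cC by (simp add: c1_def)
  have contf: "continuous_on {-1..1} (poly (f j))" for j by (intro continuous_intros)
  have lower: "c1 * real j powr (- \<kappa> - 1/2) \<le> I (poly (f j))" if j: "j \<ge> 1" for j
  proof -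
    have "(2 * real j) powr (- \<kappa> - 1/2) \<le> (1 + real j) powr (- \<kappa> - 1/2)"
      using j kappa by (intro powr_mono2') auto
    then have "2 powr (- \<kappa> - 1/2) * real j powr (- \<kappa> - 1/2) \<le> (1 + real j) powr (- \<kappa> - 1/2)"
      by (simp add: powr_mult)
    then have "c1 * real j powr (- \<kappa> - 1/2) \<le> 1/2 * (c * (1 + real j) powr (- \<kappa> - 1/2))"
      using cC(1) by (simp add: c1_def)
    also have "\<dots> \<le> 1/2 * I (E (real j))" by (intro mult_left_mono cC) auto
    also have "\<dots> = I (\<lambda>w. 1/2 * E (real j) w)" by (rule I_cmult[symmetric])
    also have "\<dots> \<le> I (poly (f j))"
      using f(1)[of _ j] by (intro I_mono contf continuous_intros contE) auto
    finally show ?thesis .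
  qed
  have upper: "I (poly (f j)) \<le> 3/2 * C * real j powr (- \<kappa> - 1/2)" if j: "j \<ge> 1" for j
  proof -
    have "I (poly (f j)) \<le> I (\<lambda>w. 3/2 * E (real j) w)"
      using f(2)[of _ j] by (intro I_mono contf continuous_intros contE) auto
    also have "\<dots> = 3/2 * I (E (real j))" by (rule I_cmult)
    also have "\<dots> \<le> 3/2 * (C * (1 + real j) powr (- \<kappa> - 1/2))" by (intro mult_left_mono cC) auto
    also have "\<dots> \<le> 3/2 * (C * real j powr (- \<kappa> - 1/2))"
      using cC(2) j kappa by (intro mult_left_mono powr_mono2') auto
    finally show ?thesis by simp
  qed
  define m where "m j = I (poly (f j))" for j
  have m_pos: "m j > 0" if "j \<ge> 1" for j
  proof -
    have "0 < c1 * real j powr (- \<kappa> - 1/2)" using c1 that by simp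
    then show ?thesis using lower[OF that] by (simp add: m_def)
  qed
  have f_nonneg: "0 \<le> poly (f j) w" if "w \<in> {-1..1}" for j w
  proof -
    have "0 \<le> E (real j) w / 2" by (simp add: E_def)
    then show ?thesis using f(1)[OF that, of j] by (rule order_trans)
  qed
  \<comment> \<open>R n is 1 at w = 1 and bounded by 1, so coef (f j) n / m j is its mean against a
    probability density and has modulus at most 1.\<close>
  define R where "R n w = poly (P n) w / poly (P n) 1" for n w
  have contR: "continuous_on {-1..1} (R n)" for n
    unfolding R_def using P_1_pos[of n] by (intro continuous_intros) auto
  have coefR: "coef (f j) n = I (\<lambda>w. poly (f j) w * R n w)" for j n
    unfolding coef_def R_def using I_cmult[of "1 / poly (P n) 1" "\<lambda>w. poly (f j) w * poly (P n) w"] by simp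
  have R_le: "\<bar>R n w\<bar> \<le> 1" if "w \<in> {-1..1}" for n w
    using abs_P_le[OF that, of n] P_1_pos[of n] by (simp add: R_def)
  have coef_le: "\<bar>coef (f j) n\<bar> \<le> m j" for j n
  proof -
    have b: "\<bar>poly (f j) w * R n w\<bar> \<le> poly (f j) w" if "w \<in> {-1..1}" for w
      using mult_left_mono[OF R_le[OF that, of n] f_nonneg[OF that, of j]] f_nonneg[OF that, of j] by (simp add: abs_mult)
    have "coef (f j) n \<le> m j" unfolding coefR m_def using b
      by (intro I_mono continuous_intros contR) (auto simp: abs_le_iff)
    moreover have "- coef (f j) n \<le> m j" unfolding coefR m_def using b
      by (subst I_cmult[of "-1", simplified, symmetric], intro I_mono continuous_intros contR) (auto simp: abs_le_iff)
    ultimately show ?thesis by simp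
  qed
  have coef_lim: "(\<lambda>j. coef (f j) n / m j) \<longlonglongrightarrow> 1" for n
  proof -
    \<comment> \<open>Factoring out w - 1 gives 1 - R n w \<le> B' (1 - w). The factor 1 - w is paid
      for with half of the exponential and gains 1/j, so the normalized coefficients tend to 1 at
      the rate 1/j.\<close>
    have "poly (P n - [:poly (P n) 1:]) 1 = 0" by simp
    then obtain q where q: "P n - [:poly (P n) 1:] = [:-1, 1:] * q"
      unfolding poly_eq_0_iff_dvd by (auto elim: dvdE)
    have "compact (poly q ` {-1..1})" by (intro compact_continuous_image continuous_intros) simp
    then obtain B where B: "\<And>w. w \<in> {-1..1} \<Longrightarrow> \<bar>poly q w\<bar> \<le> B"
      by (metis bounded_iff compact_imp_bounded imageI real_norm_def)
    define B' where "B' = B / poly (P n) 1"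
    have R1: "1 - R n w \<le> B' * (1 - w)" if w: "w \<in> {-1..1}" for w
    proof -
      have "poly (P n) w - poly (P n) 1 = (w - 1) * poly q w"
        using arg_cong[OF q, of "\<lambda>p. poly p w"] by (simp add: algebra_simps)
      then have "1 - R n w = (1 - w) * (poly q w / poly (P n) 1)"
        using P_1_pos[of n] by (simp add: R_def field_simps)
      also have "\<dots> \<le> (1 - w) * B'"
        unfolding B'_def using B[OF w] P_1_pos[of n] w by (intro mult_left_mono divide_right_mono) auto
      finally show ?thesis by (simp add: mult.commute)
    qed
    have B'0: "B' \<ge> 0" unfolding B'_def using B[of 0] P_1_pos[of n] by (intro divide_nonneg_pos) auto
    define K where "K = B' * 3 * C / c1 * (1/2) powr (- \<kappa> - 1/2)"
    have lo: "1 - coef (f j) n / m j \<le> K * (1 / real j)" if j: "j \<ge> 1" for j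
    proof -
      have "m j - coef (f j) n = I (\<lambda>w. poly (f j) w + (-1) * (poly (f j) w * R n w))"
        unfolding m_def coefR by (subst I_add) (auto intro!: continuous_intros contR simp: I_cmult[of "-1", simplified])
      also have "\<dots> \<le> I (\<lambda>w. 3 * B' / real j * E (real j / 2) w)"
      proof (rule I_mono)
        fix w :: real assume w: "w \<in> {-1..1}"
        have "real j / 2 * (1 - w) \<le> exp (real j / 2 * (1 - w))"
          using exp_ge_add_one_self[of "real j / 2 * (1 - w)"] by linarith
        then have "real j / 2 * (1 - w) * E (real j) w \<le> exp (real j / 2 * (1 - w)) * E (real j) w"
          by (intro mult_right_mono) (auto simp: E_def)
        also have "\<dots> = E (real j / 2) w" by (simp add: E_def field_simps flip: exp_add)
        finally have e: "(1 - w) * E (real j) w \<le> 2 / real j * E (real j / 2) w" using j by (simp add: field_simps)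
        have "poly (f j) w + (-1) * (poly (f j) w * R n w) = poly (f j) w * (1 - R n w)" by (simp add: algebra_simps)
        also have "\<dots> \<le> poly (f j) w * (B' * (1 - w))" by (intro mult_left_mono R1 f_nonneg w)
        also have "\<dots> \<le> 3/2 * E (real j) w * (B' * (1 - w))"
          using w B'0 by (intro mult_right_mono f) auto
        also have "\<dots> = 3/2 * B' * ((1 - w) * E (real j) w)" by simp
        also have "\<dots> \<le> 3/2 * B' * (2 / real j * E (real j / 2) w)"
          using B'0 by (intro mult_left_mono e) auto
        finally show "poly (f j) w + (-1) * (poly (f j) w * R n w) \<le> 3 * B' / real j * E (real j / 2) w"
          by simp
      qed (use j in \<open>auto intro!: continuous_intros contE contR\<close>)
      also have "\<dots> = 3 * B' / real j * I (E (real j / 2))" by (rule I_cmult)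
      also have "\<dots> \<le> 3 * B' / real j * (C * (1 + real j / 2) powr (- \<kappa> - 1/2))"
        using B'0 by (intro mult_left_mono cC) auto
      also have "\<dots> \<le> 3 * B' / real j * (C * (1/2 * real j) powr (- \<kappa> - 1/2))"
        using B'0 cC(2) j kappa by (intro mult_left_mono powr_mono2') auto
      also have "\<dots> = K * (1 / real j) * (c1 * real j powr (- \<kappa> - 1/2))"
        unfolding powr_mult using c1 by (simp add: K_def)
      also have "\<dots> \<le> K * (1 / real j) * m j"
        unfolding m_def using B'0 cC(2) c1 by (intro mult_left_mono lower j) (auto simp: K_def)
      finally show ?thesis using m_pos[OF j] by (simp add: field_simps)
    qed
    show ?thesis
    proof (rule tendsto_sandwich)
      show "\<forall>\<^sub>F j in sequentially. 1 - K * (1 / real j) \<le> coef (f j) n / m j"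
        using lo by (intro eventually_sequentiallyI[of 1]) (simp add: algebra_simps)
      show "\<forall>\<^sub>F j in sequentially. coef (f j) n / m j \<le> 1"
      proof (rule eventually_sequentiallyI[of 1])
        fix j :: nat assume "1 \<le> j"
        then show "coef (f j) n / m j \<le> 1"
          using coef_le[of j n] m_pos[of j] by (simp add: abs_le_iff)
      qed
      have "(\<lambda>j. 1 - K * (1 / real j)) \<longlonglongrightarrow> 1 - K * 0"
        by (intro tendsto_diff tendsto_mult tendsto_const lim_1_over_n)
      then show "(\<lambda>j. 1 - K * (1 / real j)) \<longlonglongrightarrow> 1" by simp
    qed (rule tendsto_const)
  qed
  have lim: "(\<lambda>j. flow (f j) t w / m j) \<longlonglongrightarrow> G t w" if t: "t > 0" and w: "w \<in> {-1..1}" for t w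
  proof -
    have eq: "flow (f j) t w / m j = (\<Sum>n. exp (- t * ev n) * (coef (f j) n / m j) * Z n w)" for j
    proof -
      have "summable (\<lambda>n. exp (- t * ev n) * coef (f j) n * Z n w)"
        by (rule summable_finite[of "{..degree (f j)}"]) (auto simp: coef_beyond_degree)
      from suminf_divide[OF this, of "m j"] show ?thesis by (simp add: flow_eq_suminf)
    qed
    \<comment> \<open>Dominated convergence for series; the majorant is uniform in j because the
      normalized coefficients have modulus at most 1.\<close>
    have "(\<lambda>j. \<Sum>n. exp (- t * ev n) * (coef (f j) n / m j) * Z n w) \<longlonglongrightarrow> (\<Sum>n. exp (- t * ev n) * Z n w)"
    proof (rule tannerys_theorem[THEN conjunct2, THEN conjunct2])
      show "(\<lambda>j. exp (- t * ev n) * (coef (f j) n / m j) * Z n w) \<longlonglongrightarrow> exp (- t * ev n) * Z n w" for n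
        using tendsto_mult[OF tendsto_mult[OF tendsto_const[of "exp (- t * ev n)"] coef_lim[of n]] tendsto_const[of "Z n w"]]
        by simp
      have "\<forall>\<^sub>F p in at_top \<times>\<^sub>F at_top. fst p \<ge> (0 :: nat) \<and> snd p \<ge> (1 :: nat)"
        by (intro eventually_prodI eventually_ge_at_top)
      then show "\<forall>\<^sub>F (n, j) in at_top \<times>\<^sub>F at_top. norm (exp (- t * ev n) * (coef (f j) n / m j) * Z n w) \<le> exp (- t * ev n) * Z n 1"
      proof (rule eventually_mono)
        fix p :: "nat \<times> nat"
        obtain n j where p: "p = (n, j)" by (cases p)
        assume "0 \<le> fst p \<and> 1 \<le> snd p"
        then have mj: "m j > 0" by (intro m_pos) (simp add: p)
        have "\<bar>coef (f j) n / m j\<bar> \<le> 1" using coef_le[of j n] mj by simp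
        then have "\<bar>coef (f j) n / m j\<bar> * \<bar>Z n w\<bar> \<le> 1 * Z n 1" by (intro mult_mono abs_Z_le w) auto
        then have "exp (- t * ev n) * (\<bar>coef (f j) n / m j\<bar> * \<bar>Z n w\<bar>) \<le> exp (- t * ev n) * (1 * Z n 1)"
          by (intro mult_left_mono) auto
        then show "case p of (n, j) \<Rightarrow> norm (exp (- t * ev n) * (coef (f j) n / m j) * Z n w) \<le> exp (- t * ev n) * Z n 1"
          by (simp add: p abs_mult mult.assoc)
      qed
      show "summable (\<lambda>n. exp (- t * ev n) * Z n 1)" by (rule summable_Z_1[OF t])
    qed (rule sequentially_bot)
    then show ?thesis unfolding eq G_def .
  qed
  show ?thesis
    unfolding approximate_identity_def
    by (rule that[of c1 "3/2 * C" f, unfolded approximate_identity_def])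
      (use c1 cC f lower upper lim in \<open>auto simp: E_def m_def\<close>)
qed

text \<open>The constant k may have either sign: positive values serve upper bounds, negative ones
  lower bounds. The comparison runs from V at time \<rho>/j to V at time \<rho>/j + t, and the shift
  disappears as j grows.\<close>

lemma G_comparison:
  assumes f: "approximate_identity c C f" and V: "supersolution V" and \<rho>: "\<rho> > 0"
    and bdd: "\<And>s. s > 0 \<Longrightarrow> \<exists>M. \<forall>t r. s \<le> t \<and> 0 < r \<and> r < pi \<longrightarrow> - M \<le> V t r"
    and init: "\<And>j r. j \<ge> 1 \<Longrightarrow> 0 < r \<Longrightarrow> r < pi \<Longrightarrow> k / I (poly (f j)) * poly (f j) (cos r) \<le> V (\<rho> / real j) r"
    and t: "t > 0" and r: "0 < r" "r < pi"
  shows "k * G t (cos r) \<le> V t r"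
proof (rule tendsto_le)
  show "\<forall>\<^sub>F j in sequentially. k * (flow (f j) t (cos r) / I (poly (f j))) \<le> V (\<rho> / real j + t) r"
  proof (rule eventually_sequentiallyI[of 1])
    fix j :: nat assume j: "1 \<le> j"
    then have s: "\<rho> / real j > 0" using \<rho> by simp
    obtain M where M: "\<And>t r. \<rho> / real j \<le> t \<Longrightarrow> 0 < r \<Longrightarrow> r < pi \<Longrightarrow> - M \<le> V t r"
      using bdd[OF s] by blast
    have "flow (smult (k / I (poly (f j))) (f j)) t (cos r) \<le> V (\<rho> / real j + t) r"
      by (rule flow_comparison[OF V s _ M]) (use t r init[OF j] in auto)
    then show "k * (flow (f j) t (cos r) / I (poly (f j))) \<le> V (\<rho> / real j + t) r"
      by (simp add: flow_smult)
  qed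
  show "(\<lambda>j. k * (flow (f j) t (cos r) / I (poly (f j)))) \<longlonglongrightarrow> k * G t (cos r)"
    using f t by (intro tendsto_mult tendsto_const) (auto simp: approximate_identity_def)
  have "isCont (\<lambda>s. V s r) t" using V t r unfolding supersolution_def by (blast intro: DERIV_isCont)
  moreover have "(\<lambda>j. \<rho> * (1 / real j) + t) \<longlonglongrightarrow> \<rho> * 0 + t" by (intro tendsto_intros lim_1_over_n)
  ultimately show "(\<lambda>j. V (\<rho> / real j + t) r) \<longlonglongrightarrow> V t r"
    using isCont_tendsto_compose[of t "\<lambda>s. V s r" "\<lambda>j. \<rho> * (1 / real j) + t"] by simp
qed simp

text \<open>The factor j powr (-\<kappa> - 1/2) is the order of the mass of \<open>f j\<close>, so
  \<open>init\<close> says that V at time \<rho>/j dominates a multiple of the normalized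
  approximation.\<close>

lemma G_upper:
  assumes V: "supersolution V" and pos: "\<And>t r. t > 0 \<Longrightarrow> 0 < r \<Longrightarrow> r < pi \<Longrightarrow> 0 \<le> V t r"
    and \<rho>: "\<rho> > 0" and A: "A > 0"
    and init: "\<And>j r. j \<ge> 1 \<Longrightarrow> 0 < r \<Longrightarrow> r < pi \<Longrightarrow>
      exp (- real j * (1 - cos r)) \<le> A * real j powr (- \<kappa> - 1/2) * V (\<rho> / real j) r"
  obtains C where "C > 0" "\<And>t r. t > 0 \<Longrightarrow> 0 < r \<Longrightarrow> r < pi \<Longrightarrow> G t (cos r) \<le> C * V t r"
proof -
  obtain c C f where f: "approximate_identity c C f" by (rule approximate_identity_exists)
  then have c: "c > 0" by (simp add: approximate_identity_def)
  define k where "k = 2 * c / (3 * A)"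
  have k: "k > 0" using c A by (simp add: k_def)
  have "k * G t (cos r) \<le> V t r" if "t > 0" "0 < r" "r < pi" for t r
  proof (rule G_comparison[OF f V \<rho>])
    show "\<exists>M. \<forall>t r. s \<le> t \<and> 0 < r \<and> r < pi \<longrightarrow> - M \<le> V t r" if "s > 0" for s
      using pos that by (intro exI[of _ 0]) auto
    fix j :: nat and r :: real assume j: "j \<ge> 1" and r: "0 < r" "r < pi"
    define a where "a = real j powr (- \<kappa> - 1/2)"
    have a: "a > 0" using j by (simp add: a_def)
    have I: "c * a \<le> I (poly (f j))" using f j by (simp add: approximate_identity_def a_def)
    have "0 < c * a" using c a by simp
    with I have I0: "I (poly (f j)) > 0" by linarith
    have v: "0 \<le> V (\<rho> / real j) r" using \<rho> j r by (intro pos) auto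
    have "poly (f j) (cos r) \<le> 3/2 * exp (- real j * (1 - cos r))"
      using f by (simp add: approximate_identity_def)
    also have "\<dots> \<le> 3/2 * (A * a * V (\<rho> / real j) r)" using init[OF j r] by (simp add: a_def)
    finally have "k * poly (f j) (cos r) \<le> k * (3/2 * (A * a * V (\<rho> / real j) r))"
      using k by (intro mult_left_mono) auto
    also have "\<dots> = c * a * V (\<rho> / real j) r" using A by (simp add: k_def)
    also have "\<dots> \<le> I (poly (f j)) * V (\<rho> / real j) r" using I v by (rule mult_right_mono)
    finally show "k / I (poly (f j)) * poly (f j) (cos r) \<le> V (\<rho> / real j) r"
      using I0 by (simp add: field_simps)
  qed (use that in auto)
  then show ?thesis using k by (intro that[of "1 / k"]) (auto simp: field_simps)
qed

text \<open>\<open>G_comparison\<close> with -V and negative k. V has to be bounded above away from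
  t = 0, since the minimum principle wants a lower bound for -V.\<close>

lemma G_lower:
  assumes V: "supersolution (\<lambda>t r. - V t r)"
    and pos: "\<And>t r. t > 0 \<Longrightarrow> 0 < r \<Longrightarrow> r < pi \<Longrightarrow> 0 \<le> V t r"
    and bdd: "\<And>s. s > 0 \<Longrightarrow> \<exists>M. \<forall>t r. s \<le> t \<and> 0 < r \<and> r < pi \<longrightarrow> V t r \<le> M"
    and \<rho>: "\<rho> > 0" and A: "A > 0"
    and init: "\<And>j r. j \<ge> 1 \<Longrightarrow> 0 < r \<Longrightarrow> r < pi \<Longrightarrow>
      A * real j powr (- \<kappa> - 1/2) * V (\<rho> / real j) r \<le> exp (- real j * (1 - cos r))"
  obtains c where "c > 0" "\<And>t r. t > 0 \<Longrightarrow> 0 < r \<Longrightarrow> r < pi \<Longrightarrow> c * V t r \<le> G t (cos r)"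
proof -
  obtain c C f where f: "approximate_identity c C f" by (rule approximate_identity_exists)
  then have c: "c > 0" "C > 0" by (simp_all add: approximate_identity_def)
  define k where "k = 2 * C / A"
  have k: "k > 0" using c A by (simp add: k_def)
  have "- k * G t (cos r) \<le> - V t r" if "t > 0" "0 < r" "r < pi" for t r
  proof (rule G_comparison[OF f V \<rho>])
    show "\<exists>M. \<forall>t r. s \<le> t \<and> 0 < r \<and> r < pi \<longrightarrow> - M \<le> - V t r" if "s > 0" for s
      using bdd[OF that] by simp
    fix j :: nat and r :: real assume j: "j \<ge> 1" and r: "0 < r" "r < pi"
    define a where "a = real j powr (- \<kappa> - 1/2)"
    have a: "a > 0" using j by (simp add: a_def)
    have I: "c * a \<le> I (poly (f j))" "I (poly (f j)) \<le> C * a"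
      using f j by (simp_all add: approximate_identity_def a_def)
    have "0 < c * a" using c a by simp
    with I have I0: "I (poly (f j)) > 0" by linarith
    have v: "0 \<le> V (\<rho> / real j) r" using \<rho> j r by (intro pos) auto
    have "I (poly (f j)) * V (\<rho> / real j) r \<le> C * a * V (\<rho> / real j) r" using I(2) v by (rule mult_right_mono)
    also have "\<dots> = k * (1/2 * (A * a * V (\<rho> / real j) r))" using A by (simp add: k_def)
    also have "\<dots> \<le> k * (1/2 * exp (- real j * (1 - cos r)))"
      using k init[OF j r] by (intro mult_left_mono) (auto simp: a_def)
    also have "\<dots> \<le> k * poly (f j) (cos r)"
      using f k by (intro mult_left_mono) (auto simp: approximate_identity_def)
    finally show "- k / I (poly (f j)) * poly (f j) (cos r) \<le> - V (\<rho> / real j) r"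
      using I0 by (simp add: field_simps)
  qed (use that in auto)
  then show ?thesis using k by (intro that[of "1 / k"]) (auto simp: field_simps)
qed

end

section \<open>Explicit supersolutions and subsolutions\<close>

text \<open>In the form r cot r \<le> 1 this is the sign that makes the plain Gaussian a
  subsolution.\<close>

lemma mult_cos_le_sin:
  assumes "0 \<le> x" "x \<le> pi"
  shows "x * cos x \<le> sin x"
proof -
  have "sin 0 - 0 * cos 0 \<le> sin x - x * cos x"
  proof (rule DERIV_nonneg_imp_nondecreasing[OF assms(1)])
    fix y :: real assume y: "0 \<le> y" "y \<le> x"
    have "((\<lambda>x. sin x - x * cos x) has_real_derivative y * sin y) (at y)"
      by (auto intro!: derivative_eq_intros)
    moreover have "0 \<le> y * sin y" using y assms by (simp add: sin_ge_zero)
    ultimately show "\<exists>d. ((\<lambda>x. sin x - x * cos x) has_real_derivative d) (at y) \<and> 0 \<le> d" by blast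
  qed
  then show ?thesis by simp
qed

text \<open>Up to \<pi>/3 the cosine is at least 1/2; from there to 2\<pi>/3 the sine is at least
  1/2 while x < 8. The range stops short of the zero of the sine at \<pi>.\<close>

lemma sin_ge_linear:
  assumes "0 \<le> x" "x \<le> 2 * pi / 3"
  shows "x / 16 \<le> sin x"
proof (cases "x \<le> pi / 3")
  case True
  have "cos (pi / 3) \<le> cos x" using assms True by (intro cos_monotone_0_pi_le) auto
  then have "x * (1/2) \<le> x * cos x" using assms by (intro mult_left_mono) (auto simp: cos_60)
  also have "\<dots> \<le> sin x" using assms by (intro mult_cos_le_sin) auto
  finally show ?thesis using assms by simp
next
  case False
  have "cos x \<le> cos (pi / 3)" using assms False by (intro cos_monotone_0_pi_le) auto
  then have 1: "cos x \<le> 1/2" by (simp add: cos_60)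
  have "cos (2 * pi / 3) \<le> cos x" using assms by (intro cos_monotone_0_pi_le) auto
  moreover have "cos (2 * pi / 3) = -1/2" by (simp add: cos_120)
  ultimately have "\<bar>cos x\<bar> \<le> 1/2" using 1 by simp
  then have "(cos x)\<^sup>2 \<le> (1/2)\<^sup>2" by (metis abs_ge_zero power2_abs power_mono)
  moreover have "(1/2 :: real)\<^sup>2 = 1/4" by (simp add: power2_eq_square)
  ultimately have "(1/2)\<^sup>2 \<le> (sin x)\<^sup>2" unfolding sin_squared_eq by simp
  moreover have "sin x \<ge> 0" using assms by (intro sin_ge_zero) auto
  ultimately have "1/2 \<le> sin x" by (meson power2_le_imp_le)
  then show ?thesis using assms pi_less_4 by linarith
qed

text \<open>Monotonicity of z^2 + 2 cos z and of -32 cos z - z^2, where 32 = 2 * 16 comes from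
  \<open>sin_ge_linear\<close>. For y beyond 2\<pi>/3, x \<le> \<pi>/2 gives cos x - cos y \<ge>
  1/2, while y^2 \<le> 16.\<close>

lemma square_diff_cos_diff:
  assumes "0 \<le> x" "x \<le> y" "y \<le> pi" "x \<le> pi / 2"
  shows "2 * (cos x - cos y) \<le> y\<^sup>2 - x\<^sup>2" and "y\<^sup>2 - x\<^sup>2 \<le> 32 * (cos x - cos y)"
proof -
  have "x\<^sup>2 + 2 * cos x \<le> y\<^sup>2 + 2 * cos y"
  proof (rule DERIV_nonneg_imp_nondecreasing[OF assms(2)])
    fix z :: real assume z: "x \<le> z" "z \<le> y"
    have "((\<lambda>x. x\<^sup>2 + 2 * cos x) has_real_derivative 2 * (z - sin z)) (at z)"
      by (auto intro!: derivative_eq_intros)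
    moreover have "0 \<le> 2 * (z - sin z)" using sin_x_le_x[of z] z assms by simp
    ultimately show "\<exists>d. ((\<lambda>x. x\<^sup>2 + 2 * cos x) has_real_derivative d) (at z) \<and> 0 \<le> d" by blast
  qed
  then show "2 * (cos x - cos y) \<le> y\<^sup>2 - x\<^sup>2" by simp
  show "y\<^sup>2 - x\<^sup>2 \<le> 32 * (cos x - cos y)"
  proof (cases "y \<le> 2 * pi / 3")
    case True
    have "- 32 * cos x - x\<^sup>2 \<le> - 32 * cos y - y\<^sup>2"
    proof (rule DERIV_nonneg_imp_nondecreasing[OF assms(2)])
      fix z :: real assume z: "x \<le> z" "z \<le> y"
      have "((\<lambda>x. - 32 * cos x - x\<^sup>2) has_real_derivative 32 * sin z - 2 * z) (at z)"
        by (auto intro!: derivative_eq_intros)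
      moreover have "0 \<le> 32 * sin z - 2 * z" using sin_ge_linear[of z] z assms True by simp
      ultimately show "\<exists>d. ((\<lambda>x. - 32 * cos x - x\<^sup>2) has_real_derivative d) (at z) \<and> 0 \<le> d" by blast
    qed
    then show ?thesis by simp
  next
    case False
    have "cos y \<le> cos (2 * pi / 3)" using False assms by (intro cos_monotone_0_pi_le) auto
    moreover have "0 \<le> cos x" using assms by (intro cos_ge_zero) auto
    ultimately have "1/2 \<le> cos x - cos y" by (simp add: cos_120)
    moreover have "y\<^sup>2 \<le> 4\<^sup>2" using assms pi_less_4 by (intro power_mono) auto
    then have "y\<^sup>2 \<le> 16" by simp
    moreover have "0 \<le> x\<^sup>2" by simp
    ultimately show ?thesis by argo
  qed
qed

context ultraspherical
begin

text \<open>Division by exp g turns the second derivative into g'' + g'^2. The factor e is 1 for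
  supersolutions and -1 for the negatives of subsolutions.\<close>

lemma exp_supersolution:
  fixes e :: real
  assumes cont: "continuous_on ({0<..} \<times> {0<..<pi}) (\<lambda>(t, r). g t r)"
    and gt: "\<And>t r. 0 < t \<Longrightarrow> 0 < r \<Longrightarrow> r < pi \<Longrightarrow> ((\<lambda>s. g s r) has_real_derivative gt t r) (at t)"
    and g1: "\<And>t r. 0 < t \<Longrightarrow> 0 < r \<Longrightarrow> r < pi \<Longrightarrow> (g t has_real_derivative g1 t r) (at r)"
    and g2: "\<And>t r. 0 < t \<Longrightarrow> 0 < r \<Longrightarrow> r < pi \<Longrightarrow> (g1 t has_real_derivative g2 t r) (at r)"
    and ineq: "\<And>t r. 0 < t \<Longrightarrow> 0 < r \<Longrightarrow> r < pi \<Longrightarrow>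
      e * (g2 t r + (g1 t r)\<^sup>2 + 2 * \<kappa> * (cos r / sin r) * g1 t r) \<le> e * gt t r"
  shows "supersolution (\<lambda>t r. e * exp (g t r))"
  unfolding supersolution_def
proof (intro conjI exI allI impI; (elim conjE)?)
  show "continuous_on ({0<..} \<times> {0<..<pi}) (\<lambda>(t, r). e * exp (g t r))"
    using continuous_on_mult_left[OF continuous_on_exp[OF cont], of e] by (simp add: case_prod_unfold)
  fix t r :: real assume p: "0 < t" "0 < r" "r < pi"
  show "((\<lambda>s. e * exp (g s r)) has_real_derivative e * (exp (g t r) * gt t r)) (at t)"
    by (intro DERIV_cmult DERIV_fun_exp gt p)
  have d: "((\<lambda>r. exp (g t r)) has_real_derivative exp (g t r) * g1 t r) (at r)"
    by (rule DERIV_fun_exp[OF g1[OF p]])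
  then show "((\<lambda>r. e * exp (g t r)) has_real_derivative e * (exp (g t r) * g1 t r)) (at r)"
    by (rule DERIV_cmult)
  show "((\<lambda>r. e * (exp (g t r) * g1 t r)) has_real_derivative e * (exp (g t r) * (g2 t r + (g1 t r)\<^sup>2))) (at r)"
    by (intro DERIV_cmult, rule DERIV_cong[OF DERIV_mult'[OF d g2[OF p]]]) (simp add: algebra_simps power2_eq_square)
  show "e * (exp (g t r) * (g2 t r + (g1 t r)\<^sup>2)) + 2 * \<kappa> * (cos r / sin r) * (e * (exp (g t r) * g1 t r))
    \<le> e * (exp (g t r) * gt t r)"
    using mult_left_mono[OF ineq[OF p], of "exp (g t r)"] by (simp add: algebra_simps)
qed

text \<open>At time \<rho>/j the factor t powr (-\<kappa> - 1/2) offsets j powr (-\<kappa> - 1/2),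
  so only the exponents remain to be compared.\<close>

lemma exp_initial_scaling:
  assumes "j \<ge> 1" "\<rho> > 0"
  shows "\<rho> powr (\<kappa> + 1/2) * real j powr (- \<kappa> - 1/2) * exp (- (\<kappa> + 1/2) * ln (\<rho> / real j) + y) = exp y"
  using assms by (simp add: powr_def ln_div algebra_simps flip: exp_add)

text \<open>(r / sin r)^\<kappa> is the inverse square root of the volume density (sin r /
  r)^(2\<kappa>), the leading term of the heat parametrix; it cancels all terms in 1/t. With
  exp(\<kappa>^2 t) included, the defect is (\<kappa>^2 - \<kappa>)(1/(sin r)^2 - 1/r^2) \<ge>
  0.\<close>

lemma G_upper_gauss:
  obtains C where "C > 0" "\<And>t r. 0 < t \<Longrightarrow> 0 < r \<Longrightarrow> r < pi \<Longrightarrow>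
    G t (cos r) \<le> C * exp (\<kappa>\<^sup>2 * t - (\<kappa> + 1/2) * ln t - r\<^sup>2 / (4 * t) + \<kappa> * (ln r - ln (sin r)))"
proof -
  define g where "g t r = \<kappa>\<^sup>2 * t - (\<kappa> + 1/2) * ln t - r\<^sup>2 / (4 * t) + \<kappa> * (ln r - ln (sin r))" for t r
  define gt where "gt t r = \<kappa>\<^sup>2 - (\<kappa> + 1/2) / t + r\<^sup>2 / (4 * t\<^sup>2)" for t r :: real
  define g1 where "g1 t r = - r / (2 * t) + \<kappa> * (1 / r - cos r / sin r)" for t r
  define g2 where "g2 t r = - 1 / (2 * t) + \<kappa> * (1 / (sin r)\<^sup>2 - 1 / r\<^sup>2)" for t r :: real
  have "supersolution (\<lambda>t r. 1 * exp (g t r))"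
  proof (rule exp_supersolution)
    show "continuous_on ({0<..} \<times> {0<..<pi}) (\<lambda>(t, r). g t r)"
      unfolding g_def case_prod_unfold
      by (intro continuous_intros) (auto simp: less_imp_neq[OF sin_gt_zero, THEN not_sym])
    fix t r :: real assume t: "0 < t" and p: "0 < r" "r < pi"
    have s: "sin r > 0" using p by (rule sin_gt_zero)
    show "((\<lambda>s. g s r) has_real_derivative gt t r) (at t)"
      unfolding g_def gt_def using t by (auto intro!: derivative_eq_intros simp: field_simps power2_eq_square)
    show "(g t has_real_derivative g1 t r) (at r)"
      unfolding g_def g1_def using t p s by (auto intro!: derivative_eq_intros simp: field_simps)
    have dcot: "((\<lambda>r. cos r / sin r) has_real_derivative - 1 / (sin r)\<^sup>2) (at r)"
      using s by (auto intro!: derivative_eq_intros simp: power2_eq_square[symmetric] cos_squared_eq)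
    have dinv: "((\<lambda>r. 1 / r) has_real_derivative - 1 / r\<^sup>2) (at r)"
      using p by (auto intro!: derivative_eq_intros simp: power2_eq_square)
    have dlin: "((\<lambda>r. - r / (2 * t)) has_real_derivative - 1 / (2 * t)) (at r)"
      using t by (auto intro!: derivative_eq_intros)
    show "(g1 t has_real_derivative g2 t r) (at r)"
      using DERIV_add[OF dlin DERIV_cmult[OF DERIV_diff[OF dinv dcot], of \<kappa>]]
      by (simp add: g1_def[abs_def] g2_def)
    define X k q where "X = 1 / r" and "k = cos r / sin r" and "q = r / (2 * t)"
    have Xq: "2 * (X * q) = 1 / t" using t p by (simp add: X_def q_def)
    have k2: "1 / (sin r)\<^sup>2 = 1 + k\<^sup>2" using s by (simp add: k_def power_divide cos_squared_eq field_simps)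
    have sin_le: "1 / r\<^sup>2 \<le> 1 / (sin r)\<^sup>2"
      using s p sin_x_le_x[of r] by (intro divide_left_mono power_mono) auto
    have "gt t r - (g2 t r + (g1 t r)\<^sup>2 + 2 * \<kappa> * k * g1 t r)
      = \<kappa>\<^sup>2 - (\<kappa> + 1/2) * (2 * (X * q)) + q\<^sup>2 - (- (X * q) + \<kappa> * ((1 + k\<^sup>2) - X\<^sup>2) + (- q + \<kappa> * (X - k))\<^sup>2
        + 2 * \<kappa> * k * (- q + \<kappa> * (X - k)))"
      unfolding gt_def g2_def g1_def k2[symmetric] Xq
      unfolding k_def[symmetric] unfolding X_def q_def
      using t p by (simp add: field_simps power2_eq_square)
    also have "\<dots> = (\<kappa>\<^sup>2 - \<kappa>) * ((1 + k\<^sup>2) - X\<^sup>2)"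
      by (simp add: power2_eq_square algebra_simps)
    also have "\<dots> \<ge> 0"
      using kappa sin_le unfolding k2[symmetric] X_def
      by (intro mult_nonneg_nonneg) (auto simp: power2_eq_square)
    finally show "1 * (g2 t r + (g1 t r)\<^sup>2 + 2 * \<kappa> * (cos r / sin r) * g1 t r) \<le> 1 * gt t r"
      by (simp add: k_def)
  qed
  then have sup: "supersolution (\<lambda>t r. exp (g t r))" by simp
  show ?thesis
  \<comment> \<open>\<rho> = 8 turns r^2 \<le> 32 (1 - cos r) into r^2 / (4\<rho>/j) \<le> j (1 -
    cos r).\<close>
  proof (rule G_upper[OF sup, where \<rho> = 8 and A = "8 powr (\<kappa> + 1/2)"])
    fix j :: nat and r :: real assume j: "j \<ge> 1" and p: "0 < r" "r < pi"
    have s: "sin r > 0" using p by (rule sin_gt_zero)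
    have ln: "ln (sin r) \<le> ln r" using s p sin_x_le_x[of r] by (subst ln_le_cancel_iff) auto
    have "r\<^sup>2 \<le> 32 * (1 - cos r)" using square_diff_cos_diff(2)[of 0 r] p by simp
    then have "real j * r\<^sup>2 \<le> real j * (32 * (1 - cos r))" by (intro mult_left_mono) auto
    then have "- real j * (1 - cos r) \<le> - r\<^sup>2 / (4 * (8 / real j))" using j by (simp add: field_simps)
    also have "\<dots> \<le> \<kappa>\<^sup>2 * (8 / real j) - r\<^sup>2 / (4 * (8 / real j)) + \<kappa> * (ln r - ln (sin r))"
      using ln kappa by simp
    finally have "exp (- real j * (1 - cos r)) \<le>
      exp (\<kappa>\<^sup>2 * (8 / real j) - r\<^sup>2 / (4 * (8 / real j)) + \<kappa> * (ln r - ln (sin r)))" by simp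
    also have "\<dots> = 8 powr (\<kappa> + 1/2) * real j powr (- \<kappa> - 1/2) * exp (g (8 / real j) r)"
      by (subst exp_initial_scaling[OF j, of 8, symmetric]) (simp_all add: g_def algebra_simps)
    finally show "exp (- real j * (1 - cos r)) \<le> 8 powr (\<kappa> + 1/2) * real j powr (- \<kappa> - 1/2) * exp (g (8 / real j) r)" .
  qed (use that in \<open>auto simp: g_def\<close>)
qed

text \<open>The defect is the perfect square (m - (1 - cos r)/(2t))^2 with m = \<kappa> + 1/2. Since
  1 - cos r is smooth at \<pi>, the bound stays finite at the antipode.\<close>

lemma G_upper_far:
  obtains C where "C > 0" "\<And>t r. 0 < t \<Longrightarrow> 0 < r \<Longrightarrow> r < pi \<Longrightarrow>
    G t (cos r) \<le> C * exp ((\<kappa> + 1/2)\<^sup>2 * t - (\<kappa> + 1/2) * ln t - (1 - cos r) / (2 * t))"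
proof -
  define m where "m = \<kappa> + 1/2"
  define g where "g t r = m\<^sup>2 * t - m * ln t - (1 - cos r) / (2 * t)" for t r :: real
  define gt where "gt t r = m\<^sup>2 - m / t + (1 - cos r) / (2 * t\<^sup>2)" for t r :: real
  define g1 where "g1 t r = - sin r / (2 * t)" for t r :: real
  define g2 where "g2 t r = - cos r / (2 * t)" for t r :: real
  have "supersolution (\<lambda>t r. 1 * exp (g t r))"
  proof (rule exp_supersolution)
    show "continuous_on ({0<..} \<times> {0<..<pi}) (\<lambda>(t, r). g t r)"
      unfolding g_def case_prod_unfold by (intro continuous_intros) auto
    fix t r :: real assume t: "0 < t" and p: "0 < r" "r < pi"
    have s: "sin r > 0" using p by (rule sin_gt_zero)
    show "((\<lambda>s. g s r) has_real_derivative gt t r) (at t)"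
      unfolding g_def gt_def using t by (auto intro!: derivative_eq_intros simp: field_simps power2_eq_square)
    show "(g t has_real_derivative g1 t r) (at r)"
      unfolding g_def g1_def using t by (auto intro!: derivative_eq_intros simp: field_simps)
    show "(g1 t has_real_derivative g2 t r) (at r)"
      unfolding g1_def g2_def using t by (auto intro!: derivative_eq_intros simp: field_simps)
    define c where "c = cos r"
    have s2: "(sin r)\<^sup>2 = 1 - c\<^sup>2" by (simp add: c_def sin_squared_eq)
    have "gt t r - (g2 t r + (g1 t r)\<^sup>2 + 2 * \<kappa> * (cos r / sin r) * g1 t r)
      = m\<^sup>2 - m / t + (1 - c) / (2 * t\<^sup>2) + c / (2 * t) - (1 - c\<^sup>2) / (4 * t\<^sup>2) + \<kappa> * c / t"
      unfolding gt_def g1_def g2_def using s t by (simp add: power_divide power_mult_distrib s2 c_def[symmetric])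
    also have "\<dots> = (m - (1 - c) / (2 * t))\<^sup>2"
      using t by (simp add: m_def field_simps power2_eq_square)
    also have "\<dots> \<ge> 0" by simp
    finally show "1 * (g2 t r + (g1 t r)\<^sup>2 + 2 * \<kappa> * (cos r / sin r) * g1 t r) \<le> 1 * gt t r"
      by simp
  qed
  then have sup: "supersolution (\<lambda>t r. exp (g t r))" by simp
  show ?thesis
  \<comment> \<open>With \<rho> = 1/2 the last term of the exponent at time \<rho>/j is exactly -j
    (1 - cos r).\<close>
  proof (rule G_upper[OF sup, where \<rho> = "1/2" and A = "(1/2) powr m"])
    fix j :: nat and r :: real assume j: "j \<ge> 1" and p: "0 < r" "r < pi"
    have "- real j * (1 - cos r) \<le> m\<^sup>2 * ((1/2) / real j) - (1 - cos r) / (2 * ((1/2) / real j))"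
      using j by simp
    then have "exp (- real j * (1 - cos r)) \<le> exp (m\<^sup>2 * ((1/2) / real j) - (1 - cos r) / (2 * ((1/2) / real j)))"
      by simp
    also have "\<dots> = (1/2) powr m * real j powr (- \<kappa> - 1/2) * exp (g ((1/2) / real j) r)"
      by (subst exp_initial_scaling[OF j, of "1/2", symmetric]) (simp_all add: g_def m_def algebra_simps)
    finally show "exp (- real j * (1 - cos r)) \<le> (1/2) powr m * real j powr (- \<kappa> - 1/2) * exp (g ((1/2) / real j) r)" .
  qed (use that in \<open>auto simp: g_def m_def\<close>)
qed

text \<open>The defect is (\<kappa>/t)(1 - r cot r), nonnegative by
  \<open>mult_cos_le_sin\<close>.\<close>

lemma G_lower_gauss:
  obtains c where "c > 0" "\<And>t r. 0 < t \<Longrightarrow> 0 < r \<Longrightarrow> r < pi \<Longrightarrow>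
    c * exp (- (\<kappa> + 1/2) * ln t - r\<^sup>2 / (4 * t)) \<le> G t (cos r)"
proof -
  define m where "m = \<kappa> + 1/2"
  define g where "g t r = - m * ln t - r\<^sup>2 / (4 * t)" for t r :: real
  define gt where "gt t r = - m / t + r\<^sup>2 / (4 * t\<^sup>2)" for t r :: real
  define g1 where "g1 t r = - r / (2 * t)" for t r :: real
  define g2 where "g2 t r = - 1 / (2 * t)" for t r :: real
  have "supersolution (\<lambda>t r. (-1) * exp (g t r))"
  proof (rule exp_supersolution)
    show "continuous_on ({0<..} \<times> {0<..<pi}) (\<lambda>(t, r). g t r)"
      unfolding g_def case_prod_unfold by (intro continuous_intros) auto
    fix t r :: real assume t: "0 < t" and p: "0 < r" "r < pi"
    have s: "sin r > 0" using p by (rule sin_gt_zero)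
    show "((\<lambda>s. g s r) has_real_derivative gt t r) (at t)"
      unfolding g_def gt_def using t by (auto intro!: derivative_eq_intros simp: field_simps power2_eq_square)
    show "(g t has_real_derivative g1 t r) (at r)"
      unfolding g_def g1_def using t by (auto intro!: derivative_eq_intros simp: field_simps)
    show "(g1 t has_real_derivative g2 t r) (at r)"
      unfolding g1_def g2_def using t by (auto intro!: derivative_eq_intros simp: field_simps)
    have "r * (cos r / sin r) \<le> 1" using mult_cos_le_sin[of r] p s by simp
    then have "\<kappa> / t * (r * (cos r / sin r)) \<le> \<kappa> / t * 1" using kappa t by (intro mult_left_mono) auto
    moreover have "g2 t r + (g1 t r)\<^sup>2 + 2 * \<kappa> * (cos r / sin r) * g1 t r - gt t r
      = \<kappa> / t - \<kappa> / t * (r * (cos r / sin r))"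
      unfolding gt_def g1_def g2_def m_def using t by (simp add: field_simps power2_eq_square)
    ultimately have "gt t r \<le> g2 t r + (g1 t r)\<^sup>2 + 2 * \<kappa> * (cos r / sin r) * g1 t r"
      by linarith
    then show "(-1) * (g2 t r + (g1 t r)\<^sup>2 + 2 * \<kappa> * (cos r / sin r) * g1 t r) \<le> (-1) * gt t r"
      by simp
  qed
  then have sub: "supersolution (\<lambda>t r. - exp (g t r))" by simp
  show ?thesis
  \<comment> \<open>\<rho> = 1/2 is fitted to 2 (1 - cos r) \<le> r^2.\<close>
  proof (rule G_lower[OF sub, where \<rho> = "1/2" and A = "(1/2) powr m"])
    fix s :: real assume s: "s > 0"
    have "exp (g t r) \<le> exp (- m * ln s)" if "s \<le> t" for t r
    proof -
      have "m * ln s \<le> m * ln t" using that s kappa by (intro mult_left_mono) (auto simp: m_def)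
      moreover have "0 \<le> r\<^sup>2 / (4 * t)" using that s by simp
      ultimately show ?thesis by (simp add: g_def)
    qed
    then show "\<exists>M. \<forall>t r. s \<le> t \<and> 0 < r \<and> r < pi \<longrightarrow> exp (g t r) \<le> M" by blast
  next
    fix j :: nat and r :: real assume j: "j \<ge> 1" and p: "0 < r" "r < pi"
    have "2 * (1 - cos r) \<le> r\<^sup>2" using square_diff_cos_diff(1)[of 0 r] p by simp
    then have "real j * (2 * (1 - cos r)) \<le> real j * r\<^sup>2" by (intro mult_left_mono) auto
    then have le: "- r\<^sup>2 / (4 * ((1/2) / real j)) \<le> - real j * (1 - cos r)" using j by (simp add: field_simps)
    have "(1/2) powr m * real j powr (- \<kappa> - 1/2) * exp (g ((1/2) / real j) r)
      = exp (- r\<^sup>2 / (4 * ((1/2) / real j)))"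
      by (subst exp_initial_scaling[OF j, of "1/2", symmetric]) (simp_all add: g_def m_def algebra_simps)
    then show "(1/2) powr m * real j powr (- \<kappa> - 1/2) * exp (g ((1/2) / real j) r) \<le> exp (- real j * (1 - cos r))"
      using le by simp
  qed (use that in \<open>auto simp: g_def m_def\<close>)
qed

end

section \<open>Bounds for the zonal heat kernel\<close>

context ultraspherical
begin

text \<open>The Gaussian is frozen at X and only the increment X - x is estimated with loss. The
  rate 8 is 32/4 from \<open>square_diff_cos_diff\<close>; the rate 1/20 is dictated by the region
  near the antipode.\<close>

lemma G_sandwich:
  obtains c C where "c > 0" "C > 0"
    "\<And>t x X. 0 < t \<Longrightarrow> t \<le> 1 \<Longrightarrow> 0 \<le> X \<Longrightarrow> X \<le> 1 \<Longrightarrow> - 1 \<le> x \<Longrightarrow> x \<le> X \<Longrightarrow>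
      c * t powr (- \<kappa> - 1/2) * exp (- (arccos X)\<^sup>2 / (4 * t)) * exp (- (8 / t) * (X - x)) \<le> G t x"
    "\<And>t x X. 0 < t \<Longrightarrow> t \<le> 1 \<Longrightarrow> 0 \<le> X \<Longrightarrow> X \<le> 1 \<Longrightarrow> - 1 \<le> x \<Longrightarrow> x \<le> X \<Longrightarrow>
      G t x \<le> C * t powr (- \<kappa> - 1/2) * exp (- (arccos X)\<^sup>2 / (4 * t)) * exp (- (1 / (20 * t)) * (X - x))"
proof -
  obtain c where c: "c > 0" "\<And>t r. 0 < t \<Longrightarrow> 0 < r \<Longrightarrow> r < pi \<Longrightarrow>
    c * exp (- (\<kappa> + 1/2) * ln t - r\<^sup>2 / (4 * t)) \<le> G t (cos r)"
    using G_lower_gauss by blast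
  obtain C1 where C1: "C1 > 0" "\<And>t r. 0 < t \<Longrightarrow> 0 < r \<Longrightarrow> r < pi \<Longrightarrow>
    G t (cos r) \<le> C1 * exp (\<kappa>\<^sup>2 * t - (\<kappa> + 1/2) * ln t - r\<^sup>2 / (4 * t) + \<kappa> * (ln r - ln (sin r)))"
    using G_upper_gauss by blast
  obtain C2 where C2: "C2 > 0" "\<And>t r. 0 < t \<Longrightarrow> 0 < r \<Longrightarrow> r < pi \<Longrightarrow>
    G t (cos r) \<le> C2 * exp ((\<kappa> + 1/2)\<^sup>2 * t - (\<kappa> + 1/2) * ln t - (1 - cos r) / (2 * t))"
    using G_upper_far by blast
  define C where "C = C1 * exp (\<kappa>\<^sup>2 + \<kappa> * ln 16) + C2 * exp ((\<kappa> + 1/2)\<^sup>2)"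
  have C: "C > 0" "C1 * exp (\<kappa>\<^sup>2 + \<kappa> * ln 16) \<le> C" "C2 * exp ((\<kappa> + 1/2)\<^sup>2) \<le> C"
    using C1(1) C2(1) by (auto simp: C_def add_pos_pos)
  define A where "A t X = t powr (- \<kappa> - 1/2) * exp (- (arccos X)\<^sup>2 / (4 * t))" for t X
  have A_exp: "A t X * exp y = exp (- (\<kappa> + 1/2) * ln t - (arccos X)\<^sup>2 / (4 * t) + y)" if "t > 0" for t X y
    using that by (simp add: A_def powr_def algebra_simps flip: exp_add)
  have both: "c * A t X * exp (- (8 / t) * (X - x)) \<le> G t x \<and> G t x \<le> C * A t X * exp (- (1 / (20 * t)) * (X - x))"
    if t: "0 < t" "t \<le> 1" and X: "0 \<le> X" "X \<le> 1" and x: "- 1 < x" "x < X" for t x X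
  proof -
    define r \<Phi> where "r = arccos x" and "\<Phi> = arccos X"
    have x': "x = cos r" and X': "X = cos \<Phi>" using x X by (auto simp: r_def \<Phi>_def)
    have r: "0 < r" "r < pi" using x X arccos_lt_bounded[of x] by (auto simp: r_def)
    have \<Phi>: "0 \<le> \<Phi>" "\<Phi> \<le> pi / 2" "\<Phi> \<le> r"
      unfolding r_def \<Phi>_def using x X
      by (simp_all only: arccos_le_pi2) (auto intro: arccos_le_arccos arccos_lbound)
    have sq: "2 * (X - x) \<le> r\<^sup>2 - \<Phi>\<^sup>2" "r\<^sup>2 - \<Phi>\<^sup>2 \<le> 32 * (X - x)"
      unfolding x' X' using r \<Phi> by (intro square_diff_cos_diff; simp)+
    have "c * A t X * exp (- (8 / t) * (X - x)) = c * exp (- (\<kappa> + 1/2) * ln t - \<Phi>\<^sup>2 / (4 * t) + - (8 / t) * (X - x))"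
      using A_exp[OF t(1), of X] by (simp only: mult.assoc \<Phi>_def)
    also have "\<dots> \<le> c * exp (- (\<kappa> + 1/2) * ln t - r\<^sup>2 / (4 * t))"
    proof -
      have "r\<^sup>2 / (4 * t) \<le> (\<Phi>\<^sup>2 + 32 * (X - x)) / (4 * t)" using sq t by (intro divide_right_mono) auto
      also have "\<dots> = \<Phi>\<^sup>2 / (4 * t) - (- (8 / t) * (X - x))" using t by (simp add: field_simps)
      finally have "- (\<kappa> + 1/2) * ln t - \<Phi>\<^sup>2 / (4 * t) + - (8 / t) * (X - x) \<le> - (\<kappa> + 1/2) * ln t - r\<^sup>2 / (4 * t)"
        by simp
      then show ?thesis using c(1) by simp
    qed
    also have "\<dots> \<le> G t x" unfolding x' using t r by (intro c) auto
    finally have lower: "c * A t X * exp (- (8 / t) * (X - x)) \<le> G t x" .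
    define Y where "Y = - (\<kappa> + 1/2) * ln t - \<Phi>\<^sup>2 / (4 * t) + - (1 / (20 * t)) * (X - x)"
    have upper: "G t x \<le> C * exp Y"
    \<comment> \<open>Up to 2\<pi>/3 the correction (r / sin r)^\<kappa> is at most 16^\<kappa>;
      beyond, the second supersolution takes over.\<close>
    proof (cases "r \<le> 2 * pi / 3")
      case True
      have s: "sin r > 0" using r by (simp add: sin_gt_zero)
      have "ln r \<le> ln (16 * sin r)" using sin_ge_linear[of r] True r by (subst ln_le_cancel_iff) auto
      then have "ln r - ln (sin r) \<le> ln 16" using s by (simp add: ln_mult)
      then have "\<kappa> * (ln r - ln (sin r)) \<le> \<kappa> * ln 16" using kappa by (intro mult_left_mono) auto
      moreover have "\<kappa>\<^sup>2 * t \<le> \<kappa>\<^sup>2 * 1" using t by (intro mult_left_mono) auto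
      moreover have "(\<Phi>\<^sup>2 + 2 * (X - x)) / (4 * t) \<le> r\<^sup>2 / (4 * t)" using sq t by (intro divide_right_mono) auto
      moreover have "(\<Phi>\<^sup>2 + 2 * (X - x)) / (4 * t) = \<Phi>\<^sup>2 / (4 * t) + (X - x) / (2 * t)"
        using t by (simp add: field_simps)
      moreover have "(X - x) / (20 * t) \<le> (X - x) / (2 * t)" using t x by (intro divide_left_mono) auto
      ultimately have le: "\<kappa>\<^sup>2 * t - (\<kappa> + 1/2) * ln t - r\<^sup>2 / (4 * t) + \<kappa> * (ln r - ln (sin r))
        \<le> (\<kappa>\<^sup>2 + \<kappa> * ln 16) + Y"
        by (simp add: Y_def left_diff_distrib distrib_right)
      have "G t x \<le> C1 * exp (\<kappa>\<^sup>2 * t - (\<kappa> + 1/2) * ln t - r\<^sup>2 / (4 * t) + \<kappa> * (ln r - ln (sin r)))"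
        unfolding x' using t r by (intro C1) auto
      also have "\<dots> \<le> C1 * (exp (\<kappa>\<^sup>2 + \<kappa> * ln 16) * exp Y)"
        unfolding exp_add[symmetric] using C1(1) le by (intro mult_left_mono) auto
      also have "\<dots> \<le> C * exp Y"
        unfolding mult.assoc[symmetric] using C(2) by (intro mult_right_mono) auto
      finally show ?thesis .
    next
      case False
      have "cos r \<le> cos (2 * pi / 3)" using False r by (intro cos_monotone_0_pi_le) auto
      then have xl: "x \<le> - 1/2" by (simp add: x' cos_120)
      \<comment> \<open>Since \<Phi> \<le> \<pi>/2 \<le> 8/5 and x \<le> -1/2, 5\<Phi>^2 \<le> 64/5
        \<le> 9 (1 - x); one more 1 - x covers X - x. Division by 20t then splits off the exact
        Gaussian at \<Phi>.\<close>
      have "\<Phi>\<^sup>2 \<le> (8/5)\<^sup>2" using \<Phi> pi_approx by (intro power_mono) auto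
      moreover have "(8/5 :: real)\<^sup>2 = 64/25" by (simp add: power2_eq_square)
      ultimately have "5 * \<Phi>\<^sup>2 + (X - x) \<le> 10 * (1 - x)" using xl X by argo
      then have "(5 * \<Phi>\<^sup>2 + (X - x)) / (20 * t) \<le> 10 * (1 - x) / (20 * t)" using t by (intro divide_right_mono) auto
      moreover have "(5 * \<Phi>\<^sup>2 + (X - x)) / (20 * t) = \<Phi>\<^sup>2 / (4 * t) + (X - x) / (20 * t)"
        "10 * (1 - x) / (20 * t) = (1 - x) / (2 * t)"
        using t by (simp_all add: field_simps)
      moreover have "(\<kappa> + 1/2)\<^sup>2 * t \<le> (\<kappa> + 1/2)\<^sup>2 * 1" using t by (intro mult_left_mono) auto
      ultimately have le: "(\<kappa> + 1/2)\<^sup>2 * t - (\<kappa> + 1/2) * ln t - (1 - cos r) / (2 * t)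
        \<le> (\<kappa> + 1/2)\<^sup>2 + Y"
        by (simp add: Y_def x' left_diff_distrib distrib_right)
      have "G t x \<le> C2 * exp ((\<kappa> + 1/2)\<^sup>2 * t - (\<kappa> + 1/2) * ln t - (1 - cos r) / (2 * t))"
        unfolding x' using t r by (intro C2) auto
      also have "\<dots> \<le> C2 * (exp ((\<kappa> + 1/2)\<^sup>2) * exp Y)"
        unfolding exp_add[symmetric] using C2(1) le by (intro mult_left_mono) auto
      also have "\<dots> \<le> C * exp Y"
        unfolding mult.assoc[symmetric] using C(3) by (intro mult_right_mono) auto
      finally show ?thesis .
    qed
    then have "G t x \<le> C * A t X * exp (- (1 / (20 * t)) * (X - x))"
      using A_exp[OF t(1), of X] by (simp only: mult.assoc \<Phi>_def Y_def)
    with lower show ?thesis by blast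
  qed
  \<comment> \<open>The comparison lives on 0 < r < \<pi> and \<open>both\<close> on -1 < x < X; the
    end points follow by continuity of \<open>G t\<close>.\<close>
  have closed: "c * A t X * exp (- (8 / t) * (X - x)) \<le> G t x" "G t x \<le> C * A t X * exp (- (1 / (20 * t)) * (X - x))"
    if t: "0 < t" "t \<le> 1" and X: "0 \<le> X" "X \<le> 1" and x: "- 1 \<le> x" "x \<le> X" for t x X
  proof -
    have cl: "closure {-1<..<X} = {-1..X}" using X by (intro closure_greaterThanLessThan) simp
    have cG: "continuous_on {-1..X} (G t)" by (rule continuous_on_subset[OF continuous_G[OF t(1)]]) (use X in auto)
    have "c * A t X * exp (- (8 / t) * (X - x)) - G t x \<le> 0"
    proof (rule continuous_le_on_closure[of "{-1<..<X}" "\<lambda>x. c * A t X * exp (- (8 / t) * (X - x)) - G t x"])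
      show "continuous_on (closure {-1<..<X}) (\<lambda>x. c * A t X * exp (- (8 / t) * (X - x)) - G t x)"
        unfolding cl by (intro continuous_intros cG)
      show "x \<in> closure {-1<..<X}" unfolding cl using x by simp
    qed (use both t X in auto)
    then show "c * A t X * exp (- (8 / t) * (X - x)) \<le> G t x" by simp
    have "G t x - C * A t X * exp (- (1 / (20 * t)) * (X - x)) \<le> 0"
    proof (rule continuous_le_on_closure[of "{-1<..<X}" "\<lambda>x. G t x - C * A t X * exp (- (1 / (20 * t)) * (X - x))"])
      show "continuous_on (closure {-1<..<X}) (\<lambda>x. G t x - C * A t X * exp (- (1 / (20 * t)) * (X - x)))"
        unfolding cl by (intro continuous_intros cG)
      show "x \<in> closure {-1<..<X}" unfolding cl using x by simp
    qed (use both t X in auto)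
    then show "G t x \<le> C * A t X * exp (- (1 / (20 * t)) * (X - x))" by simp
  qed
  show ?thesis
    by (rule that[OF c(1) C(1)]) (use closed in \<open>simp_all add: A_def mult.assoc\<close>)
qed

text \<open>The term n = 0 is the constant 1, and the rest is at most exp(1 - t) S because ev n
  \<ge> 1 for n \<ge> 1. This settles t \<ge> T; on the bounded range 1 \<le> t \<le> T positivity
  comes from the Gaussian lower bound.\<close>

lemma G_large_time:
  obtains c C where "c > 0" "C > 0"
    "\<And>t w. 1 \<le> t \<Longrightarrow> w \<in> {-1..1} \<Longrightarrow> c \<le> G t w" "\<And>t w. 1 \<le> t \<Longrightarrow> w \<in> {-1..1} \<Longrightarrow> G t w \<le> C"
proof -
  define S where "S = (\<Sum>n. exp (- 1 * ev (Suc n)) * Z (Suc n) 1)"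
  have sumS: "summable (\<lambda>n. exp (- 1 * ev (Suc n)) * Z (Suc n) 1)"
    using summable_Z_1[of 1] by (subst summable_Suc_iff) simp
  have S: "S \<ge> 0" unfolding S_def using sumS Z_1_pos by (intro suminf_nonneg) (auto simp: less_imp_le)
  have tail: "\<bar>G t w - 1\<bar> \<le> exp (1 - t) * S" if t: "1 \<le> t" and w: "w \<in> {-1..1}" for t w
  proof -
    have sg: "summable (\<lambda>n. exp (- t * ev n) * Z n w)" using t w by (intro summable_G) auto
    have "G t w - 1 = (\<Sum>n. exp (- t * ev (Suc n)) * Z (Suc n) w)"
      using suminf_split_head[OF sg] by (simp add: G_def ev_def Z_0)
    also have "\<bar>\<dots>\<bar> \<le> (\<Sum>n. exp (1 - t) * (exp (- 1 * ev (Suc n)) * Z (Suc n) 1))"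
    proof (rule norm_suminf_le[where 'a = real, unfolded real_norm_def])
      fix n
      have "1 \<le> ev (Suc n)" using ev_ge[of "Suc n"] by simp
      then have "(t - 1) * 1 \<le> (t - 1) * ev (Suc n)" using t by (intro mult_left_mono) auto
      then have "exp (- t * ev (Suc n)) \<le> exp (1 - t) * exp (- 1 * ev (Suc n))"
        by (simp add: algebra_simps flip: exp_add)
      then have "exp (- t * ev (Suc n)) * \<bar>Z (Suc n) w\<bar> \<le> exp (1 - t) * exp (- 1 * ev (Suc n)) * Z (Suc n) 1"
        by (intro mult_mono abs_Z_le w) auto
      then show "\<bar>exp (- t * ev (Suc n)) * Z (Suc n) w\<bar> \<le> exp (1 - t) * (exp (- 1 * ev (Suc n)) * Z (Suc n) 1)"
        by (simp add: abs_mult mult.assoc)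
    qed (intro summable_mult sumS)
    also have "\<dots> = exp (1 - t) * S" unfolding S_def by (rule suminf_mult[OF sumS])
    finally show ?thesis .
  qed
  \<comment> \<open>Makes exp(1 - T) = 1/(2S + 1), so that the tail is at most 1/2 from T
    on.\<close>
  define T where "T = 1 + ln (2 * S + 1)"
  have T: "T \<ge> 1" using S by (simp add: T_def)
  have late: "1/2 \<le> G t w" if "T \<le> t" "w \<in> {-1..1}" for t w
  proof -
    have "exp (1 - t) \<le> exp (- ln (2 * S + 1))" using that by (simp add: T_def)
    also have "\<dots> = 1 / (2 * S + 1)" using S by (simp add: exp_minus inverse_eq_divide)
    finally have "exp (1 - t) * S \<le> 1 / (2 * S + 1) * S" using S by (intro mult_right_mono) auto
    also have "\<dots> \<le> 1/2" using S by (simp add: field_simps)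
    finally show ?thesis using tail[of t w] that T by linarith
  qed
  obtain c where c: "c > 0" "\<And>t r. 0 < t \<Longrightarrow> 0 < r \<Longrightarrow> r < pi \<Longrightarrow>
    c * exp (- (\<kappa> + 1/2) * ln t - r\<^sup>2 / (4 * t)) \<le> G t (cos r)"
    using G_lower_gauss by blast
  \<comment> \<open>The 4 bounds r^2/(4t), as r < \<pi> < 4 and t \<ge> 1.\<close>
  define c1 where "c1 = c * exp (- (\<kappa> + 1/2) * ln T - 4)"
  have early: "c1 \<le> G t w" if t: "1 \<le> t" "t \<le> T" and w: "w \<in> {-1<..<1}" for t w
  proof -
    define r where "r = arccos w"
    have r: "0 < r" "r < pi" "w = cos r" using w arccos_lt_bounded[of w] by (auto simp: r_def)
    have "(\<kappa> + 1/2) * ln t \<le> (\<kappa> + 1/2) * ln T" using t kappa by (intro mult_left_mono) auto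
    moreover have "r\<^sup>2 / (4 * t) \<le> 4\<^sup>2 / (4 * 1)" using t r pi_less_4 by (intro frac_le power_mono) auto
    ultimately have "- (\<kappa> + 1/2) * ln T - 4 \<le> - (\<kappa> + 1/2) * ln t - r\<^sup>2 / (4 * t)"
      unfolding mult_minus_left by simp
    then have "c1 \<le> c * exp (- (\<kappa> + 1/2) * ln t - r\<^sup>2 / (4 * t))"
      using c(1) by (simp add: c1_def)
    also have "\<dots> \<le> G t w" unfolding r(3) using t r by (intro c(2)) auto
    finally show ?thesis .
  qed
  have early': "c1 \<le> G t w" if t: "1 \<le> t" "t \<le> T" and w: "w \<in> {-1..1}" for t w
  proof (rule continuous_ge_on_closure[of "{-1<..<1}" "G t" w c1])
    show "continuous_on (closure {-1<..<1}) (G t)" using t continuous_G[of t] by simp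
    show "w \<in> closure {-1<..<1}" using w by simp
  qed (use early t in auto)
  show ?thesis
  proof (rule that)
    show "min (1/2) c1 > 0" using c by (simp add: c1_def)
    show "1 + S > 0" using S by simp
    fix t w :: real assume t: "1 \<le> t" and w: "w \<in> {-1..1}"
    show "min (1/2) c1 \<le> G t w" using late[of t w] early'[of t w] t w by (cases "t \<le> T") auto
    have "exp (1 - t) * S \<le> 1 * S" using t S by (intro mult_right_mono) auto
    then show "G t w \<le> 1 + S" using tail[OF t w] by linarith
  qed
qed

text \<open>Averaging over w and -w cancels the odd degrees by parity, leaving exactly the degrees
  2n that enter the kernel on the cone.\<close>

lemma G_even_part:
  assumes t: "t > 0" and w: "w \<in> {-1..1}"
  shows "(\<lambda>n. exp (- t * ev (2 * n)) * Z (2 * n) w) sums ((G t w + G t (- w)) / 2)"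
proof -
  have w': "- w \<in> {-1..1}" using w by auto
  have s1: "(\<lambda>n. exp (- t * ev n) * Z n w) sums G t w" "(\<lambda>n. exp (- t * ev n) * Z n (- w)) sums G t (- w)"
    unfolding G_def using summable_G[OF t w] summable_G[OF t w'] by (auto intro: summable_sums)
  have "(\<lambda>n. (exp (- t * ev n) * Z n w + exp (- t * ev n) * Z n (- w)) / 2) sums ((G t w + G t (- w)) / 2)"
    by (intro sums_divide sums_add s1)
  then have "(\<lambda>n. if even n then exp (- t * ev n) * Z n w else 0) sums ((G t w + G t (- w)) / 2)"
    by (rule sums_cong[THEN iffD1, rotated]) (auto simp: Z_minus)
  moreover have "(\<lambda>n. (\<lambda>n. if even n then exp (- t * ev n) * Z n w else 0) (2 * n)) sums c
      \<longleftrightarrow> (\<lambda>n. if even n then exp (- t * ev n) * Z n w else 0) sums c" for c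
    by (rule sums_mono_reindex) (auto simp: strict_mono_def elim!: evenE)
  ultimately show ?thesis by simp
qed

end

section \<open>The triple integral\<close>

definition exp_mean :: "real \<Rightarrow> real \<Rightarrow> real" where
  "exp_mean \<nu> x = (LINT v|Pi_measure \<nu>. indicator {-1..1} v * exp (- x * (1 - v)))"

lemma exp_mean_minus:
  assumes "\<nu> \<ge> -1/2"
  shows "(LINT v|Pi_measure \<nu>. indicator {-1..1} v * exp (- x * (1 + v))) = exp_mean \<nu> x"
proof -
  have "indicator {-1..1} (- v) = (indicator {-1..1} v :: real)" for v :: real
    by (auto simp: indicator_def)
  then show ?thesis unfolding exp_mean_def
    using integral_Pi_measure_minus[OF _ assms, of "\<lambda>v. indicator {-1..1} v * exp (- x * (1 - v))"] by simp
qed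

lemma exp_mean_bounds:
  assumes "\<nu> \<ge> -1/2"
  obtains c C where "c > 0" "C > 0"
    "\<And>x. x \<ge> 0 \<Longrightarrow> c * (1 + x) powr (- \<nu> - 1/2) \<le> exp_mean \<nu> x"
    "\<And>x. x \<ge> 0 \<Longrightarrow> exp_mean \<nu> x \<le> C * (1 + x) powr (- \<nu> - 1/2)"
proof -
  obtain c where "c > 0" "\<And>x. x \<ge> 0 \<Longrightarrow> c * (1 + x) powr (- \<nu> - 1/2) \<le> exp_mean \<nu> x"
    unfolding exp_mean_def using Pi_measure_exp_lower[OF assms] by blast
  moreover obtain C where "C > 0" "\<And>x. x \<ge> 0 \<Longrightarrow> exp_mean \<nu> x \<le> C * (1 + x) powr (- \<nu> - 1/2)"
    unfolding exp_mean_def using Pi_measure_exp_upper[OF assms] by blast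
  ultimately show ?thesis using that[of c C] by simp
qed

lemma powr_scale_le:
  fixes k x p :: real
  assumes "0 < k" "k \<le> 1" "x \<ge> 0" "p \<ge> 0"
  shows "(1 + k * x) powr (- p) \<le> k powr (- p) * (1 + x) powr (- p)"
proof -
  have "k * (1 + x) \<le> 1 + k * x" using assms by (simp add: algebra_simps)
  then have "(1 + k * x) powr (- p) \<le> (k * (1 + x)) powr (- p)"
    using assms by (intro powr_mono2') auto
  then show ?thesis using assms by (simp add: powr_mult)
qed

text \<open>
  In the notation of the paper, \<open>a = st + \<langle>x,y\<rangle>\<close>, \<open>b\<close> is the product of the two square roots
  \<open>sqrt (t\<^sup>2 - \<parallel>x\<parallel>\<^sup>2)\<close> and \<open>sqrt (s\<^sup>2 - \<parallel>y\<parallel>\<^sup>2)\<close>, and \<open>B = sqrt (1 - t) * sqrt (1 - s)\<close>.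
\<close>

locale cone_parameters =
  fixes \<mu> \<alpha> \<gamma> :: real
  assumes mu: "\<mu> \<ge> 0" and alpha: "\<alpha> \<ge> 0" and gamma: "\<gamma> \<ge> -1/2"
begin

abbreviation "Mu \<equiv> Pi_measure (\<mu> - 1/2)"
abbreviation "Mv \<equiv> Pi_measure (\<alpha> - 1/2)"
abbreviation "Mw \<equiv> Pi_measure \<gamma>"

sublocale U: prob_space Mu using mu by (intro prob_space_Pi_measure) simp
sublocale V: prob_space Mv using alpha by (intro prob_space_Pi_measure) simp
sublocale W: prob_space Mw using gamma by (intro prob_space_Pi_measure) simp
sublocale VW: pair_prob_space Mv Mw ..
sublocale UVW: pair_prob_space Mu "Mv \<Otimes>\<^sub>M Mw" ..

abbreviation "M3 \<equiv> Mu \<Otimes>\<^sub>M (Mv \<Otimes>\<^sub>M Mw)"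
abbreviation "cube \<equiv> ({-1..1} \<times> {-1..1} \<times> {-1..1} :: (real \<times> real \<times> real) set)"

section \<open>The square root in \<xi> and its dependence on u\<close>

definition rad :: "real \<Rightarrow> real \<Rightarrow> real \<Rightarrow> real" where
  "rad a b u = sqrt ((a + b * u) / 2)"

lemma rad_measurable [measurable]: "rad a b \<in> borel_measurable borel"
  unfolding rad_def by measurable

lemma rad_mono: "0 \<le> b \<Longrightarrow> u \<le> 1 \<Longrightarrow> rad a b u \<le> rad a b 1"
  unfolding rad_def by (simp add: mult_left_le)

lemma rad_nonneg: "0 \<le> b \<Longrightarrow> b \<le> a \<Longrightarrow> u \<in> {-1..1} \<Longrightarrow> 0 \<le> rad a b u"
proof -
  assume "0 \<le> b" "b \<le> a" "u \<in> {-1..1}"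
  then have "b * (-1) \<le> b * u" by (intro mult_left_mono) auto
  then show ?thesis using \<open>b \<le> a\<close> by (simp add: rad_def)
qed

lemma rad_le:
  assumes "0 \<le> b" "b \<le> a" "u \<in> {-1..1}"
  shows "rad a b u \<le> sqrt a"
proof -
  have "b * u \<le> b * 1" using assms by (intro mult_left_mono) auto
  then show ?thesis using assms by (simp add: rad_def)
qed

lemma rad_1_ge:
  assumes "0 \<le> b" "b \<le> a"
  shows "sqrt a / 2 \<le> rad a b 1"
proof -
  have "sqrt a / 2 = sqrt (a / 4)" by (simp add: real_sqrt_divide)
  also have "\<dots> \<le> rad a b 1" using assms by (simp add: rad_def)
  finally show ?thesis .
qed

text \<open>The difference of the squares, b (1 - u)/2, is divided by the sum, which stays between
  sqrt a / 2 and 2 sqrt a even where \<open>rad a b u\<close> vanishes. For a = 0 also b = 0, and b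
  / sqrt a is 0 by convention.\<close>

lemma rad_diff:
  assumes "0 \<le> b" "b \<le> a" "u \<in> {-1..1}"
  shows "b / sqrt a * (1 - u) / 4 \<le> rad a b 1 - rad a b u"
    and "rad a b 1 - rad a b u \<le> b / sqrt a * (1 - u)"
proof -
  have "b / sqrt a * (1 - u) / 4 \<le> rad a b 1 - rad a b u \<and> rad a b 1 - rad a b u \<le> b / sqrt a * (1 - u)"
  proof (cases "a = 0")
    case True
    then show ?thesis using assms by (simp add: rad_def)
  next
    case False
    then have a: "sqrt a > 0" using assms by simp
    define R where "R = rad a b 1 + rad a b u"
    have R: "sqrt a / 2 \<le> R" "R \<le> 2 * sqrt a"
      using rad_1_ge[OF assms(1,2)] rad_nonneg[OF assms] rad_le[OF assms] rad_le[of b a 1] assms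
      by (auto simp: R_def)
    have R0: "R > 0" using R(1) a by linarith
    have "-1 * b \<le> u * b" using assms by (intro mult_right_mono) auto
    then have "(rad a b 1)\<^sup>2 - (rad a b u)\<^sup>2 = (a + b) / 2 - (a + b * u) / 2"
      using assms by (simp add: rad_def mult.commute)
    then have "(rad a b 1 - rad a b u) * R = b * (1 - u) / 2"
      by (simp add: R_def power2_eq_square algebra_simps diff_divide_distrib add_divide_distrib)
    then have "(rad a b 1 - rad a b u) * (2 * R) = b * (1 - u)" by simp
    then have eq: "rad a b 1 - rad a b u = b * (1 - u) / (2 * R)"
      using R a by (subst nonzero_eq_divide_eq) auto
    have nn: "0 \<le> b * (1 - u)" using assms by simp
    have "b * (1 - u) / (4 * sqrt a) \<le> b * (1 - u) / (2 * R)"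
      by (intro frac_le nn order_refl) (use R R0 a in linarith)+
    moreover have "b * (1 - u) / (2 * R) \<le> b * (1 - u) / sqrt a"
      by (intro frac_le nn order_refl) (use R R0 a in linarith)+
    ultimately show ?thesis unfolding eq by simp
  qed
  then show "b / sqrt a * (1 - u) / 4 \<le> rad a b 1 - rad a b u"
    and "rad a b 1 - rad a b u \<le> b / sqrt a * (1 - u)" by auto
qed

text \<open>What is left of \<open>cube_mean\<close> once v1 and v2 are integrated out, apart from
  the separate factor produced by v2.\<close>

definition rad_mean :: "real \<Rightarrow> real \<Rightarrow> real \<Rightarrow> real" where
  "rad_mean r a b = (LINT u|Mu. indicator {-1..1} u * (exp (- r * (rad a b 1 - rad a b u)) * exp_mean (\<alpha> - 1/2) (r * rad a b u)))"

definition cube_mean :: "real \<Rightarrow> real \<Rightarrow> real \<Rightarrow> real \<Rightarrow> real \<Rightarrow> real" where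
  "cube_mean \<sigma> r a b B = (LINT (u, v1, v2):cube|M3. exp (- r * (rad a b 1 + B - \<sigma> * (v1 * rad a b u + v2 * B))))"

lemma exp_mean_sign:
  assumes "\<nu> \<ge> -1/2" "\<sigma> \<in> {1, -1}"
  shows "(LINT v|Pi_measure \<nu>. indicator {-1..1} v * exp (- x * (1 - \<sigma> * v))) = exp_mean \<nu> x"
  using assms exp_mean_minus[OF assms(1), of x] by (auto simp: exp_mean_def)

lemma integrable_M3:
  fixes f :: "real \<times> real \<times> real \<Rightarrow> real"
  assumes "f \<in> borel_measurable M3" "\<And>z. \<bar>f z\<bar> \<le> C"
  shows "integrable M3 f"
  using assms by (intro UVW.P.integrable_const_bound[of _ C]) auto

text \<open>The exponent splits as (rad a b 1 - rad a b u) + rad a b u (1 - \<sigma> v1) + B (1 -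
  \<sigma> v2), so for fixed u the integrals over v1 and v2 factor. Symmetry of the measures removes
  \<sigma>.\<close>

lemma cube_mean_eq:
  assumes \<sigma>: "\<sigma> \<in> {1, -1}" and r: "r \<ge> 0" and ab: "0 \<le> b" "b \<le> a" and B: "0 \<le> B"
  shows "cube_mean \<sigma> r a b B = exp_mean \<gamma> (r * B) * rad_mean r a b"
proof -
  define e where "e x v = indicator {-1..1} v * exp (- x * (1 - \<sigma> * v))" for x v :: real
  have [measurable]: "(\<lambda>v. e x v) \<in> borel_measurable borel" for x unfolding e_def by measurable
  have e2: "(\<lambda>p. e (f p) (g p)) \<in> borel_measurable N"
    if [measurable]: "f \<in> borel_measurable N" "g \<in> borel_measurable N" for f g and N :: "'n measure"
    unfolding e_def by measurable
  have e_bound: "\<bar>e x v\<bar> \<le> 1" if "x \<ge> 0" for x v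
  proof -
    have "0 \<le> x * (1 - \<sigma> * v)" if "v \<in> {-1..1}" using \<sigma> \<open>x \<ge> 0\<close> that by (intro mult_nonneg_nonneg) auto
    then show ?thesis by (auto simp: e_def indicator_def)
  qed
  define k where "k u = indicator {-1..1} u * exp (- r * (rad a b 1 - rad a b u))" for u :: real
  have [measurable]: "k \<in> borel_measurable borel" unfolding k_def by measurable
  have k_bound: "\<bar>k u\<bar> \<le> 1" for u using r rad_mono[OF ab(1), of u a] by (auto simp: k_def indicator_def)
  \<comment> \<open>Outside [-1,1] the radicand, and with it \<open>sqrt\<close>, may be negative;
    the cut-off keeps \<open>e (ru u)\<close> bounded by 1 everywhere.\<close>
  define ru where "ru u = (if u \<in> {-1..1} then r * rad a b u else 0)" for u
  have [measurable]: "ru \<in> borel_measurable borel" unfolding ru_def by measurable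
  have ru: "0 \<le> ru u" for u using r rad_nonneg[OF ab, of u] by (auto simp: ru_def)
  define F where "F z = (case z of (u, v1, v2) \<Rightarrow> k u * (e (ru u) v1 * e (r * B) v2))" for z
  have F_meas: "F \<in> borel_measurable M3"
    unfolding F_def case_prod_unfold by (intro borel_measurable_times e2) measurable
  have F_bound: "\<bar>F z\<bar> \<le> 1" for z
  proof -
    obtain u v1 v2 where z: "z = (u, v1, v2)" by (cases z)
    have "\<bar>k u\<bar> * (\<bar>e (ru u) v1\<bar> * \<bar>e (r * B) v2\<bar>) \<le> 1 * (1 * 1)"
      using r B by (intro mult_mono k_bound e_bound ru) auto
    then show ?thesis by (simp add: F_def z abs_mult)
  qed
  have "cube_mean \<sigma> r a b B = (LINT z|M3. F z)"
    unfolding cube_mean_def set_lebesgue_integral_def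
  proof (rule Bochner_Integration.integral_cong[OF refl])
    fix z :: "real \<times> real \<times> real"
    obtain u v1 v2 where z: "z = (u, v1, v2)" by (cases z)
    show "indicator cube z *\<^sub>R (case z of (u, v1, v2) \<Rightarrow> exp (- r * (rad a b 1 + B - \<sigma> * (v1 * rad a b u + v2 * B)))) = F z"
      by (auto simp: F_def z k_def e_def ru_def indicator_def algebra_simps simp flip: exp_add)
  qed
  also have "\<dots> = (LINT u|Mu. LINT p|(Mv \<Otimes>\<^sub>M Mw). F (u, p))"
    by (rule UVW.integral_fst'[symmetric]) (rule integrable_M3[OF F_meas F_bound])
  also have "\<dots> = (LINT u|Mu. k u * (exp_mean (\<alpha> - 1/2) (ru u) * exp_mean \<gamma> (r * B)))"
  proof (rule Bochner_Integration.integral_cong[OF refl])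
    fix u
    have int: "integrable (Mv \<Otimes>\<^sub>M Mw) (\<lambda>(v1, v2). e (ru u) v1 * e (r * B) v2)"
    proof (rule VW.P.integrable_const_bound[of _ 1])
      show "AE p in Mv \<Otimes>\<^sub>M Mw. norm (case p of (v1, v2) \<Rightarrow> e (ru u) v1 * e (r * B) v2) \<le> 1"
        using e_bound[OF ru] e_bound[of "r * B"] r B
        by (intro AE_I2) (auto simp: abs_mult intro!: mult_le_one)
    qed measurable
    have "(LINT p|(Mv \<Otimes>\<^sub>M Mw). F (u, p)) = k u * (LINT p|(Mv \<Otimes>\<^sub>M Mw). (case p of (v1, v2) \<Rightarrow> e (ru u) v1 * e (r * B) v2))"
      by (simp add: F_def case_prod_unfold)
    also have "(LINT p|(Mv \<Otimes>\<^sub>M Mw). (case p of (v1, v2) \<Rightarrow> e (ru u) v1 * e (r * B) v2))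
      = (LINT v1|Mv. LINT v2|Mw. e (ru u) v1 * e (r * B) v2)"
      using VW.integral_fst'[OF int] by simp
    also have "\<dots> = (LINT v|Mv. e (ru u) v) * (LINT v|Mw. e (r * B) v)"
      by simp
    also have "(LINT v|Mv. e (ru u) v) = exp_mean (\<alpha> - 1/2) (ru u)"
      unfolding e_def using alpha by (intro exp_mean_sign \<sigma>) simp
    also have "(LINT v|Mw. e (r * B) v) = exp_mean \<gamma> (r * B)"
      unfolding e_def by (intro exp_mean_sign \<sigma> gamma)
    finally show "(LINT p|(Mv \<Otimes>\<^sub>M Mw). F (u, p)) = k u * (exp_mean (\<alpha> - 1/2) (ru u) * exp_mean \<gamma> (r * B))" .
  qed
  also have "\<dots> = (LINT u|Mu. exp_mean \<gamma> (r * B) * (indicator {-1..1} u *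
      (exp (- r * (rad a b 1 - rad a b u)) * exp_mean (\<alpha> - 1/2) (r * rad a b u))))"
    by (rule Bochner_Integration.integral_cong[OF refl]) (auto simp: k_def ru_def indicator_def)
  also have "\<dots> = exp_mean \<gamma> (r * B) * rad_mean r a b"
    unfolding rad_mean_def by simp
  finally show ?thesis .
qed

lemma exp_mean_measurable [measurable]:
  "exp_mean \<nu> \<in> borel_measurable borel" if "\<nu> \<ge> -1/2"
proof -
  interpret prob_space "Pi_measure \<nu>" using that by (rule prob_space_Pi_measure)
  have "(\<lambda>x. LINT v|Pi_measure \<nu>. indicator {-1..1} v * exp (- x * (1 - v))) \<in> borel_measurable borel"
    by (rule borel_measurable_lebesgue_integral) measurable
  then show ?thesis by (simp add: exp_mean_def[abs_def])
qed

text \<open>The obstacle is that \<open>rad a b u\<close> may vanish at u = -1, so the decay in r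
  rad a b u is not uniformly that at u = 1. With X = r (rad a b 1 - rad a b u) one has 1 + r rad a b
  1 \<le> (1 + X)(1 + r rad a b u): replacing u by 1 costs (1 + X)^\<alpha>, which half of exp(-X)
  absorbs. The lower bound only needs rad a b u \<le> sqrt a.\<close>

lemma rad_mean_bounds:
  obtains c C where "c > 0" "C > 0"
    "\<And>r a b. r \<ge> 0 \<Longrightarrow> 0 \<le> b \<Longrightarrow> b \<le> a \<Longrightarrow>
      c * ((1 + r * sqrt a) powr (- \<alpha>) * (1 + r * (b / sqrt a)) powr (- \<mu>)) \<le> rad_mean r a b"
    "\<And>r a b. r \<ge> 0 \<Longrightarrow> 0 \<le> b \<Longrightarrow> b \<le> a \<Longrightarrow>
      rad_mean r a b \<le> C * ((1 + r * sqrt a) powr (- \<alpha>) * (1 + r * (b / sqrt a)) powr (- \<mu>))"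
proof -
  have m: "\<mu> - 1/2 \<ge> -1/2" "\<alpha> - 1/2 \<ge> -1/2" using mu alpha by auto
  obtain c1 C1 where 1: "c1 > 0" "C1 > 0"
    "\<And>x. x \<ge> 0 \<Longrightarrow> c1 * (1 + x) powr (- (\<alpha> - 1/2) - 1/2) \<le> exp_mean (\<alpha> - 1/2) x"
    "\<And>x. x \<ge> 0 \<Longrightarrow> exp_mean (\<alpha> - 1/2) x \<le> C1 * (1 + x) powr (- (\<alpha> - 1/2) - 1/2)"
    using exp_mean_bounds[OF m(2)] by blast
  obtain c2 C2 where 2: "c2 > 0" "C2 > 0"
    "\<And>x. x \<ge> 0 \<Longrightarrow> c2 * (1 + x) powr (- (\<mu> - 1/2) - 1/2) \<le> exp_mean (\<mu> - 1/2) x"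
    "\<And>x. x \<ge> 0 \<Longrightarrow> exp_mean (\<mu> - 1/2) x \<le> C2 * (1 + x) powr (- (\<mu> - 1/2) - 1/2)"
    using exp_mean_bounds[OF m(1)] by blast
  have ex: "- (\<alpha> - 1/2) - 1/2 = - \<alpha>" "- (\<mu> - 1/2) - 1/2 = - \<mu>" by simp_all
  note 1 = 1[unfolded ex] and 2 = 2[unfolded ex]
  obtain C3 where C3: "C3 > 0" "\<And>z. z \<ge> 0 \<Longrightarrow> (1 + z) powr \<alpha> \<le> C3 * exp (1/2 * z)"
    using powr_le_exp[of "1/2" \<alpha>] alpha by auto
  define D where "D = C1 * C3 * 2 powr \<alpha>"
  have D: "D > 0" using 1 C3 by (simp add: D_def)
  have int_e: "integrable Mu (\<lambda>u. indicator {-1..1} u * exp (- x * (1 - u)))" if "x \<ge> 0" for x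
    using that by (intro U.integrable_const_bound[of _ 1] AE_I2) (auto simp: indicator_def)
  have int_r: "integrable Mu (\<lambda>u. indicator {-1..1} u * (exp (- r * (rad a b 1 - rad a b u)) * exp_mean (\<alpha> - 1/2) (r * rad a b u)))"
    if r: "r \<ge> 0" and ab: "0 \<le> b" "b \<le> a" for r a b
  proof (rule U.integrable_const_bound[of _ C1], rule AE_I2)
    note [measurable] = exp_mean_measurable[OF m(2)]
    show "(\<lambda>u. indicator {-1..1} u * (exp (- r * (rad a b 1 - rad a b u)) * exp_mean (\<alpha> - 1/2) (r * rad a b u))) \<in> borel_measurable Mu"
      by measurable
    fix u :: real
    show "norm (indicator {-1..1} u * (exp (- r * (rad a b 1 - rad a b u)) * exp_mean (\<alpha> - 1/2) (r * rad a b u))) \<le> C1"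
    proof (cases "u \<in> {-1..1}")
      case True
      have x: "0 \<le> r * rad a b u" using r rad_nonneg[OF ab True] by simp
      have "0 \<le> c1 * (1 + r * rad a b u) powr (- \<alpha>)" using 1 by simp
      then have "0 \<le> exp_mean (\<alpha> - 1/2) (r * rad a b u)" using 1(3)[OF x] by linarith
      moreover have "exp_mean (\<alpha> - 1/2) (r * rad a b u) \<le> C1 * 1"
        using 1(2) 1(4)[OF x] x alpha
        by (elim order_trans, intro mult_left_mono) (auto simp: powr_minus_divide ge_one_powr_ge_zero)
      moreover have "exp (- r * (rad a b 1 - rad a b u)) \<le> 1" using r rad_mono[OF ab(1), of u a] True by simp
      ultimately have "exp (- r * (rad a b 1 - rad a b u)) * exp_mean (\<alpha> - 1/2) (r * rad a b u) \<le> 1 * C1"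
        by (intro mult_mono) auto
      then show ?thesis using True \<open>0 \<le> exp_mean (\<alpha> - 1/2) (r * rad a b u)\<close> by (simp add: abs_mult)
    qed (use 1(2) in auto)
  qed
  show ?thesis
  proof (rule that)
    show "c1 * c2 > 0" using 1 2 by simp
    show "D * C2 * (1/8) powr (- \<mu>) > 0" using D 2 by simp
    fix r a b :: real assume r: "r \<ge> 0" and ab: "0 \<le> b" "b \<le> a"
    have sa: "0 \<le> sqrt a" "0 \<le> b / sqrt a" using ab by auto
    define x where "x = r * (b / sqrt a)"
    have x: "0 \<le> x" unfolding x_def by (intro mult_nonneg_nonneg r sa)
    define A where "A = (1 + r * sqrt a) powr (- \<alpha>)"
    have pos: "0 < 1 + r * sqrt a" using mult_nonneg_nonneg[OF r sa(1)] by linarith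
    then have A: "A > 0" by (simp add: A_def)
    have "c1 * c2 * (A * (1 + x) powr (- \<mu>)) = c1 * A * (c2 * (1 + x) powr (- \<mu>))" by simp
    also have "\<dots> \<le> c1 * A * exp_mean (\<mu> - 1/2) x"
      using 1(1) A by (intro mult_left_mono 2(3) x) auto
    also have "\<dots> = (LINT u|Mu. c1 * A * (indicator {-1..1} u * exp (- x * (1 - u))))"
      by (simp add: exp_mean_def)
    also have "\<dots> \<le> rad_mean r a b"
      unfolding rad_mean_def
    proof (rule integral_mono)
      show "integrable Mu (\<lambda>u. c1 * A * (indicator {-1..1} u * exp (- x * (1 - u))))"
        by (intro integrable_mult_right int_e x)
      fix u :: real
      show "c1 * A * (indicator {-1..1} u * exp (- x * (1 - u))) \<le>
        indicator {-1..1} u * (exp (- r * (rad a b 1 - rad a b u)) * exp_mean (\<alpha> - 1/2) (r * rad a b u))"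
      proof (cases "u \<in> {-1..1}")
        case True
        have ru: "0 \<le> r * rad a b u" using r rad_nonneg[OF ab True] by simp
        have "r * rad a b u \<le> r * sqrt a" using r rad_le[OF ab True] by (intro mult_left_mono)
        then have "A \<le> (1 + r * rad a b u) powr (- \<alpha>)" unfolding A_def using ru alpha by (intro powr_mono2') auto
        then have "c1 * A \<le> exp_mean (\<alpha> - 1/2) (r * rad a b u)"
          using 1(3)[OF ru] 1(1) by (meson mult_left_mono less_imp_le order_trans)
        moreover have "r * (rad a b 1 - rad a b u) \<le> r * (b / sqrt a * (1 - u))"
          using r rad_diff(2)[OF ab True] by (intro mult_left_mono)
        then have "exp (- x * (1 - u)) \<le> exp (- r * (rad a b 1 - rad a b u))" by (simp add: x_def mult.assoc)
        ultimately have "exp (- x * (1 - u)) * (c1 * A) \<le> exp (- r * (rad a b 1 - rad a b u)) * exp_mean (\<alpha> - 1/2) (r * rad a b u)"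
          using 1(1) A by (intro mult_mono) auto
        then show ?thesis using True by (simp add: mult_ac)
      qed simp
    qed (rule int_r[OF r ab])
    finally show "c1 * c2 * ((1 + r * sqrt a) powr (- \<alpha>) * (1 + r * (b / sqrt a)) powr (- \<mu>)) \<le> rad_mean r a b"
      by (simp add: A_def x_def)
    \<comment> \<open>1/8 is the factor 1/4 of \<open>rad_diff\<close> times the half of the
      exponent that is not spent on (1 + X)^\<alpha>.\<close>
    have x8: "0 \<le> 1/8 * x" using x by simp
    have "rad_mean r a b \<le> (LINT u|Mu. D * A * (indicator {-1..1} u * exp (- (1/8 * x) * (1 - u))))"
      unfolding rad_mean_def
    proof (rule integral_mono)
      show "integrable Mu (\<lambda>u. D * A * (indicator {-1..1} u * exp (- (1/8 * x) * (1 - u))))"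
        by (intro integrable_mult_right int_e x8)
      fix u :: real
      show "indicator {-1..1} u * (exp (- r * (rad a b 1 - rad a b u)) * exp_mean (\<alpha> - 1/2) (r * rad a b u))
        \<le> D * A * (indicator {-1..1} u * exp (- (1/8 * x) * (1 - u)))"
      proof (cases "u \<in> {-1..1}")
        case True
        have ru: "0 \<le> r * rad a b u" using r rad_nonneg[OF ab True] by simp
        define X where "X = r * (rad a b 1 - rad a b u)"
        have X: "0 \<le> X" using r rad_mono[OF ab(1), of u a] True by (simp add: X_def)
        have "r * (b / sqrt a * (1 - u) / 4) \<le> X"
          unfolding X_def using r rad_diff(1)[OF ab True] by (intro mult_left_mono)
        then have "1/2 * (r * (b / sqrt a * (1 - u) / 4)) \<le> 1/2 * X" by (rule mult_left_mono) simp
        moreover have "1/8 * x * (1 - u) = 1/2 * (r * (b / sqrt a * (1 - u) / 4))" by (simp add: x_def)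
        ultimately have "1/8 * x * (1 - u) \<le> 1/2 * X" by (simp only:)
        then have e: "exp (- (1/2) * X) \<le> exp (- (1/8 * x) * (1 - u))" by simp
        have "1 + r * rad a b 1 \<le> (1 + X) * (1 + r * rad a b u)"
          using mult_nonneg_nonneg[OF X ru] by (simp add: X_def algebra_simps)
        moreover have "1/2 * (1 + r * sqrt a) \<le> 1 + r * rad a b 1"
          using mult_left_mono[OF rad_1_ge[OF ab] r] by simp
        ultimately have "1/2 * (1 + r * sqrt a) \<le> (1 + X) * (1 + r * rad a b u)" by (rule order_trans[rotated])
        then have "(1/2 * (1 + r * sqrt a)) powr \<alpha> \<le> ((1 + X) * (1 + r * rad a b u)) powr \<alpha>"
          using alpha r sa by (intro powr_mono2) auto
        also have "\<dots> = (1 + X) powr \<alpha> * (1 + r * rad a b u) powr \<alpha>"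
          using X ru by (simp add: powr_mult)
        also have "\<dots> \<le> C3 * exp (1/2 * X) * (1 + r * rad a b u) powr \<alpha>"
          using C3(2)[OF X] by (intro mult_right_mono) auto
        finally have "(1/2) powr \<alpha> * (1 + r * sqrt a) powr \<alpha> \<le> C3 * exp (1/2 * X) * (1 + r * rad a b u) powr \<alpha>"
          by (simp only: powr_mult)
        then have p: "(1 + r * rad a b u) powr (- \<alpha>) \<le> C3 * exp (1/2 * X) * (2 powr \<alpha> * A)"
          using pos ru unfolding A_def powr_minus
          by (simp add: powr_divide field_simps)
        have "exp (- X) * exp_mean (\<alpha> - 1/2) (r * rad a b u) \<le> exp (- X) * (C1 * (C3 * exp (1/2 * X) * (2 powr \<alpha> * A)))"
          using 1(4)[OF ru] p 1(2) by (intro mult_left_mono order_trans[OF 1(4)[OF ru]]) auto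
        also have "\<dots> = D * A * (exp (- X) * exp (1/2 * X))" by (simp add: D_def mult_ac)
        also have "exp (- X) * exp (1/2 * X) = exp (- (1/2) * X)" by (simp flip: exp_add)
        also have "D * A * \<dots> \<le> D * A * exp (- (1/8 * x) * (1 - u))" using D A e by (intro mult_left_mono) auto
        finally show ?thesis using True by (simp add: X_def)
      qed simp
    qed (rule int_r[OF r ab])
    also have "\<dots> = D * A * exp_mean (\<mu> - 1/2) (1/8 * x)"
      by (simp add: exp_mean_def)
    also have "\<dots> \<le> D * A * (C2 * (1 + 1/8 * x) powr (- \<mu>))"
      using D A by (intro mult_left_mono 2(4) x8) auto
    also have "\<dots> \<le> D * A * (C2 * ((1/8) powr (- \<mu>) * (1 + x) powr (- \<mu>)))"
      using D A 2(2) x mu by (intro mult_left_mono powr_scale_le) auto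
    finally show "rad_mean r a b \<le> D * C2 * (1/8) powr (- \<mu>) * ((1 + r * sqrt a) powr (- \<alpha>) * (1 + r * (b / sqrt a)) powr (- \<mu>))"
      by (simp add: A_def x_def mult_ac)
  qed
qed

end

section \<open>The heat kernel on the cone\<close>

text \<open>1 + k x / \<tau> lies between min 1 k and 1 + k times max x \<tau> / \<tau>; this is how
  the maxima of \<open>cone_K\<close> arise.\<close>

lemma powr_max_bounds:
  fixes k p :: real
  assumes "k > 0" "p \<ge> 0"
  obtains c C where "c > 0" "C > 0"
    "\<And>\<tau> x. \<tau> > 0 \<Longrightarrow> x \<ge> 0 \<Longrightarrow> c * (max x \<tau> / \<tau>) powr (- p) \<le> (1 + k / \<tau> * x) powr (- p)"
    "\<And>\<tau> x. \<tau> > 0 \<Longrightarrow> x \<ge> 0 \<Longrightarrow> (1 + k / \<tau> * x) powr (- p) \<le> C * (max x \<tau> / \<tau>) powr (- p)"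
proof (rule that)
  show "(1 + k) powr (- p) > 0" "min 1 k powr (- p) > 0" using assms by auto
  fix \<tau> x :: real assume \<tau>: "\<tau> > 0" and x: "x \<ge> 0"
  define m where "m = max x \<tau> / \<tau>"
  have m: "m \<ge> 1" "x / \<tau> \<le> m" using \<tau> by (auto simp: m_def divide_right_mono)
  have q: "0 \<le> x / \<tau>" using x \<tau> by simp
  have "k * (x / \<tau>) \<le> k * m" using m assms by (intro mult_left_mono) auto
  then have "1 + k / \<tau> * x \<le> (1 + k) * m" using m by (simp add: distrib_right)
  moreover have "0 < 1 + k / \<tau> * x" using mult_nonneg_nonneg[OF less_imp_le[OF assms(1)] q] by simp
  ultimately have "((1 + k) * m) powr (- p) \<le> (1 + k / \<tau> * x) powr (- p)"
    using assms by (intro powr_mono2') auto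
  then show "(1 + k) powr (- p) * (max x \<tau> / \<tau>) powr (- p) \<le> (1 + k / \<tau> * x) powr (- p)"
    by (simp only: powr_mult m_def)
  have "min 1 k * m \<le> 1 + k / \<tau> * x"
  proof (cases "x \<le> \<tau>")
    case True
    then have "m = 1" using \<tau> by (simp add: m_def)
    moreover have "0 \<le> k / \<tau> * x" using assms \<tau> x by simp
    ultimately show ?thesis by simp
  next
    case False
    then have "m = x / \<tau>" by (simp add: m_def)
    moreover have "min 1 k * (x / \<tau>) \<le> k * (x / \<tau>)" using q by (intro mult_right_mono) auto
    ultimately show ?thesis by simp
  qed
  then have "(1 + k / \<tau> * x) powr (- p) \<le> (min 1 k * m) powr (- p)"
    using assms m by (intro powr_mono2') auto
  then show "(1 + k / \<tau> * x) powr (- p) \<le> min 1 k powr (- p) * (max x \<tau> / \<tau>) powr (- p)"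
    by (simp only: powr_mult m_def)
qed

text \<open>\<alpha> \<ge> 1/2 is what d \<ge> 2 provides; with \<gamma> \<ge> -1/2 it gives
  2\<alpha> + \<gamma> + 1 \<ge> 3/2.\<close>

locale cone_kernel = cone_parameters +
  assumes alpha_half: "\<alpha> \<ge> 1/2"
begin

sublocale S: ultraspherical "2 * \<alpha> + \<gamma> + 1"
  using alpha_half gamma by unfold_locales simp

definition xi :: "real \<Rightarrow> real \<Rightarrow> real \<Rightarrow> real \<times> real \<times> real \<Rightarrow> real" where
  "xi a b B = (\<lambda>(u, v1, v2). v1 * rad a b u + v2 * B)"

definition profile :: "real \<Rightarrow> real \<Rightarrow> real \<Rightarrow> real \<Rightarrow> real" where
  "profile \<tau> a b B = (max B \<tau> / \<tau>) powr (- \<gamma> - 1/2) * (max (sqrt a) \<tau> / \<tau>) powr (- \<alpha>)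
    * (max (b / sqrt a) \<tau> / \<tau>) powr (- \<mu>)"

text \<open>This is \<open>cone_K\<close> with each maximum divided by \<tau>, the compensating
  powers being collected in the exponent of \<tau>.\<close>

definition model :: "real \<Rightarrow> real \<Rightarrow> real \<Rightarrow> real \<Rightarrow> real" where
  "model \<tau> a b B = \<tau> powr (- (2 * \<alpha> + \<gamma> + 1) - 1/2) * exp (- (arccos (rad a b 1 + B))\<^sup>2 / \<tau>) * profile \<tau> a b B"

definition admissible :: "real \<Rightarrow> real \<Rightarrow> real \<Rightarrow> bool" where
  "admissible a b B \<longleftrightarrow> 0 \<le> b \<and> b \<le> a \<and> 0 \<le> B \<and> rad a b 1 + B \<le> 1"

lemma profile_nonneg: "0 \<le> profile \<tau> a b B"
  by (simp add: profile_def)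

text \<open>Two values of k are used, one for each side of the sandwich; the upper side needs both
  signs \<sigma>.\<close>

definition cube_mean_comparable :: "real \<Rightarrow> real \<Rightarrow> real \<Rightarrow> bool" where
  "cube_mean_comparable k c C \<longleftrightarrow> c > 0 \<and> C > 0 \<and>
    (\<forall>\<sigma> \<tau> a b B. \<sigma> \<in> {1, -1} \<longrightarrow> \<tau> > 0 \<longrightarrow> 0 \<le> b \<longrightarrow> b \<le> a \<longrightarrow> 0 \<le> B \<longrightarrow>
      c * profile \<tau> a b B \<le> cube_mean \<sigma> (k / \<tau>) a b B \<and>
      cube_mean \<sigma> (k / \<tau>) a b B \<le> C * profile \<tau> a b B)"

lemma cube_mean_comparable_exists:
  assumes k: "k > 0"
  obtains c C where "cube_mean_comparable k c C"
proof -
  obtain c0 C0 where 0: "c0 > 0" "C0 > 0"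
    "\<And>x. x \<ge> 0 \<Longrightarrow> c0 * (1 + x) powr (- \<gamma> - 1/2) \<le> exp_mean \<gamma> x"
    "\<And>x. x \<ge> 0 \<Longrightarrow> exp_mean \<gamma> x \<le> C0 * (1 + x) powr (- \<gamma> - 1/2)"
    using exp_mean_bounds[OF gamma] by blast
  obtain c1 C1 where 1: "c1 > 0" "C1 > 0"
    "\<And>r a b. r \<ge> 0 \<Longrightarrow> 0 \<le> b \<Longrightarrow> b \<le> a \<Longrightarrow>
      c1 * ((1 + r * sqrt a) powr (- \<alpha>) * (1 + r * (b / sqrt a)) powr (- \<mu>)) \<le> rad_mean r a b"
    "\<And>r a b. r \<ge> 0 \<Longrightarrow> 0 \<le> b \<Longrightarrow> b \<le> a \<Longrightarrow>
      rad_mean r a b \<le> C1 * ((1 + r * sqrt a) powr (- \<alpha>) * (1 + r * (b / sqrt a)) powr (- \<mu>))"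
    using rad_mean_bounds by blast
  have g: "\<gamma> + 1/2 \<ge> 0" using gamma by simp
  obtain c2 C2 where 2: "c2 > 0" "C2 > 0"
    "\<And>\<tau> x. \<tau> > 0 \<Longrightarrow> x \<ge> 0 \<Longrightarrow> c2 * (max x \<tau> / \<tau>) powr (- (\<gamma> + 1/2)) \<le> (1 + k / \<tau> * x) powr (- (\<gamma> + 1/2))"
    "\<And>\<tau> x. \<tau> > 0 \<Longrightarrow> x \<ge> 0 \<Longrightarrow> (1 + k / \<tau> * x) powr (- (\<gamma> + 1/2)) \<le> C2 * (max x \<tau> / \<tau>) powr (- (\<gamma> + 1/2))"
    using powr_max_bounds[OF k g] by blast
  obtain c3 C3 where 3: "c3 > 0" "C3 > 0"
    "\<And>\<tau> x. \<tau> > 0 \<Longrightarrow> x \<ge> 0 \<Longrightarrow> c3 * (max x \<tau> / \<tau>) powr (- \<alpha>) \<le> (1 + k / \<tau> * x) powr (- \<alpha>)"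
    "\<And>\<tau> x. \<tau> > 0 \<Longrightarrow> x \<ge> 0 \<Longrightarrow> (1 + k / \<tau> * x) powr (- \<alpha>) \<le> C3 * (max x \<tau> / \<tau>) powr (- \<alpha>)"
    using powr_max_bounds[OF k alpha] by blast
  obtain c4 C4 where 4: "c4 > 0" "C4 > 0"
    "\<And>\<tau> x. \<tau> > 0 \<Longrightarrow> x \<ge> 0 \<Longrightarrow> c4 * (max x \<tau> / \<tau>) powr (- \<mu>) \<le> (1 + k / \<tau> * x) powr (- \<mu>)"
    "\<And>\<tau> x. \<tau> > 0 \<Longrightarrow> x \<ge> 0 \<Longrightarrow> (1 + k / \<tau> * x) powr (- \<mu>) \<le> C4 * (max x \<tau> / \<tau>) powr (- \<mu>)"
    using powr_max_bounds[OF k mu] by blast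
  have ge: "- (\<gamma> + 1/2) = - \<gamma> - 1/2" by simp
  note 2 = 2[unfolded ge]
  show ?thesis
  proof (rule that[of "c0 * c1 * c2 * c3 * c4" "C0 * C1 * C2 * C3 * C4"], unfold cube_mean_comparable_def,
      intro conjI allI impI)
    show "c0 * c1 * c2 * c3 * c4 > 0" "C0 * C1 * C2 * C3 * C4 > 0" using 0 1 2 3 4 by simp_all
    fix \<sigma> \<tau> a b B :: real
    assume \<sigma>: "\<sigma> \<in> {1, -1}" and \<tau>: "\<tau> > 0" and ab: "0 \<le> b" "b \<le> a" and B: "0 \<le> B"
    have r: "0 \<le> k / \<tau>" using k \<tau> by simp
    have rB: "0 \<le> k / \<tau> * B" using r B by (rule mult_nonneg_nonneg)
    have sa: "0 \<le> sqrt a" "0 \<le> b / sqrt a" using ab by auto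
    define x y z where "x = (max B \<tau> / \<tau>) powr (- \<gamma> - 1/2)" and "y = (max (sqrt a) \<tau> / \<tau>) powr (- \<alpha>)"
      and "z = (max (b / sqrt a) \<tau> / \<tau>) powr (- \<mu>)"
    have nn: "0 \<le> x" "0 \<le> y" "0 \<le> z" by (simp_all add: x_def y_def z_def)
    have "c0 * (c2 * x) \<le> c0 * (1 + k / \<tau> * B) powr (- \<gamma> - 1/2)"
      unfolding x_def using 0(1) by (intro mult_left_mono 2(3) \<tau> B) auto
    also have "\<dots> \<le> exp_mean \<gamma> (k / \<tau> * B)" by (rule 0(3)[OF rB])
    finally have e1: "c0 * (c2 * x) \<le> exp_mean \<gamma> (k / \<tau> * B)" .
    have "c1 * ((c3 * y) * (c4 * z)) \<le> c1 * ((1 + k / \<tau> * sqrt a) powr (- \<alpha>) * (1 + k / \<tau> * (b / sqrt a)) powr (- \<mu>))"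
      unfolding y_def z_def using 1(1) 3(1) 4(1) \<tau> sa
      by (intro mult_left_mono mult_mono 3(3) 4(3)) auto
    also have "\<dots> \<le> rad_mean (k / \<tau>) a b" by (rule 1(3)[OF r ab])
    finally have r1: "c1 * ((c3 * y) * (c4 * z)) \<le> rad_mean (k / \<tau>) a b" .
    have p1: "0 \<le> c0 * (c2 * x)" "0 \<le> c1 * ((c3 * y) * (c4 * z))" using 0 1 2 3 4 nn by simp_all
    have "(c0 * (c2 * x)) * (c1 * ((c3 * y) * (c4 * z))) \<le> exp_mean \<gamma> (k / \<tau> * B) * rad_mean (k / \<tau>) a b"
      using p1 e1 by (intro mult_mono e1 r1) auto
    then show "c0 * c1 * c2 * c3 * c4 * profile \<tau> a b B \<le> cube_mean \<sigma> (k / \<tau>) a b B"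
      unfolding cube_mean_eq[OF \<sigma> r ab B] profile_def x_def[symmetric] y_def[symmetric] z_def[symmetric]
      by (simp add: mult_ac)
    have "exp_mean \<gamma> (k / \<tau> * B) \<le> C0 * (1 + k / \<tau> * B) powr (- \<gamma> - 1/2)" by (rule 0(4)[OF rB])
    also have "\<dots> \<le> C0 * (C2 * x)"
      unfolding x_def using 0(2) by (intro mult_left_mono 2(4) \<tau> B) auto
    finally have e2: "exp_mean \<gamma> (k / \<tau> * B) \<le> C0 * (C2 * x)" .
    have "rad_mean (k / \<tau>) a b \<le> C1 * ((1 + k / \<tau> * sqrt a) powr (- \<alpha>) * (1 + k / \<tau> * (b / sqrt a)) powr (- \<mu>))"
      by (rule 1(4)[OF r ab])
    also have "\<dots> \<le> C1 * ((C3 * y) * (C4 * z))"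
      unfolding y_def z_def using 1(2) 3(2) 4(2) \<tau> sa
      by (intro mult_left_mono mult_mono 3(4) 4(4)) auto
    finally have r2: "rad_mean (k / \<tau>) a b \<le> C1 * ((C3 * y) * (C4 * z))" .
    have "exp_mean \<gamma> (k / \<tau> * B) * rad_mean (k / \<tau>) a b \<le> (C0 * (C2 * x)) * (C1 * ((C3 * y) * (C4 * z)))"
      using p1 e1 r1 e2 by (intro mult_mono e2 r2) auto
    then show "cube_mean \<sigma> (k / \<tau>) a b B \<le> C0 * C1 * C2 * C3 * C4 * profile \<tau> a b B"
      unfolding cube_mean_eq[OF \<sigma> r ab B] profile_def x_def[symmetric] y_def[symmetric] z_def[symmetric]
      by (simp add: mult_ac)
  qed
qed

section \<open>The kernel on the cone as an average of G over the cube\<close>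

lemma cube_sets [measurable]: "cube \<in> sets M3"
  by (intro pair_measureI) auto

lemma cube_AE: "AE z in M3. z \<in> cube"
proof -
  have "AE p in Mv \<Otimes>\<^sub>M Mw. p \<in> {-1..1} \<times> {-1..1}"
  proof (rule VW.AE_pair_measure)
    show "{p \<in> space (Mv \<Otimes>\<^sub>M Mw). p \<in> {-1..1} \<times> {-1..1}} \<in> sets (Mv \<Otimes>\<^sub>M Mw)" by measurable
    show "AE x in Mv. AE y in Mw. (x, y) \<in> {-1..1} \<times> {-1..1}"
      using AE_Pi_measure by eventually_elim (use AE_Pi_measure in \<open>auto elim: eventually_mono\<close>)
  qed
  note VW = this
  show ?thesis
  proof (rule UVW.AE_pair_measure)
    show "{z \<in> space M3. z \<in> cube} \<in> sets M3" by measurable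
    show "AE x in Mu. AE y in Mv \<Otimes>\<^sub>M Mw. (x, y) \<in> cube"
      using AE_Pi_measure by eventually_elim (use VW in \<open>auto elim: eventually_mono\<close>)
  qed
qed

lemma cube_indicator: "(LINT z|M3. indicator cube z :: real) = 1"
proof -
  have "(LINT z|M3. indicator cube z :: real) = (LINT z|M3. 1)"
    using cube_AE by (intro integral_cong_AE) (auto elim!: eventually_mono)
  then show ?thesis using UVW.P.prob_space by simp
qed

lemma xi_measurable [measurable]: "xi a b B \<in> borel_measurable M3"
  unfolding xi_def case_prod_unfold by measurable

lemma abs_xi_le:
  assumes "0 \<le> b" "b \<le> a" "0 \<le> B" "z \<in> cube"
  shows "\<bar>xi a b B z\<bar> \<le> rad a b 1 + B"
proof -
  obtain u v1 v2 where z: "z = (u, v1, v2)" by (cases z)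
  have u: "u \<in> {-1..1}" "\<bar>v1\<bar> \<le> 1" "\<bar>v2\<bar> \<le> 1" using assms(4) by (auto simp: z)
  have "\<bar>v1\<bar> * rad a b u \<le> 1 * rad a b 1" using u assms rad_mono[of b u a] rad_nonneg[of b a u]
    by (intro mult_mono) auto
  moreover have "\<bar>v2\<bar> * B \<le> 1 * B" using u assms by (intro mult_right_mono) auto
  moreover have "\<bar>xi a b B z\<bar> \<le> \<bar>v1\<bar> * rad a b u + \<bar>v2\<bar> * B"
    using assms(3) rad_nonneg[OF assms(1,2) u(1)] abs_triangle_ineq[of "v1 * rad a b u" "v2 * B"]
    by (simp add: xi_def z abs_mult)
  ultimately show ?thesis by linarith
qed

definition heat :: "real \<Rightarrow> real \<Rightarrow> real \<Rightarrow> real \<Rightarrow> real" where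
  "heat t a b B = (\<Sum>n. exp (- t * S.ev (2 * n)) * (LINT z:cube|M3. S.Z (2 * n) (xi a b B z)))"

definition heat_density :: "real \<Rightarrow> real \<Rightarrow> real \<Rightarrow> real \<Rightarrow> real \<times> real \<times> real \<Rightarrow> real" where
  "heat_density t a b B z = indicator cube z * ((S.G t (xi a b B z) + S.G t (- xi a b B z)) / 2)"

text \<open>As \<bar>\<xi>\<bar> \<le> 1 on the cube, the terms have the summable bound exp(- t ev
  (2n)) Z (2n) 1 uniformly there, so sum and integral may be exchanged.\<close>

lemma heat_eq_integral:
  assumes t: "t > 0" and ab: "0 \<le> b" "b \<le> a" and B: "0 \<le> B" and X: "rad a b 1 + B \<le> 1"
  shows "integrable M3 (heat_density t a b B)" "heat t a b B = (LINT z|M3. heat_density t a b B z)"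
proof -
  define f where "f n z = indicator cube z * (exp (- t * S.ev (2 * n)) * S.Z (2 * n) (xi a b B z))" for n z
  have [measurable]: "S.Z n \<in> borel_measurable borel" for n
    by (intro borel_measurable_continuous_onI S.continuous_Z)
  have xi1: "xi a b B z \<in> {-1..1}" if "z \<in> cube" for z
    using abs_xi_le[OF ab B that] X by (simp add: abs_le_iff)
  have f_bound: "\<bar>f n z\<bar> \<le> exp (- t * S.ev (2 * n)) * S.Z (2 * n) 1" for n z
    using S.norm_G_term_le[OF xi1, of z t "2 * n"] S.Z_1_pos[of "2 * n"] by (auto simp: f_def indicator_def)
  have f_int: "integrable M3 (f n)" for n
    by (rule integrable_M3[OF _ f_bound]) (unfold f_def, measurable)
  have sum2: "summable (\<lambda>n. exp (- t * S.ev (2 * n)) * S.Z (2 * n) 1)"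
    using sums_summable[OF S.G_even_part[OF t, of 1]] by simp
  have norm_sum: "summable (\<lambda>n. norm (f n z))" for z
    by (rule summable_comparison_test'[OF sum2]) (use f_bound in simp)
  have int_norm: "summable (\<lambda>n. LINT z|M3. norm (f n z))"
  proof (rule summable_comparison_test'[OF sum2])
    fix n
    have "(LINT z|M3. norm (f n z)) \<le> (LINT z|M3. exp (- t * S.ev (2 * n)) * S.Z (2 * n) 1)"
      using f_int f_bound by (intro integral_mono) auto
    also have "\<dots> = exp (- t * S.ev (2 * n)) * S.Z (2 * n) 1"
      using UVW.P.prob_space by simp
    finally show "norm (LINT z|M3. norm (f n z)) \<le> exp (- t * S.ev (2 * n)) * S.Z (2 * n) 1"
      by (simp add: integral_nonneg)
  qed
  have suminf: "(\<Sum>n. f n z) = heat_density t a b B z" for z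
    using sums_unique[OF S.G_even_part[OF t xi1, of z]]
    by (auto simp: f_def heat_density_def indicator_def)
  show "integrable M3 (heat_density t a b B)"
    using integrable_suminf[OF f_int _ int_norm] norm_sum by (simp add: suminf)
  have "(LINT z|M3. heat_density t a b B z) = (\<Sum>n. LINT z|M3. f n z)"
    using integral_suminf[OF f_int _ int_norm] norm_sum by (simp add: suminf)
  also have "\<dots> = heat t a b B"
  proof -
    have "(LINT z|M3. f n z) = exp (- t * S.ev (2 * n)) * (LINT z:cube|M3. S.Z (2 * n) (xi a b B z))" for n
    proof -
      have "(LINT z|M3. f n z) = (LINT z|M3. exp (- t * S.ev (2 * n)) * (indicator cube z *\<^sub>R S.Z (2 * n) (xi a b B z)))"
        by (rule Bochner_Integration.integral_cong) (auto simp: f_def)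
      then show ?thesis unfolding set_lebesgue_integral_def by simp
    qed
    then show ?thesis by (simp add: heat_def)
  qed
  finally show "heat t a b B = (LINT z|M3. heat_density t a b B z)" ..
qed

lemma cube_mean_integrand:
  assumes "\<sigma> \<in> {1, -1}" "r \<ge> 0" "0 \<le> b" "b \<le> a" "0 \<le> B"
  shows "integrable M3 (\<lambda>z. indicator cube z * exp (- r * (rad a b 1 + B - \<sigma> * xi a b B z)))"
    and "cube_mean \<sigma> r a b B = (LINT z|M3. indicator cube z * exp (- r * (rad a b 1 + B - \<sigma> * xi a b B z)))"
proof -
  show "integrable M3 (\<lambda>z. indicator cube z * exp (- r * (rad a b 1 + B - \<sigma> * xi a b B z)))"
  proof (rule integrable_M3[of _ 1])
    show "(\<lambda>z. indicator cube z * exp (- r * (rad a b 1 + B - \<sigma> * xi a b B z))) \<in> borel_measurable M3"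
      by measurable
    fix z
    have "0 \<le> r * (rad a b 1 + B - \<sigma> * xi a b B z)" if "z \<in> cube"
      using abs_xi_le[OF assms(3,4,5) that] assms(1,2) by (intro mult_nonneg_nonneg) (auto simp: abs_le_iff)
    then show "\<bar>indicator cube z * exp (- r * (rad a b 1 + B - \<sigma> * xi a b B z))\<bar> \<le> 1"
      by (cases "z \<in> cube") auto
  qed
  show "cube_mean \<sigma> r a b B = (LINT z|M3. indicator cube z * exp (- r * (rad a b 1 + B - \<sigma> * xi a b B z)))"
    unfolding cube_mean_def set_lebesgue_integral_def
    by (rule Bochner_Integration.integral_cong) (auto simp: xi_def)
qed

text \<open>The lower bound discards the term at -\<xi>, which is nonnegative; the upper bound keeps
  both signs. At t = \<tau>/4 the rates 8/t and 1/(20t) become 32/\<tau> and (1/5)/\<tau>.\<close>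

lemma heat_small_time:
  obtains c C where "c > 0" "C > 0"
    "\<And>\<tau> a b B. 0 < \<tau> \<Longrightarrow> \<tau> \<le> 4 \<Longrightarrow> admissible a b B \<Longrightarrow> c * model \<tau> a b B \<le> heat (\<tau> / 4) a b B"
    "\<And>\<tau> a b B. 0 < \<tau> \<Longrightarrow> \<tau> \<le> 4 \<Longrightarrow> admissible a b B \<Longrightarrow> heat (\<tau> / 4) a b B \<le> C * model \<tau> a b B"
proof -
  define \<kappa> where "\<kappa> = 2 * \<alpha> + \<gamma> + 1"
  obtain c C where G: "c > 0" "C > 0"
    "\<And>t x X. 0 < t \<Longrightarrow> t \<le> 1 \<Longrightarrow> 0 \<le> X \<Longrightarrow> X \<le> 1 \<Longrightarrow> - 1 \<le> x \<Longrightarrow> x \<le> X \<Longrightarrow>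
      c * t powr (- \<kappa> - 1/2) * exp (- (arccos X)\<^sup>2 / (4 * t)) * exp (- (8 / t) * (X - x)) \<le> S.G t x"
    "\<And>t x X. 0 < t \<Longrightarrow> t \<le> 1 \<Longrightarrow> 0 \<le> X \<Longrightarrow> X \<le> 1 \<Longrightarrow> - 1 \<le> x \<Longrightarrow> x \<le> X \<Longrightarrow>
      S.G t x \<le> C * t powr (- \<kappa> - 1/2) * exp (- (arccos X)\<^sup>2 / (4 * t)) * exp (- (1 / (20 * t)) * (X - x))"
    unfolding \<kappa>_def by (rule S.G_sandwich) blast
  obtain c1 C1 where c1: "cube_mean_comparable 32 c1 C1"
    by (rule cube_mean_comparable_exists[of 32]) simp
  then have 1: "c1 > 0" "C1 > 0" by (simp_all add: cube_mean_comparable_def)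
  obtain c2 C2 where c2: "cube_mean_comparable (1/5) c2 C2"
    by (rule cube_mean_comparable_exists[of "1/5"]) simp
  then have 2: "c2 > 0" "C2 > 0" by (simp_all add: cube_mean_comparable_def)
  \<comment> \<open>The price of replacing \<tau>/4 by \<tau> in the power of t.\<close>
  define q where "q = (1/4 :: real) powr (- \<kappa> - 1/2)"
  have q: "q > 0" by (simp add: q_def)
  show ?thesis
  proof (rule that)
    show "c / 2 * q * c1 > 0" "C * q * C2 > 0" using G 1 2 q by simp_all
    fix \<tau> a b B :: real
    assume \<tau>: "0 < \<tau>" "\<tau> \<le> 4" and "admissible a b B"
    then have ab: "0 \<le> b" "b \<le> a" and B: "0 \<le> B" and X1: "rad a b 1 + B \<le> 1" by (auto simp: admissible_def)
    define X where "X = rad a b 1 + B"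
    have X: "0 \<le> X" "X \<le> 1" using X1 B rad_nonneg[OF ab, of 1] by (auto simp: X_def)
    define A where "A = \<tau> powr (- \<kappa> - 1/2) * exp (- (arccos X)\<^sup>2 / \<tau>)"
    have A: "A > 0" using \<tau> by (simp add: A_def)
    have t: "0 < \<tau> / 4" "\<tau> / 4 \<le> 1" using \<tau> by auto
    have "(1/4 * \<tau>) powr (- \<kappa> - 1/2) = q * \<tau> powr (- \<kappa> - 1/2)" unfolding q_def by (rule powr_mult)
    then have pw: "(\<tau> / 4) powr (- \<kappa> - 1/2) = q * \<tau> powr (- \<kappa> - 1/2)" by simp
    have lower: "c * q * A * exp (- (32 / \<tau>) * (X - x)) \<le> S.G (\<tau> / 4) x"
      and upper: "S.G (\<tau> / 4) x \<le> C * q * A * exp (- ((1/5) / \<tau>) * (X - x))" if "- 1 \<le> x" "x \<le> X" for x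
      using G(3)[OF t X that] G(4)[OF t X that] by (simp_all add: pw A_def mult.assoc)
    have xX: "- 1 \<le> xi a b B z" "xi a b B z \<le> X" "- 1 \<le> - xi a b B z" "- xi a b B z \<le> X" if "z \<in> cube" for z
      using abs_xi_le[OF ab B that] X by (auto simp: X_def abs_le_iff)
    note heat = heat_eq_integral[OF t(1) ab B X1]
    define E where "E k \<sigma> z = indicator cube z * exp (- (k / \<tau>) * (rad a b 1 + B - \<sigma> * xi a b B z))" for k \<sigma> z
    have E: "integrable M3 (E k \<sigma>)" "cube_mean \<sigma> (k / \<tau>) a b B = (LINT z|M3. E k \<sigma> z)"
      if "\<sigma> \<in> {1, -1}" "k > 0" for k \<sigma>
      using cube_mean_integrand[OF that(1) _ ab B, of "k / \<tau>"] that(2) \<tau> by (simp_all add: E_def[abs_def])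
    have "c / 2 * q * c1 * (A * profile \<tau> a b B) = c / 2 * q * A * (c1 * profile \<tau> a b B)" by simp
    also have "\<dots> \<le> c / 2 * q * A * cube_mean 1 (32 / \<tau>) a b B"
      using c1 G(1) q A \<tau> ab B by (intro mult_left_mono) (simp_all add: cube_mean_comparable_def)
    also have "\<dots> = (LINT z|M3. c / 2 * q * A * E 32 1 z)"
      by (simp add: E)
    also have "\<dots> \<le> (LINT z|M3. heat_density (\<tau> / 4) a b B z)"
    proof (rule integral_mono[OF _ heat(1)])
      show "integrable M3 (\<lambda>z. c / 2 * q * A * E 32 1 z)"
        by (intro integrable_mult_right E) simp_all
      fix z
      show "c / 2 * q * A * E 32 1 z \<le> heat_density (\<tau> / 4) a b B z"
      proof (cases "z \<in> cube")
        case True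
        have "0 \<le> c * q * A * exp (- (32 / \<tau>) * (X - (- xi a b B z)))" using G(1) q A by simp
        also have "\<dots> \<le> S.G (\<tau> / 4) (- xi a b B z)" by (intro lower xX True)
        finally have "0 \<le> S.G (\<tau> / 4) (- xi a b B z)" .
        moreover have "c * q * A * exp (- (32 / \<tau>) * (X - xi a b B z)) \<le> S.G (\<tau> / 4) (xi a b B z)"
          by (intro lower xX True)
        ultimately show ?thesis using True by (simp add: heat_density_def E_def X_def)
      qed (simp add: heat_density_def E_def)
    qed
    finally show "c / 2 * q * c1 * model \<tau> a b B \<le> heat (\<tau> / 4) a b B"
      unfolding heat(2) A_def X_def \<kappa>_def model_def .
    have "heat (\<tau> / 4) a b B \<le> (LINT z|M3. C / 2 * q * A * E (1/5) 1 z
      + C / 2 * q * A * E (1/5) (-1) z)"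
      unfolding heat(2)
    proof (rule integral_mono[OF heat(1)])
      show "integrable M3 (\<lambda>z. C / 2 * q * A * E (1/5) 1 z
        + C / 2 * q * A * E (1/5) (-1) z)"
        by (intro Bochner_Integration.integrable_add integrable_mult_right E) simp_all
      fix z
      show "heat_density (\<tau> / 4) a b B z \<le> C / 2 * q * A * E (1/5) 1 z
        + C / 2 * q * A * E (1/5) (-1) z"
      proof (cases "z \<in> cube")
        case True
        have "S.G (\<tau> / 4) (xi a b B z) \<le> C * q * A * exp (- ((1/5) / \<tau>) * (X - xi a b B z))"
          "S.G (\<tau> / 4) (- xi a b B z) \<le> C * q * A * exp (- ((1/5) / \<tau>) * (X - (- xi a b B z)))"
          by (intro upper xX True)+
        then show ?thesis using True by (simp add: heat_density_def E_def X_def)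
      qed (simp add: heat_density_def E_def)
    qed
    also have "\<dots> = C / 2 * q * A * cube_mean 1 ((1/5) / \<tau>) a b B + C / 2 * q * A * cube_mean (-1) ((1/5) / \<tau>) a b B"
      using E(2)[of 1 "1/5"] E(2)[of "-1" "1/5"]
      by (subst Bochner_Integration.integral_add) (simp_all add: E(1))
    also have "\<dots> \<le> C / 2 * q * A * (C2 * profile \<tau> a b B) + C / 2 * q * A * (C2 * profile \<tau> a b B)"
      using c2 G(2) q A \<tau> ab B by (intro add_mono mult_left_mono) (simp_all add: cube_mean_comparable_def)
    also have "\<dots> = C * q * C2 * (A * profile \<tau> a b B)" by simp
    finally show "heat (\<tau> / 4) a b B \<le> C * q * C2 * model \<tau> a b B"
      unfolding A_def X_def \<kappa>_def model_def .
  qed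
qed

lemma heat_large_time:
  obtains c C where "c > 0" "C > 0"
    "\<And>t a b B. 1 \<le> t \<Longrightarrow> admissible a b B \<Longrightarrow> c \<le> heat t a b B"
    "\<And>t a b B. 1 \<le> t \<Longrightarrow> admissible a b B \<Longrightarrow> heat t a b B \<le> C"
proof -
  obtain c C where G: "c > 0" "C > 0"
    "\<And>t w. 1 \<le> t \<Longrightarrow> w \<in> {-1..1} \<Longrightarrow> c \<le> S.G t w" "\<And>t w. 1 \<le> t \<Longrightarrow> w \<in> {-1..1} \<Longrightarrow> S.G t w \<le> C"
    by (rule S.G_large_time) blast
  show ?thesis
  proof (rule that[OF G(1,2)])
    fix t a b B :: real
    assume t: "1 \<le> t" and "admissible a b B"
    then have ab: "0 \<le> b" "b \<le> a" and B: "0 \<le> B" and X: "rad a b 1 + B \<le> 1" by (auto simp: admissible_def)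
    have t0: "t > 0" using t by simp
    note heat = heat_eq_integral[OF t0 ab B X]
    have xi1: "xi a b B z \<in> {-1..1}" "- xi a b B z \<in> {-1..1}" if "z \<in> cube" for z
      using abs_xi_le[OF ab B that] X by (auto simp: abs_le_iff)
    have d: "c * indicator cube z \<le> heat_density t a b B z" "heat_density t a b B z \<le> C * indicator cube z" for z
      using G(3,4)[OF t xi1(1), of z] G(3,4)[OF t xi1(2), of z] by (auto simp: heat_density_def indicator_def)
    have int: "integrable M3 (\<lambda>z. k * indicator cube z)" for k :: real
      by (intro integrable_mult_right integrable_real_indicator) (auto simp: UVW.P.emeasure_eq_measure)
    have "c * (LINT z|M3. indicator cube z) \<le> heat t a b B"
      unfolding heat(2) using integral_mono[OF int heat(1) d(1)] by simp
    then show "c \<le> heat t a b B" by (simp only: cube_indicator)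
    have "heat t a b B \<le> C * (LINT z|M3. indicator cube z)"
      unfolding heat(2) using integral_mono[OF heat(1) int d(2)] by simp
    then show "heat t a b B \<le> C" by (simp only: cube_indicator)
  qed
qed

end

text \<open>b^2 + (s \<bar>x\<bar> - t \<bar>y\<bar>)^2 = (st - \<bar>x\<bar> \<bar>y\<bar>)^2 gives
  b \<le> st - \<bar>x\<bar> \<bar>y\<bar>. Cauchy-Schwarz in its two directions then yields b \<le>
  a and a + b \<le> 2st.\<close>

lemma cone_point_bounds:
  fixes x y :: "real ^ 'd"
  assumes x: "norm x \<le> t" "t \<in> {0..1}" and y: "norm y \<le> s" "s \<in> {0..1}"
  defines "a \<equiv> s * t + x \<bullet> y" and "b \<equiv> sqrt (t\<^sup>2 - (norm x)\<^sup>2) * sqrt (s\<^sup>2 - (norm y)\<^sup>2)"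
  shows "0 \<le> b" "b \<le> a" "(a + b) / 2 \<le> s * t"
proof -
  have n: "(norm x)\<^sup>2 \<le> t\<^sup>2" "(norm y)\<^sup>2 \<le> s\<^sup>2" using x y by (auto intro!: power_mono)
  then show "0 \<le> b" by (simp add: b_def)
  have xy: "norm x * norm y \<le> t * s" using x y by (intro mult_mono) auto
  have "b\<^sup>2 = (t\<^sup>2 - (norm x)\<^sup>2) * (s\<^sup>2 - (norm y)\<^sup>2)" using n by (simp add: b_def power_mult_distrib)
  also have "\<dots> \<le> \<dots> + (s * norm x - t * norm y)\<^sup>2" by simp
  also have "\<dots> = (s * t - norm x * norm y)\<^sup>2" by (simp add: power2_eq_square algebra_simps)
  finally have "b\<^sup>2 \<le> (s * t - norm x * norm y)\<^sup>2" .
  then have b: "b \<le> s * t - norm x * norm y"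
    by (rule power2_le_imp_le) (use xy in \<open>simp add: mult.commute\<close>)
  have "\<bar>x \<bullet> y\<bar> \<le> norm x * norm y" by (rule Cauchy_Schwarz_ineq2)
  with b show "b \<le> a" "(a + b) / 2 \<le> s * t" by (auto simp: a_def)
qed

text \<open>The arithmetic-geometric mean inequality bounds the two terms by (s + t)/2 and 1 - (s +
  t)/2.\<close>

lemma cone_argument_le_1:
  fixes x y :: "real ^ 'd"
  assumes x: "norm x \<le> t" "t \<in> {0..1}" and y: "norm y \<le> s" "s \<in> {0..1}"
  shows "sqrt ((s * t + x \<bullet> y + sqrt (t\<^sup>2 - (norm x)\<^sup>2) * sqrt (s\<^sup>2 - (norm y)\<^sup>2)) / 2)
    + sqrt (1 - t) * sqrt (1 - s) \<le> 1"
proof -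
  have "sqrt ((s * t + x \<bullet> y + sqrt (t\<^sup>2 - (norm x)\<^sup>2) * sqrt (s\<^sup>2 - (norm y)\<^sup>2)) / 2) \<le> sqrt (s * t)"
    using cone_point_bounds(3)[OF x y] by (rule real_sqrt_le_mono)
  also have "\<dots> \<le> (s + t) / 2" using x y by (intro arith_geo_mean_sqrt) auto
  finally have "sqrt ((s * t + x \<bullet> y + sqrt (t\<^sup>2 - (norm x)\<^sup>2) * sqrt (s\<^sup>2 - (norm y)\<^sup>2)) / 2) \<le> (s + t) / 2" .
  moreover have "sqrt (1 - t) * sqrt (1 - s) \<le> ((1 - t) + (1 - s)) / 2"
    unfolding real_sqrt_mult[symmetric] using x y by (intro arith_geo_mean_sqrt) auto
  ultimately show ?thesis by (simp add: field_simps)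
qed

theorem theorem1p4:
  fixes \<mu> \<gamma> :: real
  assumes "CARD('d::finite) \<ge> 2" and "\<mu> \<ge> 0" and "\<gamma> \<ge> -1/2"
  shows "\<exists>C\<ge>1. \<forall>p\<in>solid_cone. \<forall>q\<in>(solid_cone :: ((real ^ 'd) \<times> real) set).
    (\<forall>\<tau>. 0 < \<tau> \<and> \<tau> \<le> 4 \<longrightarrow>
       inverse C * cone_K \<mu> \<gamma> \<tau> p q \<le> cone_heat_kernel \<mu> \<gamma> \<tau> p q \<and>
       cone_heat_kernel \<mu> \<gamma> \<tau> p q \<le> C * cone_K \<mu> \<gamma> \<tau> p q) \<and>
    (\<forall>\<tau>\<ge>4. inverse C \<le> cone_heat_kernel \<mu> \<gamma> \<tau> p q \<and> cone_heat_kernel \<mu> \<gamma> \<tau> p q \<le> C)"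
proof -
  define \<alpha> where "\<alpha> = cone_alpha TYPE('d) \<mu>"
  have \<alpha>: "\<alpha> \<ge> 1/2" "2 * \<alpha> = 2 * \<mu> + real CARD('d) - 1"
  proof -
    have "2 \<le> real CARD('d)" using assms(1) by simp
    then show "\<alpha> \<ge> 1/2" "2 * \<alpha> = 2 * \<mu> + real CARD('d) - 1"
      using assms(2) by (simp_all add: \<alpha>_def cone_alpha_def field_simps)
  qed
  interpret cone_kernel \<mu> \<alpha> \<gamma>
    using assms \<alpha>(1) by unfold_locales auto
  obtain c C where small: "c > 0" "C > 0"
    "\<And>\<tau> a b B. 0 < \<tau> \<Longrightarrow> \<tau> \<le> 4 \<Longrightarrow> admissible a b B \<Longrightarrow> c * model \<tau> a b B \<le> heat (\<tau> / 4) a b B"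
    "\<And>\<tau> a b B. 0 < \<tau> \<Longrightarrow> \<tau> \<le> 4 \<Longrightarrow> admissible a b B \<Longrightarrow> heat (\<tau> / 4) a b B \<le> C * model \<tau> a b B"
    by (rule heat_small_time) blast
  obtain c' C' where large: "c' > 0" "C' > 0"
    "\<And>t a b B. 1 \<le> t \<Longrightarrow> admissible a b B \<Longrightarrow> c' \<le> heat t a b B"
    "\<And>t a b B. 1 \<le> t \<Longrightarrow> admissible a b B \<Longrightarrow> heat t a b B \<le> C'"
    by (rule heat_large_time) blast
  define D where "D = Max {1, C, C', inverse c, inverse c'}"
  have D: "1 \<le> D" "C \<le> D" "C' \<le> D" "inverse c \<le> D" "inverse c' \<le> D"
    unfolding D_def by (intro Max_ge; simp)+
  have Dc: "inverse D \<le> c" "inverse D \<le> c'"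
    using le_imp_inverse_le[OF D(4)] le_imp_inverse_le[OF D(5)] small(1) large(1) by simp_all
  show ?thesis
  proof (intro exI[of _ D] conjI ballI D(1))
    fix p q :: "(real ^ 'd) \<times> real"
    assume pq: "p \<in> solid_cone" "q \<in> solid_cone"
    obtain x t where p: "p = (x, t)" by (cases p)
    obtain y s where q: "q = (y, s)" by (cases q)
    have x: "norm x \<le> t" "t \<in> {0..1}" and y: "norm y \<le> s" "s \<in> {0..1}"
      using pq by (auto simp: solid_cone_def p q)
    define a where "a = s * t + x \<bullet> y"
    define b where "b = sqrt (t\<^sup>2 - (norm x)\<^sup>2) * sqrt (s\<^sup>2 - (norm y)\<^sup>2)"
    define B where "B = sqrt (1 - t) * sqrt (1 - s)"
    have "0 \<le> b" "b \<le> a" unfolding a_def b_def by (rule cone_point_bounds[OF x y])+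
    moreover have "0 \<le> B" using x y by (simp add: B_def)
    moreover have "rad a b 1 + B \<le> 1"
      using cone_argument_le_1[OF x y] by (simp add: rad_def a_def b_def B_def)
    ultimately have adm: "admissible a b B" by (simp add: admissible_def)
    have dist: "cone_dist (x, t) (y, s) = arccos (rad a b 1 + B)"
      by (simp add: cone_dist_def rad_def a_def b_def B_def)
    have xi: "cone_xi p q u v1 v2 = xi a b B (u, v1, v2)" for u v1 v2
      by (simp add: cone_xi_def xi_def rad_def p q a_def b_def B_def mult.assoc)
    have P: "cone_P n \<mu> \<gamma> p q = (LINT z:cube|M3. S.Z (2 * n) (xi a b B z))" for n
      unfolding cone_P_def Let_def \<alpha>_def[symmetric] S.Z_def xi
      by (rule arg_cong[of _ _ "\<lambda>f. LINT z:cube|M3. f z"]) (auto simp: fun_eq_iff)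
    \<comment> \<open>Here \<kappa> = 2\<alpha> + \<gamma> + 1 equals 2\<mu> + \<gamma> + d, so ev
      (2n) = 4 n (n + 2\<mu> + \<gamma> + d).\<close>
    have heat: "cone_heat_kernel \<mu> \<gamma> \<tau> p q = heat (\<tau> / 4) a b B" for \<tau>
    proof -
      have "- \<tau> * real n * (real n + 2 * \<mu> + \<gamma> + real CARD('d)) = - (\<tau> / 4) * S.ev (2 * n)" for n
      proof -
        have k: "2 * (2 * \<alpha> + \<gamma> + 1) = 2 * (2 * \<mu> + \<gamma> + real CARD('d))" unfolding \<alpha>(2) by simp
        show ?thesis unfolding S.ev_def k by (simp add: field_simps)
      qed
      then show ?thesis by (simp only: cone_heat_kernel_def heat_def P)
    qed
    have K: "cone_K \<mu> \<gamma> \<tau> p q = model \<tau> a b B"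
      if \<tau>: "\<tau> > 0" for \<tau>
    proof -
      \<comment> \<open>Also valid for a = 0, where both sides are 0.\<close>
      have sb: "sqrt ((t\<^sup>2 - (norm x)\<^sup>2) * (s\<^sup>2 - (norm y)\<^sup>2) / a) = b / sqrt a"
        by (simp add: b_def real_sqrt_divide real_sqrt_mult)
      have m: "(max z \<tau> / \<tau>) powr e = max z \<tau> powr e * \<tau> powr (- e)" for z e
        using \<tau> by (simp add: powr_divide powr_minus_divide)
      define E where "E = exp (- (arccos (rad a b 1 + B))\<^sup>2 / \<tau>)"
      have "\<tau> powr (- (2 * \<alpha> + \<gamma> + 1) - 1/2) * E * profile \<tau> a b B =
        (\<tau> powr (- (2 * \<alpha> + \<gamma> + 1) - 1/2) * \<tau> powr (- (- \<gamma> - 1/2)) * \<tau> powr (- (- \<alpha>)) * \<tau> powr (- (- \<mu>)))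
        * max B \<tau> powr (- \<gamma> - 1/2) * max (sqrt a) \<tau> powr (- \<alpha>) * max (b / sqrt a) \<tau> powr (- \<mu>) * E"
        unfolding profile_def m by (simp only: mult_ac)
      \<comment> \<open>The exponents add up: -(2\<alpha> + \<gamma> + 1) - 1/2 + (\<gamma> + 1/2) +
        \<alpha> + \<mu> = -\<alpha> + \<mu> - 1.\<close>
      also have "\<tau> powr (- (2 * \<alpha> + \<gamma> + 1) - 1/2) * \<tau> powr (- (- \<gamma> - 1/2)) * \<tau> powr (- (- \<alpha>)) * \<tau> powr (- (- \<mu>))
        = \<tau> powr (- \<alpha> + \<mu> - 1)"
        unfolding powr_add[symmetric] by (rule arg_cong[of _ _ "\<lambda>e. \<tau> powr e"]) simp
      finally show ?thesis
        unfolding cone_K_def p q case_prod_conv Let_def \<alpha>_def[symmetric] a_def[symmetric] sb B_def[symmetric] dist E_def model_def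
        by simp
    qed
    show "\<forall>\<tau>. 0 < \<tau> \<and> \<tau> \<le> 4 \<longrightarrow> inverse D * cone_K \<mu> \<gamma> \<tau> p q \<le> cone_heat_kernel \<mu> \<gamma> \<tau> p q \<and>
       cone_heat_kernel \<mu> \<gamma> \<tau> p q \<le> D * cone_K \<mu> \<gamma> \<tau> p q"
    proof (intro allI impI)
      fix \<tau> :: real assume \<tau>: "0 < \<tau> \<and> \<tau> \<le> 4"
      have nn: "0 \<le> cone_K \<mu> \<gamma> \<tau> p q" using \<tau> K[of \<tau>] profile_nonneg[of \<tau> a b B] by (simp add: model_def)
      have "c * cone_K \<mu> \<gamma> \<tau> p q \<le> cone_heat_kernel \<mu> \<gamma> \<tau> p q"
        "cone_heat_kernel \<mu> \<gamma> \<tau> p q \<le> C * cone_K \<mu> \<gamma> \<tau> p q"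
        using \<tau> small(3,4)[OF _ _ adm, of \<tau>] by (simp_all only: K heat)
      then show "inverse D * cone_K \<mu> \<gamma> \<tau> p q \<le> cone_heat_kernel \<mu> \<gamma> \<tau> p q \<and>
         cone_heat_kernel \<mu> \<gamma> \<tau> p q \<le> D * cone_K \<mu> \<gamma> \<tau> p q"
        using mult_right_mono[OF Dc(1) nn] mult_right_mono[OF D(2) nn] by linarith
    qed
    show "\<forall>\<tau>\<ge>4. inverse D \<le> cone_heat_kernel \<mu> \<gamma> \<tau> p q \<and> cone_heat_kernel \<mu> \<gamma> \<tau> p q \<le> D"
    proof (intro allI impI)
      fix \<tau> :: real assume \<tau>: "4 \<le> \<tau>"
      show "inverse D \<le> cone_heat_kernel \<mu> \<gamma> \<tau> p q \<and> cone_heat_kernel \<mu> \<gamma> \<tau> p q \<le> D"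
        using large(3,4)[OF _ adm, of "\<tau> / 4"] \<tau> Dc(2) D(3) by (simp add: heat)
    qed
  qed
qed

end
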